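(* Let $\mathfrak g\in\{\mathfrak{sl}_\infty(\mathbb C),\mathfrak{so}_\infty(\mathbb C),\mathfrak{sp}_\infty(\mathbb C)\}$ with root system $\Phi\in\{A_\infty,B_\infty,C_\infty,D_\infty\}$ relative to the splitting Cartan subalgebra $\mathfrak h$, let $\prec$ be an admissible linear order (see context), let $\mathfrak n=\bigoplus_{\alpha\in\Phi^+}\mathfrak g^\alpha$ be the corresponding locally nilpotent radical, and let $\mathcal B$ be the Kostant cascade of $\mathfrak n$ (possibly empty, finite or infinite). If $\Phi=A_\infty$ or $C_\infty$, then the center $Z(\mathfrak n)$ of $U(\mathfrak n)$ is generated as an algebra by the elements $\Delta_q$, $1\le q\le|\mathcal B|$; if $\Phi=B_\infty$ or $D_\infty$, then $Z(\mathfrak n)$ is generated by the elements $P_q$, $1\le q\le |\mathcal B|$. These generators are algebraically independent, so $Z(\mathfrak n)$ is a polynomial ring in $|\mathcal B|$ variables (and $Z(\mathfrak n)=\mathbb C$ if $\mathcal B=\emptyset$).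
   Context: Notation: $\mathfrak g=\bigcup_n\mathfrak g_n$ is a union of simple Lie algebras of rank $n$ of one fixed classical type, $\mathfrak h=\bigcup\mathfrak h_n$ a nested union of Cartan subalgebras (splitting Cartan subalgebra), $\mathfrak g=\mathfrak h\oplus\bigoplus_{\alpha\in\Phi}\mathfrak g^\alpha$. The root systems are $A_\infty=\pm\{\epsilon_i-\epsilon_j: i<j\}$, $B_\infty=A_\infty\cup\pm\{\epsilon_i+\epsilon_j:i<j\}\cup\pm\{\epsilon_i\}$, $C_\infty=A_\infty\cup\pm\{\epsilon_i+\epsilon_j:i<j\}\cup\pm\{2\epsilon_i\}$, $D_\infty=A_\infty\cup\pm\{\epsilon_i+\epsilon_j:i<j\}$, indices in $\mathbb Z_{>0}$. Admissible orders: for $A_\infty$, any linear order $\prec$ on $\{\epsilon_i\}$; for $B_\infty,C_\infty$, any linear order on $\{0\}\cup\{\pm\epsilon_i\}$ reversed by multiplication by $-1$; for $D_\infty$, such an order with the extra property that a minimal positive element, if it exists, is some $\epsilon_i$. Put $\vartheta_i=\epsilon_i$ if $\epsilon_i\succ0$ (and always for $A_\infty$) and $\vartheta_i=-\epsilon_i$ if $\epsilon_i\prec0$. Positive roots: $A_\infty^+=\{\vartheta_i-\vartheta_j:\vartheta_i\succ\vartheta_j\}$; $B^+_\infty$, $C^+_\infty$, $D^+_\infty$ consist of $\vartheta_i\pm\vartheta_j$ ($\vartheta_i\succ\vartheta_j$) together with $\vartheta_i$ (for $B$), $2\vartheta_i$ (for $C$), nothing more (for $D$). $\mathfrak n=\bigoplus_{\alpha\in\Phi^+}\mathfrak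 g^\alpha$. Kostant cascade: $\mathcal N_0=\emptyset$ and for $k\ge1$: for $A_\infty$, $\mathcal N_k=\mathcal N_{k-1}\cup\{i,j\}$ if the set $\{\vartheta_s:s\notin\mathcal N_{k-1}\}$ has a maximal element $\vartheta_i$ and a minimal element $\vartheta_j$; for $C_\infty$, $\mathcal N_k=\mathcal N_{k-1}\cup\{i\}$ if $\{\vartheta_s:s\notin\mathcal N_{k-1}\}$ has a maximal element $\vartheta_i$; for $B_\infty,D_\infty$, $\mathcal N_k=\mathcal N_{k-1}\cup\{i,j\}$ if $\{\vartheta_s:s\notin\mathcal N_{k-1}\}$ has a maximal element $\vartheta_i$ and $\{\vartheta_s:s\notin\mathcal N_{k-1}\cup\{i\}\}$ has a maximal element $\vartheta_j$; otherwise $\mathcal N_k=\mathcal N_{k-1}$. Whenever $\mathcal N_{k-1}\subsetneq\mathcal N_k$ set $\beta_k=\vartheta_i-\vartheta_j$ ($A_\infty$, $\vartheta_i\succ\vartheta_j$), $\beta_k=\vartheta_i+\vartheta_j$ ($B_\infty,D_\infty$), $\beta_k=2\vartheta_i$ ($C_\infty$); $\mathcal B$ is the set of all such $\beta_k$. Root vectors: for the finite-dimensional $\mathfrak n_n$ (strictly upper triangular matrices in $\mathfrak{sl}_n$, $\mathfrak{so}_{2n+1}$, $\mathfrak{sp}_{2n}$, $\mathfrak{so}_{2n}$ in the standard realization with basis $e_1,\dots,e_n,(e_0),e_{-n},\dots,e_{-1}$) use $e_{\epsilon_i-\epsilon_j}=E_{ij}$ (type A), $e_{\epsilon_i-\epsilon_j}=E_{ij}-E_{-j,-i}$,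 $e_{\epsilon_i+\epsilon_j}=E_{i,-j}-E_{j,-i}$ (types B, D), $e_{\epsilon_i+\epsilon_j}=E_{i,-j}+E_{j,-i}$, $e_{2\epsilon_i}=E_{i,-i}$ (type C), with $E_{ab}$ elementary matrices. For a finite $M=\{a_1,\dots,a_n\}\subset\mathbb Z_{>0}$ with $\vartheta_{a_1}\succ\dots\succ\vartheta_{a_n}$ let $j_M$ send $\epsilon_r\mapsto\vartheta_{a_r}$ and $\mathfrak n_M=\bigoplus\{\mathfrak g^\alpha:\alpha\in\Phi^+\cap\mathrm{span}(\epsilon_i,i\in M)\}$. Root vectors $f_\alpha\in\mathfrak g^\alpha$ ($\alpha\in\Phi^+$) are fixed so that for every finite $M$ the map $e_\alpha\mapsto f_{j_M(\alpha)}$ is a Lie algebra isomorphism $\mathfrak n_{|M|}\to\mathfrak n_M$. Generators: for $q\le|\mathcal B|$: (A) write $\mathcal N_q=\{i_1,\dots,i_q,j_1,\dots,j_q\}$ with $\vartheta_{i_1}\succ\dots\succ\vartheta_{i_q}\succ\vartheta_{j_q}\succ\dots\succ\vartheta_{j_1}$ and set $\Delta_q=\det\big(f_{\vartheta_{i_r}-\vartheta_{j_{q+1-s}}}\big)_{r,s=1}^q$; (C) write $\mathcal N_q=\{i_1,\dots,i_q\}$, $\vartheta_{i_1}\succ\dots\succ\vartheta_{i_q}$, and $\Delta_q=\det(x_{rs})_{r,s=1}^q$ with $x_{rs}=f_{\vartheta_{i_r}+\vartheta_{i_{q+1-s}}}$ if $r\ne q+1-s$ and $x_{rs}=2f_{2\vartheta_{i_r}}$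 if $r=q+1-s$; (B, D) write $\mathcal N_q=\{a_1,\dots,a_{2q}\}$ with $\vartheta_{a_1}\succ\dots\succ\vartheta_{a_{2q}}$ and let $P_q$ be the Pfaffian of the skew-symmetric $2q\times 2q$ matrix with $(r,s)$ entry $f_{\vartheta_{a_r}+\vartheta_{a_s}}$ for $r<s$ (so the monomial $f_{\vartheta_{a_1}+\vartheta_{a_2}}\cdots f_{\vartheta_{a_{2q-1}}+\vartheta_{a_{2q}}}$ has coefficient $1$). All entries in each of these expressions commute in $U(\mathfrak n)$, so they are well-defined elements of $U(\mathfrak n)$. *)

theory Defs
  imports Complex_Main "HOL-Combinatorics.Permutations" "HOL-Library.Poly_Mapping"
begin

datatype rtype = TA | TB | TC | TD

text \<open>An admissible order is encoded as a strict relation r on int.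
 Type A: r is a strict linear order on the positive integers; i stands for epsilon_i.
 Types B, C, D: r is a strict linear order on all of int, where 0 stands for 0,
 i > 0 stands for epsilon_i and -i stands for -epsilon_i; r is reversed by negation.
 Type D additionally: a minimal element of the set of positive elements
 (elements above 0), if it exists, is some epsilon_i, i.e. a positive integer.
 (a,b) in r means a is below b.\<close>

definition admissible :: "rtype \<Rightarrow> int rel \<Rightarrow> bool" where
  "admissible t r \<longleftrightarrow>
     (if t = TA then r \<subseteq> {i. 0 < i} \<times> {i. 0 < i} \<and> strict_linear_order_on {i. 0 < i} r
      else strict_linear_order_on UNIV r \<and> (\<forall>a b. (a, b) \<in> r \<longleftrightarrow> (-b, -a) \<in> r) \<and>
        (t = TD \<longrightarrow> (\<forall>m. (0, m) \<in> r \<and> (\<forall>x. (0, x) \<in> r \<longrightarrow> x = m \<or> (m, x) \<in> r) \<longrightarrow> 0 < m)))"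

text \<open>theta_i as a signed index: theta_i = epsilon_i (i) or -epsilon_i (-i).\<close>
definition sig :: "rtype \<Rightarrow> int rel \<Rightarrow> nat \<Rightarrow> int" where
  "sig t r i = (if t = TA \<or> (0, int i) \<in> r then int i else - int i)"

definition thgt :: "rtype \<Rightarrow> int rel \<Rightarrow> nat \<Rightarrow> nat \<Rightarrow> bool" where
  "thgt t r a b \<longleftrightarrow> (sig t r b, sig t r a) \<in> r"

text \<open>D a b: theta_a - theta_b (theta_a above theta_b);
 S a b: theta_a + theta_b (a, b distinct, theta_a above theta_b);
 L a: 2 theta_a (type C); H a: theta_a (type B).\<close>
datatype gen = D nat nat | S nat nat | L nat | H nat

definition Gens :: "rtype \<Rightarrow> int rel \<Rightarrow> gen set" where
  "Gens t r =
     {D a b |a b. 0 < a \<and> 0 < b \<and> thgt t r a b}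
   \<union> {S a b |a b. t \<noteq> TA \<and> 0 < a \<and> 0 < b \<and> thgt t r a b}
   \<union> {L a |a. t = TC \<and> 0 < a}
   \<union> {H a |a. t = TB \<and> 0 < a}"

text \<open>Elements are coefficient functions on words; the product is concatenation convolution.\<close>
type_synonym 'g fa = "'g list \<Rightarrow> complex"

definition fzero :: "'g fa" where "fzero = (\<lambda>w. 0)"
definition fone :: "'g fa" where "fone = (\<lambda>w. if w = [] then 1 else 0)"
definition fgen :: "'g \<Rightarrow> 'g fa" where "fgen g = (\<lambda>w. if w = [g] then 1 else 0)"
definition fadd :: "'g fa \<Rightarrow> 'g fa \<Rightarrow> 'g fa" where "fadd p q = (\<lambda>w. p w + q w)"
definition fsub :: "'g fa \<Rightarrow> 'g fa \<Rightarrow> 'g fa" where "fsub p q = (\<lambda>w. p w - q w)"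
definition fscale :: "complex \<Rightarrow> 'g fa \<Rightarrow> 'g fa" where "fscale c p = (\<lambda>w. c * p w)"
definition fmul :: "'g fa \<Rightarrow> 'g fa \<Rightarrow> 'g fa" where
  "fmul p q = (\<lambda>w. \<Sum>k\<le>length w. p (take k w) * q (drop k w))"
definition fsum :: "'i set \<Rightarrow> ('i \<Rightarrow> 'g fa) \<Rightarrow> 'g fa" where
  "fsum A f = (\<lambda>w. \<Sum>x\<in>A. f x w)"
definition fprod :: "'g fa list \<Rightarrow> 'g fa" where
  "fprod xs = foldr fmul xs fone"
definition fpow :: "'g fa \<Rightarrow> nat \<Rightarrow> 'g fa" where
  "fpow p n = fprod (replicate n p)"

definition FA :: "'g set \<Rightarrow> 'g fa set" where
  "FA G = {p. finite {w. p w \<noteq> 0} \<and> (\<forall>w. p w \<noteq> 0 \<longrightarrow> set w \<subseteq> G)}"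

inductive_set fideal :: "'g set \<Rightarrow> 'g fa set \<Rightarrow> 'g fa set" for G Rel where
  fideal_zero: "fzero \<in> fideal G Rel"
| fideal_step: "\<lbrakk>x \<in> Rel; a \<in> FA G; b \<in> FA G; p \<in> fideal G Rel\<rbrakk>
     \<Longrightarrow> fadd (fscale c (fmul (fmul a x) b)) p \<in> fideal G Rel"

inductive_set falg :: "'g fa set \<Rightarrow> 'g fa set" for A where
  falg_one: "fone \<in> falg A"
| falg_gen: "x \<in> A \<Longrightarrow> x \<in> falg A"
| falg_add: "x \<in> falg A \<Longrightarrow> y \<in> falg A \<Longrightarrow> fadd x y \<in> falg A"
| falg_scale: "x \<in> falg A \<Longrightarrow> fscale c x \<in> falg A"
| falg_mul: "x \<in> falg A \<Longrightarrow> y \<in> falg A \<Longrightarrow> fmul x y \<in> falg A"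

text \<open>These are the brackets of the standard root vectors of the finite-dimensional
 n_n transported by j_M (positions ordered by theta). For type B the short root vector
 is taken as E_{i,0} - E_{0,-i}.\<close>

definition dl :: "nat \<Rightarrow> nat \<Rightarrow> complex" where "dl i j = (if i = j then 1 else 0)"

text \<open>vv a b is e_{theta_a + theta_b} extended: antisymmetric with vv a a = 0 in types B, D;
 symmetric with vv a a = 2 f_{2 theta_a} in type C.\<close>
definition vv :: "rtype \<Rightarrow> int rel \<Rightarrow> nat \<Rightarrow> nat \<Rightarrow> gen fa" where
  "vv t r a b =
     (if a = b then (if t = TC then fscale 2 (fgen (L a)) else fzero)
      else if thgt t r a b then fgen (S a b)
      else if t = TC then fgen (S b a) else fscale (-1) (fgen (S b a)))"

fun br :: "rtype \<Rightarrow> int rel \<Rightarrow> gen \<Rightarrow> gen \<Rightarrow> gen fa" where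
  "br t r (D i j) (D k l) = fsub (fscale (dl j k) (fgen (D i l))) (fscale (dl l i) (fgen (D k j)))"
| "br t r (D i j) (S k l) =
     fadd (fscale (dl j k) (vv t r i l)) (fscale ((if t = TC then 1 else -1) * dl j l) (vv t r i k))"
| "br t r (S k l) (D i j) =
     fscale (-1) (fadd (fscale (dl j k) (vv t r i l)) (fscale ((if t = TC then 1 else -1) * dl j l) (vv t r i k)))"
| "br t r (D i j) (L k) = fscale (dl j k) (vv t r i k)"
| "br t r (L k) (D i j) = fscale (- dl j k) (vv t r i k)"
| "br t r (D i j) (H k) = fscale (dl j k) (fgen (H i))"
| "br t r (H k) (D i j) = fscale (- dl j k) (fgen (H i))"
| "br t r (H i) (H k) = fscale (-1) (vv t r i k)"
| "br t r _ _ = fzero"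

definition URel :: "rtype \<Rightarrow> int rel \<Rightarrow> gen fa set" where
  "URel t r = {fsub (fsub (fmul (fgen g) (fgen h)) (fmul (fgen h) (fgen g))) (br t r g h)
               |g h. g \<in> Gens t r \<and> h \<in> Gens t r}"

text \<open>U(n) = FA (Gens) / UJ.\<close>
definition UJ :: "rtype \<Rightarrow> int rel \<Rightarrow> gen fa set" where
  "UJ t r = fideal (Gens t r) (URel t r)"

definition Zc :: "rtype \<Rightarrow> int rel \<Rightarrow> gen fa set" where
  "Zc t r = {z \<in> FA (Gens t r). \<forall>y \<in> FA (Gens t r). fsub (fmul z y) (fmul y z) \<in> UJ t r}"

definition ismax :: "rtype \<Rightarrow> int rel \<Rightarrow> nat set \<Rightarrow> nat \<Rightarrow> bool" where
  "ismax t r R i \<longleftrightarrow> i \<in> R \<and> (\<forall>s \<in> R. s \<noteq> i \<longrightarrow> thgt t r i s)"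
definition ismin :: "rtype \<Rightarrow> int rel \<Rightarrow> nat set \<Rightarrow> nat \<Rightarrow> bool" where
  "ismin t r R j \<longleftrightarrow> j \<in> R \<and> (\<forall>s \<in> R. s \<noteq> j \<longrightarrow> thgt t r s j)"

primrec casc :: "rtype \<Rightarrow> int rel \<Rightarrow> nat \<Rightarrow> nat set" where
  "casc t r 0 = {}"
| "casc t r (Suc k) =
    (let R = {s. 0 < s} - casc t r k in
     if t = TA then
       (if (\<exists>i. ismax t r R i) \<and> (\<exists>j. ismin t r R j)
        then casc t r k \<union> {THE i. ismax t r R i, THE j. ismin t r R j} else casc t r k)
     else if t = TC then
       (if (\<exists>i. ismax t r R i) then insert (THE i. ismax t r R i) (casc t r k) else casc t r k)
     else
       (if (\<exists>i. ismax t r R i \<and> (\<exists>j. ismax t r (R - {i}) j))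
        then (let i = THE i. ismax t r R i in casc t r k \<union> {i, THE j. ismax t r (R - {i}) j})
        else casc t r k))"

text \<open>The indices q with 1 <= q <= |B| (a new cascade root beta_q appears at step q).\<close>
definition cindex :: "rtype \<Rightarrow> int rel \<Rightarrow> nat set" where
  "cindex t r = {q. 1 \<le> q \<and> casc t r (q - 1) \<noteq> casc t r q}"

definition thsort :: "rtype \<Rightarrow> int rel \<Rightarrow> nat set \<Rightarrow> nat list" where
  "thsort t r M = (THE xs. set xs = M \<and> distinct xs \<and> sorted_wrt (thgt t r) xs)"

text \<open>Determinant (products taken in row order; the entries commute in U(n)).\<close>
definition fdet :: "nat \<Rightarrow> (nat \<Rightarrow> nat \<Rightarrow> 'g fa) \<Rightarrow> 'g fa" where
  "fdet n M = fsum {p. p permutes {..<n}}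
     (\<lambda>p. fscale (of_int (sign p)) (fprod (map (\<lambda>i. M i (p i)) [0..<n])))"

text \<open>Pfaffian of a skew-symmetric 2n x 2n matrix (coefficient of A01 A23 ... is 1).\<close>
definition fpf :: "nat \<Rightarrow> (nat \<Rightarrow> nat \<Rightarrow> 'g fa) \<Rightarrow> 'g fa" where
  "fpf n A = fscale (1 / (2 ^ n * fact n)) (fsum {p. p permutes {..<2*n}}
     (\<lambda>p. fscale (of_int (sign p)) (fprod (map (\<lambda>i. A (p (2*i)) (p (2*i+1))) [0..<n]))))"

definition cgen :: "rtype \<Rightarrow> int rel \<Rightarrow> nat \<Rightarrow> gen fa" where
  "cgen t r q =
    (let Ls = thsort t r (casc t r q) in
     if t = TA then fdet q (\<lambda>i j. fgen (D (Ls ! i) (Ls ! (q + j))))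
     else if t = TC then fdet q (\<lambda>i j. vv t r (Ls ! i) (Ls ! (q - 1 - j)))
     else fpf q (\<lambda>i j. if i < j then fgen (S (Ls ! i) (Ls ! j))
                       else if j < i then fscale (-1) (fgen (S (Ls ! j) (Ls ! i))) else fzero))"

definition fmono :: "rtype \<Rightarrow> int rel \<Rightarrow> (nat \<Rightarrow>\<^sub>0 nat) \<Rightarrow> gen fa" where
  "fmono t r e = fprod (map (\<lambda>q. fpow (cgen t r q) (Poly_Mapping.lookup e q)) (sorted_list_of_set (Poly_Mapping.keys e)))"

definition peval :: "rtype \<Rightarrow> int rel \<Rightarrow> ((nat \<Rightarrow>\<^sub>0 nat) \<Rightarrow>\<^sub>0 complex) \<Rightarrow> gen fa" where
  "peval t r c = fsum (Poly_Mapping.keys c) (\<lambda>e. fscale (Poly_Mapping.lookup c e) (fmono t r e))"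

end

theory Submission
  imports Defs "HOL-Analysis.Analysis" "HOL-Computational_Algebra.Polynomial" "HOL-Library.Multiset"
begin

text \<open>
  Let z be central of degree at most d. The symbol of z is a polynomial function F on the dual of
  the nilpotent algebra, annihilated by the adjoint action. Only a fragment of the
  Poincare-Birkhoff-Witt theorem is needed for this: coefficients of the defining representation
  kill the relations, products of such functionals (dual to the shuffle coproduct) still do,
  and a d-fold product only sees the component of degree d.

  Since F involves finitely many variables while the index set is infinite, moving an index to one that
  does not occur shows that F depends only on the entries of a skew-symmetric (A, B, D) or symmetric
  (C) matrix whose indices have finitely many predecessors (or, in type A, successors). These entries
  commute, and F is invariant under unipotent congruences. Gaussian elimination
  moves a generic matrix to the one supported on the cascade roots, with pivots given by the ratios of consecutive
  generators. So F is a Laurent polynomial in the generators; letting one pivot tend to 0 while the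
  matrix stays bounded shows that it is a polynomial. Subtracting the corresponding
  polynomial in the generators lowers the degree of z. The same evaluation on cascade matrices
  gives algebraic independence.
\<close>

section \<open>The free algebra\<close>

text \<open>A central element has an invariant symbol, but in the enveloping algebra, which is not
  graded, the converse is clear only up to lower order. The gap closes because the surviving
  coordinates span an abelian ideal, where reordering costs nothing. To treat the four types
  together, the rectangular matrix of type A is placed in an off-diagonal block of a skew form, so
  that row and column operations become congruences; one sign \<open>eps\<close> then separates type
  C from the rest. After elimination an invariant is a polynomial in the pivots d_0, d_1, ..., and
  the generator of index q is a nonzero constant times d_0 ... d_(q-1). A monomial in the pivots is
  a polynomial in the generators exactly when its exponents decrease weakly; the degeneration of a
  pivot provides this inequality. Only finitely many coordinates occur at a time, so elimination
  runs over a finite set of indices, and the cascade is followed until every coordinate that occurs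
  has an index in it.\<close>

text \<open>A type copy of the coefficient functions, so that they form a ring with unit.\<close>

typedef 'g nc = "UNIV :: 'g fa set" morphisms cf nc by simp

setup_lifting type_definition_nc

lemma nc_eqI: "(\<And>w. cf p w = cf q w) \<Longrightarrow> p = q"
  by (metis cf_inverse ext)

lemma cf_nc [simp]: "cf (nc p) = p" by (simp add: nc_inverse)

lemma fmul_Nil: "fmul p q [] = p [] * q []"
  by (simp add: fmul_def)

lemma fmul_Cons: "fmul p q (a # w) = p [] * q (a # w) + fmul (\<lambda>u. p (a # u)) q w"
  unfolding fmul_def by (simp add: sum.atMost_Suc_shift del: sum.atMost_Suc)

lemma fmul_apply_lin:
  "fmul (\<lambda>u. c * p u + q u) s w = c * fmul p s w + fmul q s w"
  by (simp add: fmul_def algebra_simps sum.distrib sum_distrib_left)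

text \<open>Splitting off the first letter turns \<open>fmul\<close> into a product rule for the
  left derivative \<open>\<lambda>u. p (a # u)\<close>; the induction on the word needs
  \<open>p\<close> arbitrary because it passes to that derivative.\<close>

lemma fmul_assoc: "fmul (fmul p q) s w = fmul p (fmul q s) w"
proof (induction w arbitrary: p)
  case Nil then show ?case by (simp add: fmul_Nil)
next
  case (Cons a w)
  have "fmul (fmul p q) s (a # w) = p [] * q [] * s (a # w) +
      fmul (\<lambda>u. p [] * q (a # u) + fmul (\<lambda>u. p (a # u)) q u) s w"
    by (simp add: fmul_Cons fmul_Nil)
  also have "\<dots> = p [] * q [] * s (a # w) + p [] * fmul (\<lambda>u. q (a # u)) s w
      + fmul (fmul (\<lambda>u. p (a # u)) q) s w"
    by (subst fmul_apply_lin) (simp add: algebra_simps)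
  also have "\<dots> = fmul p (fmul q s) (a # w)"
    by (simp add: fmul_Cons Cons.IH algebra_simps)
  finally show ?case .
qed

lemma fmul_zero_fun: "fmul (\<lambda>u. 0) p w = 0"
  by (simp add: fmul_def)

lemma fmul_one_left: "fmul fone p w = p w"
  by (cases w) (simp_all add: fmul_Nil fmul_Cons fone_def fmul_zero_fun)

lemma fmul_one_right: "fmul p fone w = p w"
  by (induction w arbitrary: p) (simp_all add: fmul_Nil fmul_Cons, simp_all add: fone_def)

instantiation nc :: (type) ring_1
begin
lift_definition zero_nc :: "'a nc" is fzero .
lift_definition one_nc :: "'a nc" is fone .
lift_definition plus_nc :: "'a nc \<Rightarrow> 'a nc \<Rightarrow> 'a nc" is fadd .
lift_definition minus_nc :: "'a nc \<Rightarrow> 'a nc \<Rightarrow> 'a nc" is fsub .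
lift_definition uminus_nc :: "'a nc \<Rightarrow> 'a nc" is "fscale (-1)" .
lift_definition times_nc :: "'a nc \<Rightarrow> 'a nc \<Rightarrow> 'a nc" is fmul .
instance
proof
  fix a b c :: "'a nc"
  show "a + b + c = a + (b + c)" "a + b = b + a" "0 + a = a" "- a + a = 0" "a - b = a + - b"
    by (transfer; simp add: fadd_def fsub_def fscale_def fzero_def fun_eq_iff)+
  show "a * b * c = a * (b * c)" "1 * a = a" "a * 1 = a"
    by (transfer; simp add: fmul_assoc fmul_one_left fmul_one_right fun_eq_iff)+
  show "(a + b) * c = a * c + b * c" "a * (b + c) = a * b + a * c"
    by (transfer; simp add: fmul_def fadd_def fun_eq_iff algebra_simps sum.distrib)+
  show "0 \<noteq> (1 :: 'a nc)"
    by (transfer; auto simp: fzero_def fone_def fun_eq_iff)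
qed
end

lift_definition sc :: "complex \<Rightarrow> 'g nc \<Rightarrow> 'g nc" is fscale .
lift_definition wd :: "'g list \<Rightarrow> 'g nc" is "\<lambda>w u. if u = w then 1 else 0" .

lemma cf_0 [simp]: "cf 0 w = 0" by transfer (simp add: fzero_def)
lemma cf_add [simp]: "cf (p + q) w = cf p w + cf q w" by transfer (simp add: fadd_def)
lemma cf_minus [simp]: "cf (- p) w = - cf p w" by transfer (simp add: fscale_def)
lemma cf_diff [simp]: "cf (p - q) w = cf p w - cf q w" by transfer (simp add: fsub_def)
lemma cf_sc [simp]: "cf (sc c p) w = c * cf p w" by transfer (simp add: fscale_def)
lemma cf_wd: "cf (wd u) w = (if w = u then 1 else 0)" by transfer simp
lemma cf_mul: "cf (p * q) = fmul (cf p) (cf q)" by transfer simp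
lemma cf_sum: "cf (\<Sum>i\<in>A. f i) w = (\<Sum>i\<in>A. cf (f i) w)"
  by (induction A rule: infinite_finite_induct) auto

lemma nc_simps:
  "nc fzero = 0" "nc fone = wd []" "nc (fadd a b) = nc a + nc b" "nc (fsub a b) = nc a - nc b"
  "nc (fscale c a) = sc c (nc a)" "nc (fmul a b) = nc a * nc b" "nc (fgen g) = wd [g]"
  by (rule nc_eqI;
      simp add: fzero_def fone_def fadd_def fsub_def fscale_def fgen_def cf_wd cf_mul)+

lemma nc_fsum: "nc (fsum A f) = (\<Sum>i\<in>A. nc (f i))"
  by (rule nc_eqI) (simp add: fsum_def cf_sum)

lemma wd_Nil: "wd [] = 1"
  by transfer (simp add: fone_def fun_eq_iff)

lemma nc_fprod: "nc (fprod ps) = prod_list (map nc ps)"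
  by (induction ps) (simp_all add: fprod_def nc_simps wd_Nil)

lemma sc_simps [simp]:
  "sc c (p + q) = sc c p + sc c q"
  "sc c (p - q) = sc c p - sc c q"
  "sc c (- p) = - sc c p"
  "sc c 0 = 0" "sc 0 p = 0" "sc 1 p = p" "sc (-1) p = - p"
  "sc c (sc d p) = sc (c * d) p"
  by (rule nc_eqI; simp add: algebra_simps)+

lemma sc_add_left: "sc (c + d) p = sc c p + sc d p"
  by (rule nc_eqI; simp add: algebra_simps)

lemma sc_sum_left: "sc (\<Sum>i\<in>A. c i) p = (\<Sum>i\<in>A. sc (c i) p)"
  by (induction A rule: infinite_finite_induct) (auto simp: sc_add_left)

lemma mul_sc [simp]: "sc c p * q = sc c (p * q)" "p * sc c q = sc c (p * q)"
  by (rule nc_eqI; simp add: cf_mul fmul_def sum_distrib_left algebra_simps)+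

lemma wd_append: "wd u * wd v = wd (u @ v)"
proof (induction u)
  case Nil then show ?case by (simp add: wd_Nil)
next
  case (Cons a u)
  have c: "wd [a] * wd u = wd (a # u)" for u :: "'a list"
  proof (rule nc_eqI)
    fix w show "cf (wd [a] * wd u) w = cf (wd (a # u)) w"
    proof (cases w)
      case Nil then show ?thesis by (simp add: cf_mul fmul_Nil cf_wd)
    next
      case (Cons b v)
      have "(\<lambda>u. cf (wd [a]) (b # u)) = (if a = b then fone else (\<lambda>u. 0))"
        by (auto simp: cf_wd fone_def fun_eq_iff)
      then show ?thesis using Cons
        by (simp add: cf_mul fmul_Cons fmul_one_left fmul_zero_fun) (auto simp: cf_wd)
    qed
  qed
  show ?case using Cons c[of u] c[of "u @ v"] by (metis append_Cons mult.assoc)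
qed

section \<open>Finitely supported elements over a given alphabet\<close>

definition FN :: "'g set \<Rightarrow> 'g nc set" where "FN G = {z. cf z \<in> FA G}"

lemma FN_iff: "p \<in> FN G \<longleftrightarrow> finite {w. cf p w \<noteq> 0} \<and> (\<forall>w. cf p w \<noteq> 0 \<longrightarrow> set w \<subseteq> G)"
  by (simp add: FN_def FA_def)

lemma FN_nc: "nc p \<in> FN G \<longleftrightarrow> p \<in> FA G" by (simp add: FN_def)

lemma FN_0 [simp, intro]: "0 \<in> FN G" by (simp add: FN_iff)

lemma FN_wd [intro]: "set w \<subseteq> G \<Longrightarrow> wd w \<in> FN G"
  by (auto simp: FN_iff cf_wd)

lemma FN_1 [simp, intro]: "1 \<in> FN G" using FN_wd[of "[]" G] by (simp add: wd_Nil)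

lemma FN_add [intro]: assumes "p \<in> FN G" "q \<in> FN G" shows "p + q \<in> FN G"
proof -
  have "{w. cf (p + q) w \<noteq> 0} \<subseteq> {w. cf p w \<noteq> 0} \<union> {w. cf q w \<noteq> 0}" by auto
  moreover have "finite ({w. cf p w \<noteq> 0} \<union> {w. cf q w \<noteq> 0})" using assms by (auto simp: FN_iff)
  ultimately have "finite {w. cf (p + q) w \<noteq> 0}" by (rule finite_subset)
  moreover have "set w \<subseteq> G" if "cf (p + q) w \<noteq> 0" for w
    using that assms by (cases "cf p w = 0") (auto simp: FN_iff)
  ultimately show ?thesis by (auto simp: FN_iff)
qed

lemma FN_sc [intro]: "p \<in> FN G \<Longrightarrow> sc c p \<in> FN G"
  by (auto simp: FN_iff elim: rev_finite_subset)

lemma FN_minus [intro]: "p \<in> FN G \<Longrightarrow> - p \<in> FN G"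
  by (auto simp: FN_iff)

lemma FN_diff [intro]: "p \<in> FN G \<Longrightarrow> q \<in> FN G \<Longrightarrow> p - q \<in> FN G"
  using FN_add[of p G "- q"] FN_minus[of q G] by simp

lemma FN_sum [intro]: "(\<And>i. i \<in> A \<Longrightarrow> f i \<in> FN G) \<Longrightarrow> (\<Sum>i\<in>A. f i) \<in> FN G"
  by (induction A rule: infinite_finite_induct) auto

lemma FN_mono: "p \<in> FN G \<Longrightarrow> G \<subseteq> G' \<Longrightarrow> p \<in> FN G'"
  by (auto simp: FN_iff)

text \<open>Removing one word at a time from the finite support reduces linear statements about
  \<open>FN G\<close> to words.\<close>

lemma FN_induct [consumes 1, case_names zero step]:
  assumes "p \<in> FN G" "P 0"
    and st: "\<And>c w p. set w \<subseteq> G \<Longrightarrow> p \<in> FN G \<Longrightarrow> P p \<Longrightarrow> P (sc c (wd w) + p)"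
  shows "P p"
proof -
  have "\<And>p. p \<in> FN G \<Longrightarrow> {w. cf p w \<noteq> 0} = A \<Longrightarrow> P p" if "finite A" for A
    using that
  proof (induction A rule: finite_induct)
    case empty
    then have "p = 0" by (auto intro: nc_eqI)
    then show ?case using assms(2) by simp
  next
    case (insert v A)
    define q where "q = p - sc (cf p v) (wd v)"
    have v: "set v \<subseteq> G" using insert by (auto simp: FN_iff)
    have "{w. cf q w \<noteq> 0} = {w. cf p w \<noteq> 0} - {v}" by (auto simp: q_def cf_wd)
    then have sq: "{w. cf q w \<noteq> 0} = A" using insert.prems(2) insert.hyps(2) by auto
    have q: "q \<in> FN G" using insert.prems v by (auto simp: q_def)
    have "P (sc (cf p v) (wd v) + q)"
      using st[of v q "cf p v"] insert.IH[OF q sq] q v by auto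
    then show ?case by (simp add: q_def)
  qed
  then show ?thesis using assms(1) by (auto simp: FN_iff)
qed

lemma FN_mul [intro]: assumes "p \<in> FN G" "q \<in> FN G" shows "p * q \<in> FN G"
  using assms(1)
proof (induction p rule: FN_induct)
  case (step c w p)
  have "wd w * q \<in> FN G" using assms(2)
    using step(1) by (induction q rule: FN_induct) (auto simp: distrib_left wd_append intro!: FN_add FN_sc FN_wd)
  then show ?case using step by (auto simp: distrib_right)
qed auto

lemma FN_prod_list [intro]: "(\<And>p. p \<in> set ps \<Longrightarrow> p \<in> FN G) \<Longrightarrow> prod_list ps \<in> FN G"
  by (induction ps) auto

lemma FN_power [intro]: "p \<in> FN G \<Longrightarrow> p ^ n \<in> FN G"
  by (induction n) auto

section \<open>Pairing functions on words with noncommutative polynomials\<close>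

definition pair :: "('g list \<Rightarrow> complex) \<Rightarrow> 'g nc \<Rightarrow> complex" where
  "pair \<phi> z = (\<Sum>w | cf z w \<noteq> 0. cf z w * \<phi> w)"

lemma pair_superset:
  assumes "finite A" "{w. cf z w \<noteq> 0} \<subseteq> A" shows "pair \<phi> z = (\<Sum>w\<in>A. cf z w * \<phi> w)"
  unfolding pair_def using assms by (intro sum.mono_neutral_left) auto

lemma pair_0 [simp]: "pair \<phi> 0 = 0" by (simp add: pair_def)

lemma pair_wd [simp]: "pair \<phi> (wd w) = \<phi> w"
  by (subst pair_superset[of "{w}"]) (auto simp: cf_wd)

lemma pair_add:
  assumes "p \<in> FN G" "q \<in> FN G" shows "pair \<phi> (p + q) = pair \<phi> p + pair \<phi> q"
proof -
  let ?A = "{w. cf p w \<noteq> 0} \<union> {w. cf q w \<noteq> 0}"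
  have f: "finite ?A" using assms by (auto simp: FN_iff)
  show ?thesis
    by (subst (1 2 3) pair_superset[OF f]) (auto simp: algebra_simps sum.distrib)
qed

lemma pair_sc [simp]: "pair \<phi> (sc c p) = c * pair \<phi> p"
  by (cases "c = 0") (auto simp: pair_def sum_distrib_left algebra_simps)

lemma pair_minus [simp]: "pair \<phi> (- p) = - pair \<phi> p"
  using pair_sc[of \<phi> "-1" p] by (simp del: pair_sc)

lemma pair_diff:
  assumes "p \<in> FN G" "q \<in> FN G" shows "pair \<phi> (p - q) = pair \<phi> p - pair \<phi> q"
  using pair_add[of p G "- q" \<phi>] assms by auto

lemma pair_sum:
  "(\<And>i. i \<in> A \<Longrightarrow> f i \<in> FN G) \<Longrightarrow> pair \<phi> (\<Sum>i\<in>A. f i) = (\<Sum>i\<in>A. pair \<phi> (f i))"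
proof (induction A rule: infinite_finite_induct)
  case (insert x F)
  then show ?case using pair_add[of "f x" G "\<Sum>i\<in>F. f i" \<phi>] by auto
qed auto

lemma pair_add_fun: "pair (\<lambda>w. \<phi> w + \<psi> w) p = pair \<phi> p + pair \<psi> p"
  by (simp add: pair_def algebra_simps sum.distrib)

lemma pair_scale_fun: "pair (\<lambda>w. c * \<phi> w) p = c * pair \<phi> p"
  by (simp add: pair_def algebra_simps sum_distrib_left)

lemma pair_sum_fun: "pair (\<lambda>w. \<Sum>i\<in>A. \<phi> i w) p = (\<Sum>i\<in>A. pair (\<phi> i) p)"
  unfolding pair_def sum_distrib_left by (rule sum.swap)

lemma pair_cong:
  assumes "p \<in> FN G" "\<And>w. cf p w \<noteq> 0 \<Longrightarrow> set w \<subseteq> G \<Longrightarrow> \<phi> w = \<psi> w"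
  shows "pair \<phi> p = pair \<psi> p"
  unfolding pair_def by (rule sum.cong) (use assms in \<open>auto simp: FN_iff\<close>)

text \<open>Words multiply by concatenation, so a functional on a product is evaluated on the right
  factor for each fixed left word.\<close>

lemma pair_mul:
  assumes "p \<in> FN G" "q \<in> FN G"
  shows "pair \<phi> (p * q) = pair (\<lambda>u. pair (\<lambda>v. \<phi> (u @ v)) q) p"
  using assms(1)
proof (induction p rule: FN_induct)
  case (step c w p)
  have "pair \<phi> (wd w * q) = pair (\<lambda>v. \<phi> (w @ v)) q" using assms(2)
  proof (induction q rule: FN_induct)
    case (step c u q)
    have "wd w * q \<in> FN UNIV" "wd (w @ u) \<in> FN UNIV" "wd u \<in> FN UNIV" "q \<in> FN UNIV"
      using step by (auto intro!: FN_mul intro: FN_mono)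
    then show ?case using step
      by (simp add: distrib_left wd_append pair_add[where G=UNIV] FN_sc)
  qed auto
  moreover have "p * q \<in> FN UNIV" "wd w * q \<in> FN UNIV" "wd w \<in> FN UNIV" "p \<in> FN UNIV"
    using step assms(2) by (auto intro!: FN_mul intro: FN_mono)
  ultimately show ?case using step
    by (simp add: distrib_right pair_add[where G=UNIV] FN_sc)
qed auto

text \<open>Forgetting the order of the letters maps the free algebra to the symmetric algebra;
  \<open>ev z x\<close> is the resulting polynomial function at the point of the dual with
  coordinates \<open>x\<close>. The symbol of degree d is \<open>ev (top_part d z)\<close>.\<close>

definition ev :: "'g nc \<Rightarrow> ('g \<Rightarrow> complex) \<Rightarrow> complex" where
  "ev z x = pair (\<lambda>w. \<Prod>g\<leftarrow>w. x g) z"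

lemma ev_0 [simp]: "ev 0 x = 0" by (simp add: ev_def)
lemma ev_wd [simp]: "ev (wd w) x = (\<Prod>g\<leftarrow>w. x g)" by (simp add: ev_def)
lemma ev_1 [simp]: "ev 1 x = 1" using ev_wd[of "[]" x] by (simp add: wd_Nil)
lemma ev_sc [simp]: "ev (sc c p) x = c * ev p x" by (simp add: ev_def)
lemma ev_minus [simp]: "ev (- p) x = - ev p x" by (simp add: ev_def)
lemma ev_add: "p \<in> FN G \<Longrightarrow> q \<in> FN G \<Longrightarrow> ev (p + q) x = ev p x + ev q x"
  by (simp add: ev_def pair_add[of p G])
lemma ev_diff: "p \<in> FN G \<Longrightarrow> q \<in> FN G \<Longrightarrow> ev (p - q) x = ev p x - ev q x"
  by (simp add: ev_def pair_diff[of p G])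
lemma ev_sum: "(\<And>i. i \<in> A \<Longrightarrow> f i \<in> FN G) \<Longrightarrow> ev (\<Sum>i\<in>A. f i) x = (\<Sum>i\<in>A. ev (f i) x)"
  by (simp add: ev_def pair_sum[of A f G])
lemma ev_mul:
  assumes "p \<in> FN G" "q \<in> FN G" shows "ev (p * q) x = ev p x * ev q x"
  unfolding ev_def using assms
  by (simp add: pair_mul[of p G] pair_scale_fun mult.commute[of _ "pair _ q"])
lemma ev_prod_list:
  "(\<And>p. p \<in> set ps \<Longrightarrow> p \<in> FN G) \<Longrightarrow> ev (prod_list ps) x = (\<Prod>p\<leftarrow>ps. ev p x)"
  by (induction ps) (auto simp: ev_mul[of _ G] FN_prod_list)
lemma ev_power: "p \<in> FN G \<Longrightarrow> ev (p ^ n) x = ev p x ^ n"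
  by (induction n) (auto simp: ev_mul[of _ G] FN_power)

lemma ev_cong:
  assumes "z \<in> FN G" "\<And>g. g \<in> G \<Longrightarrow> x g = y g" shows "ev z x = ev z y"
  unfolding ev_def using assms(1)
  by (rule pair_cong) (auto intro!: arg_cong[where f=prod_list] map_cong assms(2))

section \<open>Word length: homogeneous elements, degree bounds and components\<close>

definition hom :: "nat \<Rightarrow> 'g nc \<Rightarrow> bool" where
  "hom d z \<longleftrightarrow> (\<forall>w. cf z w \<noteq> 0 \<longrightarrow> length w = d)"
definition deg_le :: "nat \<Rightarrow> 'g nc \<Rightarrow> bool" where
  "deg_le d z \<longleftrightarrow> (\<forall>w. cf z w \<noteq> 0 \<longrightarrow> length w \<le> d)"
lift_definition top_part :: "nat \<Rightarrow> 'g nc \<Rightarrow> 'g nc" is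
  "\<lambda>d z w. if length w = d then z w else 0" .

lemma cf_top: "cf (top_part d z) w = (if length w = d then cf z w else 0)"
  by transfer simp

lemma mul_nonzeroE:
  assumes "cf (p * q) w \<noteq> 0"
  obtains u v where "w = u @ v" "cf p u \<noteq> 0" "cf q v \<noteq> 0"
proof -
  have "\<exists>k\<in>{..length w}. cf p (take k w) * cf q (drop k w) \<noteq> 0"
  proof (rule ccontr)
    assume "\<not> ?thesis"
    then have "fmul (cf p) (cf q) w = 0" unfolding fmul_def by (intro sum.neutral) blast
    then show False using assms by (simp add: cf_mul)
  qed
  then obtain k where "cf p (take k w) * cf q (drop k w) \<noteq> 0" by blast
  then show ?thesis using that[of "take k w" "drop k w"] by simp
qed

lemma hom_0 [simp]: "hom d 0" by (simp add: hom_def)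
lemma hom_wd: "length w = d \<Longrightarrow> hom d (wd w)" by (auto simp: hom_def cf_wd)
lemma hom_1: "hom 0 1" using hom_wd[of "[]" 0] by (simp add: wd_Nil)
lemma hom_sc: "hom d p \<Longrightarrow> hom d (sc c p)" by (auto simp: hom_def)
lemma hom_minus: "hom d p \<Longrightarrow> hom d (- p)" by (auto simp: hom_def)
lemma hom_add: "hom d p \<Longrightarrow> hom d q \<Longrightarrow> hom d (p + q)"
  unfolding hom_def by (intro allI impI, case_tac "cf p w = 0") auto
lemma hom_diff: "hom d p \<Longrightarrow> hom d q \<Longrightarrow> hom d (p - q)"
  using hom_add[of d p "- q"] hom_minus by auto
lemma hom_sum: "(\<And>i. i \<in> A \<Longrightarrow> hom d (f i)) \<Longrightarrow> hom d (\<Sum>i\<in>A. f i)"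
  by (induction A rule: infinite_finite_induct) (auto simp: hom_add)
lemma hom_mul: assumes "hom d p" "hom e q" shows "hom (d + e) (p * q)"
  unfolding hom_def using assms by (auto simp: hom_def elim!: mul_nonzeroE)
lemma hom_prod_list: "(\<And>p. p \<in> set ps \<Longrightarrow> hom 1 p) \<Longrightarrow> hom (length ps) (prod_list ps)"
proof (induction ps)
  case (Cons p ps) then show ?case using hom_mul[of 1 p "length ps" "prod_list ps"] by auto
qed (simp add: hom_1)
lemma hom_power: "hom d p \<Longrightarrow> hom (n * d) (p ^ n)"
  by (induction n) (auto simp: hom_1 hom_mul)

lemma deg_le_0 [simp]: "deg_le d 0" by (simp add: deg_le_def)
lemma deg_le_sc: "deg_le d p \<Longrightarrow> deg_le d (sc c p)" by (auto simp: deg_le_def)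
lemma deg_le_minus: "deg_le d p \<Longrightarrow> deg_le d (- p)" by (auto simp: deg_le_def)
lemma deg_le_add: "deg_le d p \<Longrightarrow> deg_le d q \<Longrightarrow> deg_le d (p + q)"
  unfolding deg_le_def by (intro allI impI, case_tac "cf p w = 0") auto
lemma deg_le_diff: "deg_le d p \<Longrightarrow> deg_le d q \<Longrightarrow> deg_le d (p - q)"
  using deg_le_add[of d p "- q"] deg_le_minus by auto
lemma deg_le_sum: "(\<And>i. i \<in> A \<Longrightarrow> deg_le d (f i)) \<Longrightarrow> deg_le d (\<Sum>i\<in>A. f i)"
  by (induction A rule: infinite_finite_induct) (auto simp: deg_le_add)
lemma hom_deg_le: "hom d p \<Longrightarrow> d \<le> e \<Longrightarrow> deg_le e p" by (auto simp: hom_def deg_le_def)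
lemma deg_le_mul: assumes "deg_le d p" "deg_le e q" shows "deg_le (d + e) (p * q)"
  unfolding deg_le_def using assms
  by (auto simp: deg_le_def intro!: add_mono elim!: mul_nonzeroE)

lemma top_hom: "hom d z \<Longrightarrow> top_part d z = z"
  by (auto simp: hom_def cf_top intro!: nc_eqI)
lemma top_lower: "deg_le e z \<Longrightarrow> e < d \<Longrightarrow> top_part d z = 0"
  by (force simp: deg_le_def cf_top intro!: nc_eqI)
lemma top_add: "top_part d (p + q) = top_part d p + top_part d q"
  and top_diff: "top_part d (p - q) = top_part d p - top_part d q"
  and top_sc: "top_part d (sc c p) = sc c (top_part d p)"
  and top_0 [simp]: "top_part d 0 = 0"
  by (auto simp: cf_top intro!: nc_eqI)
lemma top_sum: "top_part d (\<Sum>i\<in>A. f i) = (\<Sum>i\<in>A. top_part d (f i))"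
  by (induction A rule: infinite_finite_induct) (auto simp: top_add)
lemma hom_top: "hom d (top_part d z)" by (auto simp: hom_def cf_top)
lemma FN_top: "p \<in> FN G \<Longrightarrow> top_part d p \<in> FN G"
  by (auto simp: FN_iff cf_top elim: rev_finite_subset)

section \<open>Two-sided ideals\<close>

definition idl :: "'g set \<Rightarrow> 'g fa set \<Rightarrow> 'g nc set" where
  "idl G Rel = {z. cf z \<in> fideal G Rel}"

lemma idl_nc: "nc p \<in> idl G Rel \<longleftrightarrow> p \<in> fideal G Rel" by (simp add: idl_def)

lemma idl_induct [consumes 1, case_names zero step]:
  assumes "z \<in> idl G Rel" "P 0"
    and st: "\<And>x a b p c. x \<in> Rel \<Longrightarrow> a \<in> FN G \<Longrightarrow> b \<in> FN G \<Longrightarrow> p \<in> idl G Rel \<Longrightarrow> P p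
      \<Longrightarrow> P (sc c (a * nc x * b) + p)"
  shows "P z"
proof -
  have "P (nc p)" if "p \<in> fideal G Rel" for p
    using that
  proof (induction rule: fideal.induct)
    case fideal_zero then show ?case using assms(2) by (simp add: nc_simps)
  next
    case (fideal_step x a b p c)
    then show ?case using st[of x "nc a" "nc b" "nc p" c] by (simp add: nc_simps idl_nc FN_nc)
  qed
  from this[of "cf z"] show ?thesis using assms(1) by (simp add: idl_def cf_inverse)
qed

lemma idl_0 [simp, intro]: "0 \<in> idl G Rel"
  using fideal_zero[of G Rel] by (simp add: idl_def zero_nc.rep_eq)

lemma idl_step:
  "x \<in> Rel \<Longrightarrow> a \<in> FN G \<Longrightarrow> b \<in> FN G \<Longrightarrow> p \<in> idl G Rel \<Longrightarrow> sc c (a * nc x * b) + p \<in> idl G Rel"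
  using fideal_step[of x Rel "cf a" G "cf b" "cf p" c]
  by (simp add: idl_def FN_def plus_nc.rep_eq times_nc.rep_eq sc.rep_eq)

lemma idl_FN:
  assumes "p \<in> idl G Rel" "nc ` Rel \<subseteq> FN G" shows "p \<in> FN G"
  using assms by (induction rule: idl_induct) (auto intro!: FN_add FN_sc FN_mul)

lemma idl_add [intro]: "p \<in> idl G Rel \<Longrightarrow> q \<in> idl G Rel \<Longrightarrow> p + q \<in> idl G Rel"
  by (induction rule: idl_induct) (auto simp: add.assoc idl_step)

lemma idl_sc [intro]: "p \<in> idl G Rel \<Longrightarrow> sc c p \<in> idl G Rel"
  by (induction rule: idl_induct) (auto simp: idl_step)

lemma idl_minus [intro]: "p \<in> idl G Rel \<Longrightarrow> - p \<in> idl G Rel"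
  using idl_sc[of p G Rel "-1"] by simp

lemma idl_diff [intro]: "p \<in> idl G Rel \<Longrightarrow> q \<in> idl G Rel \<Longrightarrow> p - q \<in> idl G Rel"
  using idl_add[of p G Rel "- q"] by auto

lemma idl_sum [intro]:
  "(\<And>i. i \<in> A \<Longrightarrow> f i \<in> idl G Rel) \<Longrightarrow> (\<Sum>i\<in>A. f i) \<in> idl G Rel"
  by (induction A rule: infinite_finite_induct) auto

lemma idl_mul_left [intro]:
  "p \<in> idl G Rel \<Longrightarrow> a \<in> FN G \<Longrightarrow> a * p \<in> idl G Rel"
proof (induction rule: idl_induct)
  case (step x a' b p c)
  then have "sc c ((a * a') * nc x * b) + a * p \<in> idl G Rel"
    by (intro idl_step) auto
  then show ?case by (simp add: distrib_left mult.assoc)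
qed auto

lemma idl_mul_right [intro]:
  "p \<in> idl G Rel \<Longrightarrow> b \<in> FN G \<Longrightarrow> p * b \<in> idl G Rel"
proof (induction rule: idl_induct)
  case (step x a b' p c)
  then have "sc c (a * nc x * (b' * b)) + p * b \<in> idl G Rel"
    by (intro idl_step) auto
  then show ?case by (simp add: distrib_right mult.assoc)
qed auto

lemma idl_rel: "x \<in> Rel \<Longrightarrow> nc x \<in> idl G Rel"
  using idl_step[of x Rel 1 G 1 0 1] by auto

section \<open>The symbol of an element of the enveloping algebra\<close>

lemma hom_vv: "hom (Suc 0) (nc (vv t r a b))"
  by (auto simp: vv_def nc_simps intro!: hom_sc hom_wd hom_minus)

locale nilrad =
  fixes t :: rtype and r :: "int rel"
  assumes adm: "admissible t r"
begin

abbreviation gt where "gt \<equiv> thgt t r"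
abbreviation GG where "GG \<equiv> Gens t r"
abbreviation J where "J \<equiv> idl (Gens t r) (URel t r)"
abbreviation B where "B g h \<equiv> nc (br t r g h)"
abbreviation V where "V a b \<equiv> nc (vv t r a b)"
definition tA :: bool where "tA \<longleftrightarrow> t = TA"
definition tB :: bool where "tB \<longleftrightarrow> t = TB"
definition tC :: bool where "tC \<longleftrightarrow> t = TC"
text \<open>In types B, C, D the entries satisfy V b a = eps V a b: symmetric in type C, skew in B
  and D. Type A shares the value -1, since its coordinates are later stored in a skew block
  matrix.\<close>

definition eps :: complex where "eps = (if tC then 1 else -1)"

lemma types_exclusive: "tA \<Longrightarrow> \<not> tB" "tA \<Longrightarrow> \<not> tC" "tB \<Longrightarrow> \<not> tC"
  unfolding tA_def tB_def tC_def by auto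

lemma GG_iff:
  "D a b \<in> GG \<longleftrightarrow> 0 < a \<and> 0 < b \<and> gt a b"
  "S a b \<in> GG \<longleftrightarrow> \<not> tA \<and> 0 < a \<and> 0 < b \<and> gt a b"
  "L a \<in> GG \<longleftrightarrow> tC \<and> 0 < a"
  "H a \<in> GG \<longleftrightarrow> tB \<and> 0 < a"
  by (auto simp: Gens_def tA_def tB_def tC_def)

lemma eps_square [simp]: "eps * eps = 1" "eps * (eps * x) = x"
  by (auto simp: eps_def)

lemma trans_r: "trans r" and irrefl_r: "irrefl r"
  using adm by (auto simp: admissible_def strict_linear_order_on_def split: if_splits)

lemma gt_irrefl [simp]: "\<not> gt a a"
  using irrefl_r by (auto simp: thgt_def irrefl_def)

lemma gt_trans: "gt a b \<Longrightarrow> gt b c \<Longrightarrow> gt a c"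
  using trans_r unfolding thgt_def by (meson transD)

lemma gt_asym: "gt a b \<Longrightarrow> \<not> gt b a"
  using gt_trans gt_irrefl by blast

lemma gt_total: "0 < a \<Longrightarrow> 0 < b \<Longrightarrow> a \<noteq> b \<Longrightarrow> gt a b \<or> gt b a"
proof -
  assume ab: "0 < a" "0 < b" "a \<noteq> b"
  then have ne: "sig t r a \<noteq> sig t r b" by (auto simp: sig_def split: if_splits)
  show ?thesis
  proof (cases "t = TA")
    case True
    then have "total_on {i. 0 < i} r"
      using adm by (auto simp: admissible_def strict_linear_order_on_def)
    then show ?thesis using ab ne True unfolding total_on_def thgt_def sig_def by auto
  next
    case False
    then have "total_on UNIV r"
      using adm by (auto simp: admissible_def strict_linear_order_on_def)
    then show ?thesis using ne unfolding total_on_def thgt_def by auto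
  qed
qed

lemma nc_vv:
  "V a b = (if a = b then (if tC then sc 2 (wd [L a]) else 0)
     else if gt a b then wd [S a b] else sc eps (wd [S b a]))"
  by (auto simp: vv_def nc_simps eps_def tC_def)

lemma FN_vv: "\<not> tA \<Longrightarrow> 0 < a \<Longrightarrow> 0 < b \<Longrightarrow> V a b \<in> FN GG"
  using gt_total[of a b] by (auto simp: nc_vv GG_iff intro!: FN_sc FN_wd)

lemma B_simps:
  "B (D i j) (D k l) = sc (dl j k) (wd [D i l]) - sc (dl l i) (wd [D k j])"
  "B (D i j) (S k l) = sc (dl j k) (V i l) + sc (eps * dl j l) (V i k)"
  "B (S k l) (D i j) = - sc (dl j k) (V i l) - sc (eps * dl j l) (V i k)"
  "B (D i j) (L k) = sc (dl j k) (V i k)"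
  "B (L k) (D i j) = - sc (dl j k) (V i k)"
  "B (D i j) (H k) = sc (dl j k) (wd [H i])"
  "B (H k) (D i j) = - sc (dl j k) (wd [H i])"
  "B (H i) (H k) = - V i k"
  "B (S i j) (S k l) = 0" "B (S i j) (L k) = 0" "B (S i j) (H k) = 0"
  "B (L i) (S k l) = 0" "B (L i) (L k) = 0" "B (L i) (H k) = 0"
  "B (H i) (S k l) = 0" "B (H i) (L k) = 0"
  by (auto simp: nc_simps eps_def tC_def dl_def)

text \<open>The positive roots are closed under addition. A bracket of two \<open>D\<close> with a
  common index chains two inequalities, hence transitivity of the order; the Kronecker factors
  \<open>dl\<close> remove the other cases.\<close>

lemma FN_B: assumes "g \<in> GG" "h \<in> GG" shows "B g h \<in> FN GG"
proof -
  have dlz: "dl x y = 0" if "x \<noteq> y" for x y using that by (simp add: dl_def)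
  have "B (D i j) (D k l) \<in> FN GG" if "D i j \<in> GG" "D k l \<in> GG" for i j k l
  proof -
    have "sc (dl j k) (wd [D i l]) \<in> FN GG"
      using that by (cases "j = k") (auto simp: dlz GG_iff intro!: FN_sc FN_wd intro: gt_trans)
    moreover have "sc (dl l i) (wd [D k j]) \<in> FN GG"
      using that by (cases "l = i") (auto simp: dlz GG_iff intro!: FN_sc FN_wd intro: gt_trans)
    ultimately show ?thesis by (auto simp: B_simps simp del: br.simps)
  qed
  then show ?thesis using assms
    by (cases g; cases h)
       (auto simp: B_simps GG_iff types_exclusive intro!: FN_sc FN_wd FN_vv FN_add FN_diff FN_minus simp del: br.simps)
qed

lemma hom_B: "hom (Suc 0) (B g h)"
  by (cases g; cases h) (auto simp: B_simps intro!: hom_sc hom_vv hom_add hom_diff hom_minus hom_wd simp del: br.simps)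

declare br.simps [simp del]

lemma FN_UNIV_V:
  "V a b \<in> FN UNIV" "sc c (V a b) \<in> FN UNIV" "- sc c (V a b) \<in> FN UNIV"
  "wd (w :: gen list) \<in> FN UNIV" "sc c (wd w) \<in> FN UNIV"
  by (auto simp: nc_vv intro!: FN_wd FN_sc FN_minus)

lemma URelE:
  assumes "x \<in> URel t r"
  obtains g h where "g \<in> GG" "h \<in> GG" "nc x = wd [g, h] - wd [h, g] - B g h"
  using assms by (auto simp: URel_def nc_simps wd_append)

lemma URelI:
  assumes "g \<in> GG" "h \<in> GG" shows "wd [g, h] - wd [h, g] - B g h \<in> J"
proof -
  have "fsub (fsub (fmul (fgen g) (fgen h)) (fmul (fgen h) (fgen g))) (br t r g h) \<in> URel t r"
    using assms by (auto simp: URel_def)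
  from idl_rel[OF this, of GG] show ?thesis by (simp add: nc_simps wd_append)
qed

lemma J_FN: "z \<in> J \<Longrightarrow> z \<in> FN GG"
  by (rule idl_FN) (auto elim!: URelE intro!: FN_diff FN_wd FN_B)

end

text \<open>Shuffle product of functionals: every letter goes to one of the two factors, the order
  within each factor is kept, and all distributions are summed.\<close>

fun conv :: "('g list \<Rightarrow> complex) \<Rightarrow> ('g list \<Rightarrow> complex) \<Rightarrow> 'g list \<Rightarrow> complex" where
  "conv \<phi> \<psi> [] = \<phi> [] * \<psi> []"
| "conv \<phi> \<psi> (g # w) = conv (\<lambda>u. \<phi> (g # u)) \<psi> w + conv \<phi> (\<lambda>u. \<psi> (g # u)) w"

lemma conv_0_left: "(\<And>w. set w \<subseteq> G \<Longrightarrow> \<phi> w = 0) \<Longrightarrow> set v \<subseteq> G \<Longrightarrow> conv \<phi> \<psi> v = 0"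
  by (induction \<phi> \<psi> v rule: conv.induct) auto

lemma conv_0_right: "(\<And>w. set w \<subseteq> G \<Longrightarrow> \<psi> w = 0) \<Longrightarrow> set v \<subseteq> G \<Longrightarrow> conv \<phi> \<psi> v = 0"
  by (induction \<phi> \<psi> v rule: conv.induct) auto

lemma conv_diff_left: "conv (\<lambda>w. \<phi> w - \<phi>' w) \<psi> v = conv \<phi> \<psi> v - conv \<phi>' \<psi> v"
  by (induction v arbitrary: \<phi> \<phi>' \<psi>) (auto simp: algebra_simps)

lemma conv_diff_right: "conv \<psi> (\<lambda>w. \<phi> w - \<phi>' w) v = conv \<psi> \<phi> v - conv \<psi> \<phi>' v"
  by (induction v arbitrary: \<phi> \<phi>' \<psi>) (auto simp: algebra_simps)

lemma conv_pair_left: "conv (\<lambda>w. pair (\<lambda>k. \<phi> k w) z) \<psi> v = pair (\<lambda>k. conv (\<phi> k) \<psi> v) z"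
proof (induction v arbitrary: \<phi> \<psi>)
  case Nil
  then show ?case using pair_scale_fun[of "\<psi> []" "\<lambda>k. \<phi> k []" z] by (simp add: mult.commute)
qed (simp add: pair_add_fun)

lemma conv_pair_right: "conv \<psi> (\<lambda>w. pair (\<lambda>k. \<phi> k w) z) v = pair (\<lambda>k. conv \<psi> (\<phi> k) v) z"
proof (induction v arbitrary: \<phi> \<psi>)
  case Nil
  then show ?case using pair_scale_fun[of "\<psi> []" "\<lambda>k. \<phi> k []" z] by (simp add: mult.commute)
qed (simp add: pair_add_fun)

lemma conv_short:
  assumes "\<And>v. length v < n \<Longrightarrow> \<psi> v = 0" "length w < n" shows "conv \<phi> \<psi> w = 0"
  using assms
proof (induction w arbitrary: \<phi> \<psi> n)
  case (Cons g w)
  have "conv \<phi> (\<lambda>u. \<psi> (g # u)) w = 0"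
    using Cons.prems by (intro Cons.IH[of "n - 1"]) auto
  moreover have "conv (\<lambda>u. \<phi> (g # u)) \<psi> w = 0"
    using Cons.prems by (intro Cons.IH[of n]) auto
  ultimately show ?case by simp
qed auto

lemma conv_equal:
  assumes "\<And>v. length v < n \<Longrightarrow> \<psi> v = 0" "length w = n" shows "conv \<phi> \<psi> w = \<phi> [] * \<psi> w"
  using assms
proof (induction w arbitrary: \<phi> \<psi> n)
  case (Cons g w)
  have "conv \<phi> (\<lambda>u. \<psi> (g # u)) w = \<phi> [] * \<psi> (g # w)"
    using Cons.prems by (intro Cons.IH[of "n - 1"]) auto
  moreover have "conv (\<lambda>u. \<phi> (g # u)) \<psi> w = 0"
    using Cons.prems by (intro conv_short[of n]) auto
  ultimately show ?case by simp
qed auto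

text \<open>Exactly one letter goes to \<phi>: none is impossible because \<phi> vanishes on the
  empty word, and two or more leave a word too short for \<psi>. The n + 1 choices of that letter
  produce the factorial in convolution powers.\<close>

lemma conv_Suc:
  assumes "\<And>v. length v < n \<Longrightarrow> \<psi> v = 0" "\<And>v. length v = n \<Longrightarrow> \<psi> v = C * (\<Prod>g\<leftarrow>v. x g)"
    and "length w = Suc n" "\<phi> [] = 0" "\<And>g. g \<in> set w \<Longrightarrow> \<phi> [g] = x g"
  shows "conv \<phi> \<psi> w = of_nat (Suc n) * C * (\<Prod>g\<leftarrow>w. x g)"
  using assms
proof (induction n arbitrary: \<psi> w C)
  case 0
  then obtain g where "w = [g]" by (auto simp: length_Suc_conv)
  then show ?case using 0 by simp
next
  case (Suc n)
  then obtain g v where w: "w = g # v" "length v = Suc n" by (auto simp: length_Suc_conv)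
  have "conv \<phi> (\<lambda>u. \<psi> (g # u)) v = of_nat (Suc n) * (C * x g) * (\<Prod>g\<leftarrow>v. x g)"
    using Suc.prems w by (intro Suc.IH) auto
  moreover have "conv (\<lambda>u. \<phi> (g # u)) \<psi> v = \<phi> [g] * \<psi> v"
    using Suc.prems w by (intro conv_equal[of "Suc n"]) auto
  moreover have "\<psi> v = C * (\<Prod>g\<leftarrow>v. x g)" using Suc.prems w by auto
  ultimately show ?case using Suc.prems w by (simp add: algebra_simps)
qed

primrec cpow :: "('g list \<Rightarrow> complex) \<Rightarrow> nat \<Rightarrow> 'g list \<Rightarrow> complex" where
  "cpow \<phi> 0 = (\<lambda>w. if w = [] then 1 else 0)"
| "cpow \<phi> (Suc d) = conv \<phi> (cpow \<phi> d)"

lemma cpow_short: "\<phi> [] = 0 \<Longrightarrow> length w < d \<Longrightarrow> cpow \<phi> d w = 0"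
proof (induction d arbitrary: w)
  case (Suc d)
  then have s: "\<And>v. length v < d \<Longrightarrow> cpow \<phi> d v = 0" by blast
  show ?case
  proof (cases "length w = d")
    case True then show ?thesis using conv_equal[where \<psi>="cpow \<phi> d", OF s, where w=w and \<phi>=\<phi> and n=d] Suc.prems by simp
  next
    case False then show ?thesis using conv_short[where \<psi>="cpow \<phi> d", OF s, where w=w and \<phi>=\<phi> and n=d] Suc.prems by simp
  qed
qed auto

lemma cpow_equal:
  "\<phi> [] = 0 \<Longrightarrow> (\<And>g. g \<in> G \<Longrightarrow> \<phi> [g] = x g) \<Longrightarrow> set w \<subseteq> G \<Longrightarrow> length w = d
   \<Longrightarrow> cpow \<phi> d w = of_nat (fact d) * (\<Prod>g\<leftarrow>w. x g)"
proof (induction d arbitrary: w)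
  case (Suc d)
  show ?case
  proof -
    \<comment> \<open>The product formula for \<open>cpow \<phi> d\<close> is known only over the
      alphabet \<open>G\<close>; \<psi> modifies the functional outside \<open>G\<close>, which the
      convolution on a word over \<open>G\<close> does not see.\<close>
    define \<psi> where "\<psi> = (\<lambda>v. if set v \<subseteq> G \<or> length v < d then cpow \<phi> d v
        else of_nat (fact d) * (\<Prod>g\<leftarrow>v. x g))"
    have z: "conv \<phi> (\<lambda>v. cpow \<phi> d v - \<psi> v) w = 0"
      by (rule conv_0_right[where G=G]) (use Suc.prems in \<open>auto simp: \<psi>_def\<close>)
    have "conv \<phi> \<psi> w = of_nat (Suc d) * of_nat (fact d) * (\<Prod>g\<leftarrow>w. x g)"
      by (rule conv_Suc) (use Suc.prems Suc.IH in \<open>auto simp: \<psi>_def cpow_short\<close>)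
    then show ?thesis using z by (simp add: conv_diff_right distrib_right)
  qed
qed auto

section \<open>Functionals that vanish on the relations\<close>

context nilrad
begin

text \<open>Vanishing on every u (gh - hg - [g, h]) v over the alphabet. These elements span the
  ideal, so such functionals descend to the enveloping algebra.\<close>

definition kills :: "(gen list \<Rightarrow> complex) \<Rightarrow> bool" where
  "kills \<phi> \<longleftrightarrow> (\<forall>u v g h. set u \<subseteq> GG \<longrightarrow> set v \<subseteq> GG \<longrightarrow> g \<in> GG \<longrightarrow> h \<in> GG \<longrightarrow>
     \<phi> (u @ g # h # v) - \<phi> (u @ h # g # v) = pair (\<lambda>k. \<phi> (u @ k @ v)) (B g h))"

lemma pair_swap: "pair (\<lambda>m. pair (\<lambda>v. f m v) b) z = pair (\<lambda>v. pair (\<lambda>m. f m v) z) b"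
  unfolding pair_def sum_distrib_left
  by (subst sum.swap) (simp add: algebra_simps)

lemma pair_const0 [simp]: "pair (\<lambda>w. 0) z = 0" by (simp add: pair_def)

lemma kills_J: assumes "kills \<phi>" "z \<in> J" shows "pair \<phi> z = 0"
  using assms(2)
proof (induction rule: idl_induct)
  case (step x a b p c)
  from step(1) obtain g h where gh: "g \<in> GG" "h \<in> GG" "nc x = wd [g, h] - wd [h, g] - B g h"
    by (rule URelE)
  have X: "nc x \<in> FN GG" using gh by (auto intro!: FN_diff FN_wd FN_B)
  have p0: "pair (\<lambda>m. \<phi> (u @ m @ v)) (nc x) = 0" if "set u \<subseteq> GG" "set v \<subseteq> GG" for u v
  proof -
    have "pair (\<lambda>m. \<phi> (u @ m @ v)) (nc x)
      = \<phi> (u @ g # h # v) - \<phi> (u @ h # g # v) - pair (\<lambda>k. \<phi> (u @ k @ v)) (B g h)"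
      using gh FN_B[of g h] by (simp add: pair_diff[where G=GG] FN_diff FN_wd)
    then show ?thesis using assms(1) that gh by (simp add: kills_def)
  qed
  have "pair \<phi> (a * nc x * b) = pair (\<lambda>u. pair (\<lambda>m. pair (\<lambda>v. \<phi> (u @ m @ v)) b) (nc x)) a"
    using step X by (simp add: pair_mul[where G=GG] FN_mul)
  also have "\<dots> = pair (\<lambda>u. pair (\<lambda>v. pair (\<lambda>m. \<phi> (u @ m @ v)) (nc x)) b) a"
    by (simp add: pair_swap[of _ b "nc x"])
  also have "\<dots> = pair (\<lambda>u. 0) a"
  proof (rule pair_cong[OF step(2)])
    fix u assume "set u \<subseteq> GG"
    then have "pair (\<lambda>v. pair (\<lambda>m. \<phi> (u @ m @ v)) (nc x)) b = pair (\<lambda>v. 0) b"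
      by (intro pair_cong[OF step(3)]) (use p0 in auto)
    then show "pair (\<lambda>v. pair (\<lambda>m. \<phi> (u @ m @ v)) (nc x)) b = 0" by simp
  qed
  finally have "pair \<phi> (a * nc x * b) = 0" by simp
  then show ?case using step X J_FN[OF step(4)] by (simp add: pair_add[where G=GG] FN_mul FN_sc)
qed auto

lemma kills_shift: "kills \<phi> \<Longrightarrow> g \<in> GG \<Longrightarrow> kills (\<lambda>u. \<phi> (g # u))"
  unfolding kills_def
proof (intro allI impI)
  fix u v g' h
  assume a: "\<forall>u v g h. set u \<subseteq> GG \<longrightarrow> set v \<subseteq> GG \<longrightarrow> g \<in> GG \<longrightarrow> h \<in> GG \<longrightarrow>
     \<phi> (u @ g # h # v) - \<phi> (u @ h # g # v) = pair (\<lambda>k. \<phi> (u @ k @ v)) (B g h)"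
    "g \<in> GG" "set u \<subseteq> GG" "set v \<subseteq> GG" "g' \<in> GG" "h \<in> GG"
  then show "\<phi> (g # u @ g' # h # v) - \<phi> (g # u @ h # g' # v) = pair (\<lambda>k. \<phi> (g # u @ k @ v)) (B g' h)"
    using a(1)[rule_format, of "g # u" v g' h] by simp
qed

text \<open>The relators are primitive for the shuffle coproduct, which is dual to conv.\<close>

lemma kills_conv:
  assumes "kills \<phi>" "kills \<psi>" shows "kills (conv \<phi> \<psi>)"
proof -
  have "conv \<phi> \<psi> (u @ g # h # v) - conv \<phi> \<psi> (u @ h # g # v) = pair (\<lambda>k. conv \<phi> \<psi> (u @ k @ v)) (B g h)"
    if "set u \<subseteq> GG" "set v \<subseteq> GG" "g \<in> GG" "h \<in> GG" "kills \<phi>" "kills \<psi>" for u v g h \<phi> \<psi>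
    using that
  proof (induction u arbitrary: \<phi> \<psi>)
    case Nil
    have k: "\<phi>' (g # h # w) - \<phi>' (h # g # w) = pair (\<lambda>k. \<phi>' (k @ w)) (B g h)"
      if "set w \<subseteq> GG" "kills \<phi>'" for w \<phi>'
    proof -
      have "\<phi>' ([] @ g # h # w) - \<phi>' ([] @ h # g # w) = pair (\<lambda>k. \<phi>' ([] @ k @ w)) (B g h)"
        using that Nil.prems(3,4) unfolding kills_def by (auto simp del: append_Nil)
      then show ?thesis by simp
    qed
    have 1: "conv (\<lambda>w. (\<phi> (g # h # w) - \<phi> (h # g # w)) - pair (\<lambda>k. \<phi> (k @ w)) (B g h)) \<psi> v = 0"
      by (rule conv_0_left[where G=GG]) (use k Nil in auto)
    have 2: "conv \<phi> (\<lambda>w. (\<psi> (g # h # w) - \<psi> (h # g # w)) - pair (\<lambda>k. \<psi> (k @ w)) (B g h)) v = 0"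
      by (rule conv_0_right[where G=GG]) (use k Nil in auto)
    \<comment> \<open>A bracket is linear in the generators, and a single letter goes to exactly one
      of the two factors, so its action on \<open>conv\<close> obeys the Leibniz rule.\<close>
    have "pair (\<lambda>k. conv \<phi> \<psi> (k @ v)) (B g h)
      = pair (\<lambda>k. conv (\<lambda>w. \<phi> (k @ w)) \<psi> v + conv \<phi> (\<lambda>w. \<psi> (k @ w)) v) (B g h)"
    proof (rule pair_cong[OF FN_B[OF Nil(3,4)]])
      fix w assume "cf (B g h) w \<noteq> 0"
      then have "length w = Suc 0" using hom_B[of g h] by (auto simp: hom_def)
      then obtain k where "w = [k]" by (auto simp: length_Suc_conv)
      then show "conv \<phi> \<psi> (w @ v) = conv (\<lambda>u. \<phi> (w @ u)) \<psi> v + conv \<phi> (\<lambda>u. \<psi> (w @ u)) v" by simp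
    qed
    then show ?case
      using 1[unfolded conv_diff_left conv_pair_left] 2[unfolded conv_diff_right conv_pair_right]
      by (simp add: pair_add_fun algebra_simps)
  next
    case (Cons a u)
    then have "kills (\<lambda>w. \<phi> (a # w))" "kills (\<lambda>w. \<psi> (a # w))" by (auto intro: kills_shift)
    then show ?case
      using Cons.IH[of "\<lambda>w. \<phi> (a # w)" \<psi>] Cons.IH[of \<phi> "\<lambda>w. \<psi> (a # w)"] Cons.prems
      by (simp add: pair_add_fun algebra_simps)
  qed
  then show ?thesis using assms unfolding kills_def by blast
qed

text \<open>Defining representation on coordinate vectors indexed by the integers: i, -i and 0 stand
  for the basis vectors e_i, e_(-i) and e_0, and \<open>D i j\<close> is E_(i,j) - E_(-j,-i). In
  type A this is the natural module together with its dual.\<close>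

fun op :: "gen \<Rightarrow> (int \<Rightarrow> complex) \<Rightarrow> int \<Rightarrow> complex" where
  "op (D i j) v k = (if k = int i then v (int j) else 0) - (if k = - int j then v (- int i) else 0)"
| "op (S a b) v k = (if k = int a then v (- int b) else 0) + eps * (if k = int b then v (- int a) else 0)"
| "op (L a) v k = (if k = int a then v (- int a) else 0)"
| "op (H a) v k = (if k = int a then v 0 else 0) - (if k = 0 then v (- int a) else 0)"

lemma op_sum: "op g (\<lambda>k. \<Sum>i\<in>A. c i * f i k) = (\<lambda>k'. \<Sum>i\<in>A. c i * op g (f i) k')"
  by (rule ext, cases g) (auto simp: sum_distrib_left right_diff_distrib distrib_left sum_subtractf sum.distrib mult.left_commute)

definition opw :: "gen list \<Rightarrow> (int \<Rightarrow> complex) \<Rightarrow> int \<Rightarrow> complex" where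
  "opw w v = foldr op w v"

lemma opw_simps [simp]: "opw [] v = v" "opw (g # w) v = op g (opw w v)" "opw (u @ w) v = opw u (opw w v)"
  by (auto simp: opw_def)

lemma opw_sum: "opw u (\<lambda>k. \<Sum>i\<in>A. c i * f i k) = (\<lambda>k. \<Sum>i\<in>A. c i * opw u (f i) k)"
  by (induction u) (simp_all add: op_sum)

lemma opw_diff: "opw u (\<lambda>k. f k - f' k) k = opw u f k - opw u f' k"
proof -
  have o: "op g (\<lambda>k. f k - f' k) = (\<lambda>k. op g f k - op g f' k)" for g f f'
    by (rule ext, cases g) (auto simp: algebra_simps)
  have "opw u (\<lambda>k. f k - f' k) = (\<lambda>k. opw u f k - opw u f' k)"
    by (induction u) (simp_all add: o)
  then show ?thesis by simp
qed

lemma opw_pair: "opw u (\<lambda>k. pair (\<lambda>m. f m k) z) k = pair (\<lambda>m. opw u (f m) k) z"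
  unfolding pair_def opw_sum by simp

lemma pair_op_vv:
  assumes "0 < a" "0 < b"
  shows "pair (\<lambda>m. opw m v k) (V a b)
    = (if k = int a then v (- int b) else 0) + eps * (if k = int b then v (- int a) else 0)"
  using assms by (auto simp: nc_vv eps_def)

text \<open>Products of elementary matrices; positivity keeps the indices i, -j and 0 apart, so only
  the terms recorded in the bracket survive.\<close>

lemma op_commutator:
  assumes "g \<in> GG" "h \<in> GG"
  shows "op g (op h v) k - op h (op g v) k = pair (\<lambda>m. opw m v k) (B g h)"
proof -
  note lin = FN_UNIV_V pair_add[where G=UNIV] pair_diff[where G=UNIV] pair_op_vv B_simps
  have ne: "i \<noteq> j" if "gt i j" for i j using that by auto
  show ?thesis
  proof (cases g)
    case g: (D i j)
    then have ij: "0 < i" "0 < j" "i \<noteq> j" using assms ne by (auto simp: GG_iff)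
    show ?thesis using assms ij
      by (cases h) (auto simp: g lin GG_iff dl_def eps_def)
  next
    case g: (S i j)
    then have ij: "0 < i" "0 < j" "i \<noteq> j" using assms ne by (auto simp: GG_iff)
    show ?thesis using assms ij
      by (cases h) (auto simp: g lin GG_iff dl_def eps_def)
  next
    case g: (L i)
    then have ij: "0 < i" using assms by (auto simp: GG_iff)
    show ?thesis using assms ij
      by (cases h) (auto simp: g lin GG_iff dl_def eps_def)
  next
    case g: (H i)
    then have ij: "0 < i" "\<not> tC" using assms by (auto simp: GG_iff types_exclusive)
    show ?thesis using assms ij
      by (cases h) (auto simp: g lin GG_iff dl_def eps_def)
  qed
qed

lemma kills_opw: "kills (\<lambda>w. opw w e k)"
  unfolding kills_def
proof (intro allI impI)
  fix u v g h assume "g \<in> GG" "h \<in> GG"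
  then have c: "(\<lambda>k. op g (op h (opw v e)) k - op h (op g (opw v e)) k)
      = (\<lambda>k. pair (\<lambda>m. opw m (opw v e) k) (B g h))"
    by (simp add: op_commutator)
  show "opw (u @ g # h # v) e k - opw (u @ h # g # v) e k = pair (\<lambda>m. opw (u @ m @ v) e k) (B g h)"
    using arg_cong[OF c, of "\<lambda>f. opw u f k"] by (simp add: opw_diff opw_pair)
qed

lemma kills_sum:
  assumes "\<And>i. i \<in> A \<Longrightarrow> kills (\<phi> i)" shows "kills (\<lambda>w. \<Sum>i\<in>A. c i * \<phi> i w)"
  unfolding kills_def
proof (intro allI impI)
  fix u v g h assume a: "set u \<subseteq> GG" "set v \<subseteq> GG" "g \<in> GG" "h \<in> GG"
  have "(\<Sum>i\<in>A. c i * \<phi> i (u @ g # h # v)) - (\<Sum>i\<in>A. c i * \<phi> i (u @ h # g # v))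
    = (\<Sum>i\<in>A. c i * (\<phi> i (u @ g # h # v) - \<phi> i (u @ h # g # v)))"
    by (simp add: sum_subtractf algebra_simps)
  also have "\<dots> = (\<Sum>i\<in>A. c i * pair (\<lambda>k. \<phi> i (u @ k @ v)) (B g h))"
    using a assms by (intro sum.cong refl) (simp add: kills_def)
  finally show "(\<Sum>i\<in>A. c i * \<phi> i (u @ g # h # v)) - (\<Sum>i\<in>A. c i * \<phi> i (u @ h # g # v))
      = pair (\<lambda>k. \<Sum>i\<in>A. c i * \<phi> i (u @ k @ v)) (B g h)"
    by (simp add: pair_sum_fun pair_scale_fun)
qed

lemma kills_cpow: "kills \<phi> \<Longrightarrow> kills (cpow \<phi> d)"
proof (induction d)
  case 0
  have "pair (\<lambda>k. cpow \<phi> 0 (u @ k @ v)) (B g h) = 0" for u v g h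
    unfolding pair_def
  proof (rule sum.neutral, clarify)
    fix k assume "cf (B g h) k \<noteq> 0"
    then have "length k = Suc 0" using hom_B[of g h] by (simp add: hom_def)
    then show "cf (B g h) k * cpow \<phi> 0 (u @ k @ v) = 0" by auto
  qed
  then show ?case by (simp add: kills_def)
qed (auto intro: kills_conv)

text \<open>With \<open>gcol\<close> a matrix position at which the generator itself has entry 1 and
  every other generator has entry 0. For a sum root the order of its two indices singles out one of
  its two entries.\<close>

fun grow :: "gen \<Rightarrow> int" where
  "grow (D i j) = int i" | "grow (S a b) = int a" | "grow (L a) = int a" | "grow (H a) = int a"
fun gcol :: "gen \<Rightarrow> int" where
  "gcol (D i j) = int j" | "gcol (S a b) = - int b" | "gcol (L a) = - int a" | "gcol (H a) = 0"

lemma op_entry: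
  assumes "g \<in> GG" "h \<in> GG"
  shows "op h (\<lambda>k. if k = gcol g then 1 else 0) (grow g) = (if g = h then 1 else 0)"
  using assms by (cases g; cases h) (auto simp: GG_iff types_exclusive dest: gt_asym)

lemma grow_gcol: "g \<in> GG \<Longrightarrow> grow g \<noteq> gcol g"
  by (cases g) (auto simp: GG_iff)

text \<open>The part of the Poincare-Birkhoff-Witt theorem that is needed: coefficients of a
  faithful representation separate the generators, and their convolution powers see exactly the
  top component.\<close>

lemma symbol_J:
  assumes z: "z \<in> J" "deg_le d z" shows "ev (top_part d z) x = 0"
proof -
  have zF: "z \<in> FN GG" using z J_FN by auto
  define G0 where "G0 = \<Union> (set ` {w. cf z w \<noteq> 0})"
  have G0: "finite G0" "G0 \<subseteq> GG" using zF by (auto simp: FN_iff G0_def)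
  \<comment> \<open>Matrix coefficients at the positions of the letters that occur, weighted by
    \<open>x\<close>: zero on the empty word because the positions lie off the diagonal, and
    \<open>x g\<close> on the one-letter word g.\<close>
  define \<phi> where "\<phi> w = (\<Sum>g\<in>G0. x g * opw w (\<lambda>k. if k = gcol g then 1 else 0) (grow g))" for w
  have "kills \<phi>" unfolding \<phi>_def by (rule kills_sum) (rule kills_opw)
  then have "pair (cpow \<phi> d) z = 0" using kills_J[OF kills_cpow z(1)] by blast
  moreover have p0: "\<phi> [] = 0" unfolding \<phi>_def
    by (rule sum.neutral) (use G0 grow_gcol in auto)
  have p1: "\<phi> [g] = x g" if "g \<in> G0" for g
  proof -
    have "\<phi> [g] = (\<Sum>h\<in>G0. if h = g then x g else 0)"
      unfolding \<phi>_def by (rule sum.cong) (use that G0 in \<open>auto simp: op_entry subset_iff\<close>)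
    then show ?thesis using G0 that by simp
  qed
  have "pair (cpow \<phi> d) z = pair (\<lambda>w. fact d * (if length w = d then \<Prod>g\<leftarrow>w. x g else 0)) z"
    unfolding pair_def
  proof (rule sum.cong[OF refl], goal_cases)
    case (1 w)
    then have w: "length w \<le> d" "set w \<subseteq> G0" using z(2) by (auto simp: deg_le_def G0_def)
    show ?case
    proof (cases "length w = d")
      case True
      have "cpow \<phi> d w = of_nat (fact d) * (\<Prod>g\<leftarrow>w. x g)"
        using p0 p1 w(2) True by (rule cpow_equal)
      then show ?thesis using True by simp
    next
      case False
      then have "cpow \<phi> d w = 0" using p0 w by (intro cpow_short) auto
      then show ?thesis using False by simp
    qed
  qed
  ultimately have "pair (\<lambda>w. if length w = d then \<Prod>g\<leftarrow>w. x g else 0) z = 0"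
    by (simp add: pair_scale_fun)
  moreover have "ev (top_part d z) x = pair (\<lambda>w. if length w = d then \<Prod>g\<leftarrow>w. x g else 0) z"
  proof -
    have f: "finite {w. cf z w \<noteq> 0}" using zF by (auto simp: FN_iff)
    show ?thesis unfolding ev_def
      by (subst (1 2) pair_superset[OF f]) (auto simp: cf_top intro!: sum.cong split: if_splits)
  qed
  ultimately show ?thesis by simp
qed

end

section \<open>Polynomial functions\<close>

lemma prod_mset_scale:
  "(\<Prod>h\<in>#m. (x(g := a * x g)) h) = a ^ count m g * (\<Prod>h\<in>#m. (x h :: complex))"
  by (induction m) auto

text \<open>Doubling one variable separates two different monomials, because powers of 2 are
  distinct; subtracting a multiple of the original identity removes \<open>m1\<close>. Testing only
  points without zero coordinates matters, since later applications divide by the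
  coordinates.\<close>

lemma mset_poly_zero:
  fixes c :: "'a multiset \<Rightarrow> complex"
  assumes "finite A" "\<And>x. (\<And>g. x g \<noteq> 0) \<Longrightarrow> (\<Sum>m\<in>A. c m * (\<Prod>h\<in>#m. x h)) = 0" "m \<in> A"
  shows "c m = 0"
  using assms
proof (induction A arbitrary: c m rule: finite_induct)
  case (insert m1 A)
  have A0: "c m = 0" if m: "m \<in> A" for m
  proof -
    have "m \<noteq> m1" using m insert.hyps by auto
    then obtain g where g: "count m g \<noteq> count m1 g" by (auto simp: multiset_eq_iff)
    have "c m * (2 ^ count m g - 2 ^ count m1 g) = 0"
    proof (rule insert.IH[OF _ m, of "\<lambda>m. c m * (2 ^ count m g - 2 ^ count m1 g)"])
      fix x :: "'a \<Rightarrow> complex" assume x: "\<And>g. x g \<noteq> 0"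
      have 1: "(\<Sum>m\<in>insert m1 A. c m * (\<Prod>h\<in>#m. x h)) = 0" using insert.prems(1) x by blast
      have "(\<Sum>m\<in>insert m1 A. c m * (\<Prod>h\<in>#m. (x(g := 2 * x g)) h)) = 0"
        using insert.prems(1)[of "x(g := 2 * x g)"] x by simp
      then have 2: "(\<Sum>m\<in>insert m1 A. c m * (2 ^ count m g * (\<Prod>h\<in>#m. x h))) = 0"
        by (simp only: prod_mset_scale)
      have "(\<Sum>m\<in>insert m1 A. c m * (2 ^ count m g - 2 ^ count m1 g) * (\<Prod>h\<in>#m. x h))
        = (\<Sum>m\<in>insert m1 A. c m * (2 ^ count m g * (\<Prod>h\<in>#m. x h)))
          - 2 ^ count m1 g * (\<Sum>m\<in>insert m1 A. c m * (\<Prod>h\<in>#m. x h))"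
        unfolding sum_distrib_left sum_subtractf[symmetric]
        by (rule sum.cong) (auto simp: algebra_simps)
      then show "(\<Sum>m\<in>A. c m * (2 ^ count m g - 2 ^ count m1 g) * (\<Prod>h\<in>#m. x h)) = 0"
        using 1 2 insert.hyps by simp
    qed
    moreover have "(2::complex) ^ count m g \<noteq> 2 ^ count m1 g"
    proof
      assume "(2::complex) ^ count m g = 2 ^ count m1 g"
      then have "of_nat (2 ^ count m g) = (of_nat (2 ^ count m1 g) :: complex)" by simp
      then have "(2::nat) ^ count m g = 2 ^ count m1 g" by (simp only: of_nat_eq_iff)
      then show False using g by simp
    qed
    ultimately show ?thesis by simp
  qed
  have "c m1 = 0"
    using insert.prems(1)[of "\<lambda>_. 1"] A0 insert.hyps by simp
  then show ?case using A0 insert.prems(2) by auto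
qed auto

lemma prod_list_mset: "(\<Prod>g\<leftarrow>w. x g) = (\<Prod>g\<in>#mset w. (x g :: complex))"
  by (induction w) auto

section \<open>Directional derivatives of polynomial functions\<close>

primrec dv :: "('g \<Rightarrow> complex) \<Rightarrow> ('g \<Rightarrow> complex) \<Rightarrow> 'g list \<Rightarrow> complex" where
  "dv x v [] = 0"
| "dv x v (g # w) = v g * (\<Prod>h\<leftarrow>w. x h) + x g * dv x v w"

definition dev :: "'g nc \<Rightarrow> ('g \<Rightarrow> complex) \<Rightarrow> ('g \<Rightarrow> complex) \<Rightarrow> complex" where
  "dev z x v = pair (dv x v) z"

lemma dv_cong: "(\<And>g. g \<in> set w \<Longrightarrow> x g = x' g \<and> v g = v' g) \<Longrightarrow> dv x v w = dv x' v' w"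
proof (induction w)
  case (Cons g w)
  have "map x w = map x' w" using Cons.prems by auto
  then show ?case using Cons by (auto simp del: map_eq_conv)
qed auto

lemma dev_cong:
  assumes "z \<in> FN G" "\<And>g. g \<in> G \<Longrightarrow> x g = x' g" "\<And>g. g \<in> G \<Longrightarrow> v g = v' g"
  shows "dev z x v = dev z x' v'"
  unfolding dev_def using assms(1) by (rule pair_cong) (use assms in \<open>auto intro!: dv_cong\<close>)

lemma dv_scale: "dv x (\<lambda>g. c * v g) w = c * dv x v w"
  by (induction w) (auto simp: algebra_simps)

lemma dev_scale: "dev z x (\<lambda>g. c * v g) = c * dev z x v"
  unfolding dev_def dv_scale by (rule pair_scale_fun)

lemma ev_has_derivative:
  assumes z: "z \<in> FN G" and d: "\<And>g. g \<in> G \<Longrightarrow> ((\<lambda>s. \<gamma> s g) has_field_derivative v g) (at s0)"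
  shows "((\<lambda>s. ev z (\<gamma> s)) has_field_derivative dev z (\<gamma> s0) v) (at s0)"
proof -
  have w: "((\<lambda>s. \<Prod>g\<leftarrow>w. \<gamma> s g) has_field_derivative dv (\<gamma> s0) v w) (at s0)" if "set w \<subseteq> G" for w
    using that
  proof (induction w)
    case (Cons g w)
    then have "((\<lambda>s. \<gamma> s g * (\<Prod>g\<leftarrow>w. \<gamma> s g)) has_field_derivative
       v g * (\<Prod>g\<leftarrow>w. \<gamma> s0 g) + dv (\<gamma> s0) v w * \<gamma> s0 g) (at s0)"
      by (intro DERIV_mult d) auto
    then show ?case by (simp add: mult.commute)
  qed auto
  show ?thesis unfolding ev_def dev_def pair_def
    by (intro DERIV_sum DERIV_cmult w) (use z in \<open>auto simp: FN_iff\<close>)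
qed

lemma ev_const_path:
  assumes z: "z \<in> FN G"
    and d: "\<And>s g. g \<in> G \<Longrightarrow> ((\<lambda>s. \<gamma> s g) has_field_derivative v s g) (at s)"
    and 0: "\<And>s. dev z (\<gamma> s) (v s) = 0"
  shows "ev z (\<gamma> s) = ev z (\<gamma> (0 :: complex))"
proof -
  have "((\<lambda>s. ev z (\<gamma> s)) has_field_derivative 0) (at s)" for s
    using ev_has_derivative[where z=z and G=G and \<gamma>=\<gamma> and v="v s" and ?s0.0=s] z d 0[of s] by simp
  then have "\<exists>c. \<forall>s\<in>UNIV. ev z (\<gamma> s) = c"
    by (intro has_field_derivative_zero_constant) auto
  then show ?thesis by auto
qed

lemma ev_line_poly:
  assumes "z \<in> FN G" shows "\<exists>p. \<forall>s. ev z (\<lambda>g. a g + s * b g) = poly p s"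
  using assms
proof (induction rule: FN_induct)
  case zero
  show ?case by (rule exI[of _ 0]) simp
next
  case (step c w p)
  have "\<exists>p. \<forall>s. (\<Prod>g\<leftarrow>w. a g + s * b g) = poly p s"
  proof (induction w)
    case (Cons g w)
    then obtain p where "\<And>s. (\<Prod>g\<leftarrow>w. a g + s * b g) = poly p s" by auto
    then show ?case by (intro exI[of _ "[:a g, b g:] * p"]) (simp add: algebra_simps)
  qed (auto intro: exI[of _ 1])
  then obtain q where q: "\<And>s. (\<Prod>g\<leftarrow>w. a g + s * b g) = poly q s" by auto
  obtain q' where q': "\<And>s. ev p (\<lambda>g. a g + s * b g) = poly q' s" using step by auto
  show ?case using q q' step
    by (intro exI[of _ "smult c q + q'"]) (simp add: ev_add[where G=G] FN_sc FN_wd)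
qed

section \<open>Reordering modulo lower degree, and the adjoint action\<close>

lemma nc_expand:
  assumes "z \<in> FN G" shows "z = (\<Sum>w | cf z w \<noteq> 0. sc (cf z w) (wd w))"
proof (rule nc_eqI)
  fix u
  have "finite {w. cf z w \<noteq> 0}" using assms by (simp add: FN_iff)
  then show "cf z u = cf (\<Sum>w | cf z w \<noteq> 0. sc (cf z w) (wd w)) u"
    by (simp add: cf_sum cf_wd if_distrib[of "\<lambda>x. _ * x"] cong: if_cong)
qed

context nilrad
begin

text \<open>Right adjoint action, w to [w, h], written out on words by the Leibniz rule without any
  reordering. It preserves length, so it is visible on symbols.\<close>

primrec adw :: "gen \<Rightarrow> gen list \<Rightarrow> gen nc" where
  "adw h [] = 0"
| "adw h (g # w) = B g h * wd w + wd [g] * adw h w"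

text \<open>Coadjoint vector field of \<open>h\<close> at the point \<open>x\<close> of the dual:
  its component in the coordinate g is the value of the linear form [g, h].\<close>

definition xi :: "gen \<Rightarrow> (gen \<Rightarrow> complex) \<Rightarrow> gen \<Rightarrow> complex" where
  "xi h x g = ev (B g h) x"

lemma adw_FN: "h \<in> GG \<Longrightarrow> set w \<subseteq> GG \<Longrightarrow> adw h w \<in> FN GG"
  by (induction w) (auto intro!: FN_add FN_mul FN_wd FN_B)

lemma adw_hom: "hom (length w) (adw h w)"
proof (induction w)
  case (Cons g w)
  have "hom (Suc 0 + length w) (B g h * wd w)" by (intro hom_mul hom_B hom_wd) simp
  moreover have "hom (Suc 0 + length w) (wd [g] * adw h w)" by (intro hom_mul hom_wd Cons) simp
  ultimately show ?case by (simp add: hom_add)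
qed simp

lemma adw_0: "(\<And>g. g \<in> set w \<Longrightarrow> B g h = 0) \<Longrightarrow> adw h w = 0"
  by (induction w) auto

lemma adw_closed:
  assumes "\<And>g. g \<in> G \<Longrightarrow> B g h \<in> FN G" "set w \<subseteq> G" shows "adw h w \<in> FN G"
  using assms(2) by (induction w) (auto intro!: FN_add FN_mul FN_wd assms(1))

lemma adw_commutator:
  assumes "h \<in> GG" "set w \<subseteq> GG" shows "wd w * wd [h] - wd [h] * wd w - adw h w \<in> J"
  using assms(2)
proof (induction w)
  case Nil then show ?case by (simp add: wd_Nil)
next
  case (Cons g w)
  have "(wd [g, h] - wd [h, g] - B g h) * wd w + wd [g] * (wd w * wd [h] - wd [h] * wd w - adw h w) \<in> J"
    using Cons assms by (intro idl_add idl_mul_left idl_mul_right URelI) auto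
  moreover have "wd (g # w) = wd [g] * wd w" by (simp add: wd_append)
  moreover have "wd [g, h] = wd [g] * wd [h]" "wd [h, g] = wd [h] * wd [g]" by (simp_all add: wd_append)
  ultimately show ?case by (simp add: algebra_simps)
qed

lemma ev_adw:
  assumes "h \<in> GG" "set w \<subseteq> GG" shows "ev (adw h w) x = dv x (xi h x) w"
  using assms(2)
  by (induction w)
    (simp_all add: ev_add[where G=GG] ev_mul[where G=GG] FN_mul FN_B FN_wd adw_FN assms(1) xi_def)

definition adz :: "gen \<Rightarrow> gen nc \<Rightarrow> gen nc" where
  "adz h z = (\<Sum>w | cf z w \<noteq> 0. sc (cf z w) (adw h w))"

lemma adz_FN: "h \<in> GG \<Longrightarrow> z \<in> FN GG \<Longrightarrow> adz h z \<in> FN GG"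
  unfolding adz_def by (intro FN_sum FN_sc adw_FN) (auto simp: FN_iff)

lemma adz_closed:
  "(\<And>g. g \<in> G \<Longrightarrow> B g h \<in> FN G) \<Longrightarrow> z \<in> FN G \<Longrightarrow> adz h z \<in> FN G"
  unfolding adz_def by (intro FN_sum FN_sc adw_closed) (auto simp: FN_iff)

lemma adz_deg: "deg_le d z \<Longrightarrow> deg_le d (adz h z)"
  unfolding adz_def by (intro deg_le_sum deg_le_sc hom_deg_le[OF adw_hom]) (auto simp: deg_le_def)

lemma adz_hom: "hom d z \<Longrightarrow> hom d (adz h z)"
  unfolding adz_def
  by (intro hom_sum hom_sc) (use adw_hom in \<open>auto simp: hom_def\<close>)

lemma adz_commutator:
  assumes "h \<in> GG" "z \<in> FN GG" shows "z * wd [h] - wd [h] * z - adz h z \<in> J"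
proof -
  have "(\<Sum>w | cf z w \<noteq> 0. sc (cf z w) (wd w * wd [h] - wd [h] * wd w - adw h w)) \<in> J"
    by (intro idl_sum idl_sc adw_commutator) (use assms in \<open>auto simp: FN_iff\<close>)
  also have "(\<Sum>w | cf z w \<noteq> 0. sc (cf z w) (wd w * wd [h] - wd [h] * wd w - adw h w)) =
    (\<Sum>w | cf z w \<noteq> 0. sc (cf z w) (wd w)) * wd [h] - wd [h] * (\<Sum>w | cf z w \<noteq> 0. sc (cf z w) (wd w))
      - adz h z"
    unfolding adz_def by (simp add: sum_distrib_left sum_distrib_right sum_subtractf)
  finally show ?thesis using nc_expand[OF assms(2)] by simp
qed

text \<open>Replacing one letter g by [g, h] and summing over the letters is, after commutative
  evaluation, differentiation along the vector field of \<open>h\<close>.\<close>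

lemma ev_top_adz:
  assumes "h \<in> GG" "z \<in> FN GG"
  shows "ev (top_part d (adz h z)) x = dev (top_part d z) x (xi h x)"
proof -
  have f: "finite {w. cf z w \<noteq> 0}" "\<And>w. cf z w \<noteq> 0 \<Longrightarrow> set w \<subseteq> GG" using assms by (auto simp: FN_iff)
  have t: "top_part d (adw h w) = (if length w = d then adw h w else 0)" for w
    using adw_hom[of w h] by (cases "length w = d") (force simp: top_hom hom_def cf_top intro!: nc_eqI)+
  have "ev (top_part d (adz h z)) x = (\<Sum>w | cf z w \<noteq> 0. ev (sc (cf z w) (top_part d (adw h w))) x)"
    unfolding adz_def top_sum top_sc
    by (rule ev_sum[where G=GG]) (use f assms in \<open>auto intro!: FN_sc FN_top adw_FN\<close>)
  also have "\<dots> = (\<Sum>w | cf z w \<noteq> 0. cf (top_part d z) w * dv x (xi h x) w)"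
    by (rule sum.cong) (use f assms in \<open>auto simp: t ev_adw cf_top\<close>)
  also have "\<dots> = dev (top_part d z) x (xi h x)"
    unfolding dev_def by (rule pair_superset[symmetric]) (use f in \<open>auto simp: cf_top split: if_splits\<close>)
  finally show ?thesis .
qed

text \<open>Moving the first letter of \<open>w\<close> to its place in \<open>w'\<close> costs one
  adjoint term, which is one letter shorter; the rest is the induction hypothesis. The last clause
  records that commuting letters cost nothing, and the centrality of the generators rests on
  it.\<close>

lemma reorder_word:
  assumes "set w \<subseteq> GG" "mset w = mset w'"
  shows "\<exists>e\<in>FN GG. wd w - wd w' - e \<in> J \<and> deg_le (length w - 1) e \<and>
    ((\<forall>g\<in>set w. \<forall>h\<in>set w. B g h = 0) \<longrightarrow> e = 0)"
  using assms
proof (induction w arbitrary: w')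
  case Nil
  then show ?case by (intro bexI[of _ 0]) auto
next
  case (Cons g v)
  have "g \<in> set w'" using Cons.prems(2) by (metis list.set_intros(1) set_mset_mset)
  then obtain u s where w': "w' = u @ g # s" by (auto simp: in_set_conv_decomp)
  then have m: "mset v = mset (u @ s)" using Cons.prems(2) by simp
  then have lv: "length v = length u + length s" by (metis length_append size_mset)
  have sv: "set v = set u \<union> set s" using m by (metis set_append set_mset_mset)
  obtain e1 where e1: "e1 \<in> FN GG" "wd v - wd (u @ s) - e1 \<in> J" "deg_le (length v - 1) e1"
    "(\<forall>g\<in>set v. \<forall>h\<in>set v. B g h = 0) \<longrightarrow> e1 = 0"
    using Cons.IH[OF _ m] Cons.prems(1) by auto
  show ?case
  proof (cases "v = []")
    case True
    then show ?thesis using lv w' by (intro bexI[of _ 0]) auto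
  next
    case False
    define e where "e = wd [g] * e1 - adw g u * wd s"
    have "wd [g] * (wd v - wd (u @ s) - e1) - (wd u * wd [g] - wd [g] * wd u - adw g u) * wd s \<in> J"
      using Cons.prems(1) sv by (intro idl_diff idl_mul_left idl_mul_right e1 adw_commutator) auto
    moreover have "wd (g # v) = wd [g] * wd v" "wd (u @ s) = wd u * wd s" "wd w' = wd u * (wd [g] * wd s)"
      by (simp_all add: wd_append w')
    ultimately have 1: "wd (g # v) - wd w' - e \<in> J" by (simp add: e_def algebra_simps)
    have "e \<in> FN GG" using Cons.prems(1) sv e1
      by (auto simp: e_def intro!: FN_diff FN_mul FN_wd adw_FN)
    moreover have "deg_le (length v) e"
    proof -
      have "deg_le (1 + (length v - 1)) (wd [g] * e1)"
        by (intro deg_le_mul e1 hom_deg_le[OF hom_wd]) auto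
      then have "deg_le (length v) (wd [g] * e1)" using False by simp
      moreover have "deg_le (length u + length s) (adw g u * wd s)"
        by (intro deg_le_mul hom_deg_le[OF adw_hom] hom_deg_le[OF hom_wd]) auto
      ultimately show ?thesis using lv unfolding e_def by (intro deg_le_diff) auto
    qed
    moreover have "e = 0" if "\<forall>p\<in>set (g # v). \<forall>q\<in>set (g # v). B p q = 0"
    proof -
      have "adw g u = 0" by (rule adw_0) (use that sv in auto)
      then show ?thesis using that e1(4) by (simp add: e_def)
    qed
    ultimately show ?thesis using 1 by (intro bexI[of _ e]) auto
  qed
qed

text \<open>One arrangement \<open>rp m\<close> for every multiset of letters gathers the top
  component into one coefficient per commutative monomial. These coefficients vanish with the
  symbol, so only the reordering errors and the lower words are left.\<close>

lemma reorder:
  assumes z: "z \<in> FN GG" "deg_le d z" "\<And>x. ev (top_part d z) x = 0"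
  shows "\<exists>z'\<in>FN GG. z - z' \<in> J \<and> deg_le (d - 1) z' \<and>
    (hom d z \<longrightarrow> z \<in> FN G \<longrightarrow> (\<forall>g\<in>G. \<forall>h\<in>G. B g h = 0) \<longrightarrow> z' = 0)"
proof -
  define W where "W = {w. cf z w \<noteq> 0 \<and> length w = d}"
  define zl where "zl = z - top_part d z"
  define rp where "rp m = (SOME w. mset w = m)" for m :: "gen multiset"
  have rp: "mset (rp m) = m" for m unfolding rp_def by (rule someI_ex) (rule ex_mset)
  have fW: "finite W" and sW: "\<And>w. w \<in> W \<Longrightarrow> set w \<subseteq> GG"
    using z(1) by (auto simp: W_def FN_iff)
  have "\<forall>w\<in>W. \<exists>e. e \<in> FN GG \<and> wd w - wd (rp (mset w)) - e \<in> J \<and> deg_le (d - 1) e \<and>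
    ((\<forall>g\<in>set w. \<forall>h\<in>set w. B g h = 0) \<longrightarrow> e = 0)"
    using reorder_word[OF sW, of _ "rp (mset _)"] rp by (fastforce simp: W_def)
  then obtain e where e: "\<And>w. w \<in> W \<Longrightarrow> e w \<in> FN GG"
    "\<And>w. w \<in> W \<Longrightarrow> wd w - wd (rp (mset w)) - e w \<in> J" "\<And>w. w \<in> W \<Longrightarrow> deg_le (d - 1) (e w)"
    "\<And>w. w \<in> W \<Longrightarrow> \<forall>g\<in>set w. \<forall>h\<in>set w. B g h = 0 \<Longrightarrow> e w = 0"
    by metis
  have top: "top_part d z = (\<Sum>w\<in>W. sc (cf z w) (wd w))"
  proof -
    have "{w. cf (top_part d z) w \<noteq> 0} = W" by (auto simp: W_def cf_top)
    then have "top_part d z = (\<Sum>w\<in>W. sc (cf (top_part d z) w) (wd w))"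
      using nc_expand[OF FN_top[OF z(1)], of d] by simp
    also have "\<dots> = (\<Sum>w\<in>W. sc (cf z w) (wd w))" by (rule sum.cong) (auto simp: W_def cf_top)
    finally show ?thesis .
  qed
  define cm where "cm m = (\<Sum>w | w \<in> W \<and> mset w = m. cf z w)" for m
  have cm0: "cm m = 0" if "m \<in> mset ` W" for m
  proof (rule mset_poly_zero[OF _ _ that, of cm])
    fix x :: "gen \<Rightarrow> complex"
    have "0 = ev (top_part d z) x" using z(3) by simp
    also have "\<dots> = (\<Sum>w\<in>W. cf z w * (\<Prod>g\<in>#mset w. x g))"
      unfolding top by (subst ev_sum[where G=GG]) (use sW in \<open>auto simp: prod_list_mset intro!: FN_sc FN_wd\<close>)
    also have "\<dots> = (\<Sum>m\<in>mset ` W. \<Sum>w | w \<in> W \<and> mset w = m. cf z w * (\<Prod>g\<in>#mset w. x g))"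
      by (rule sum.image_gen[OF fW])
    also have "\<dots> = (\<Sum>m\<in>mset ` W. cm m * (\<Prod>g\<in>#m. x g))"
      unfolding cm_def sum_distrib_right by (intro sum.cong) auto
    finally show "(\<Sum>m\<in>mset ` W. cm m * (\<Prod>g\<in>#m. x g)) = 0" by simp
  qed (use fW in auto)
  have rp0: "(\<Sum>w\<in>W. sc (cf z w) (wd (rp (mset w)))) = 0"
  proof -
    have "(\<Sum>w\<in>W. sc (cf z w) (wd (rp (mset w))))
      = (\<Sum>m\<in>mset ` W. \<Sum>w | w \<in> W \<and> mset w = m. sc (cf z w) (wd (rp (mset w))))"
      by (rule sum.image_gen[OF fW])
    also have "\<dots> = (\<Sum>m\<in>mset ` W. sc (cm m) (wd (rp m)))"
      unfolding cm_def sc_sum_left by (intro sum.cong) auto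
    also have "\<dots> = 0" by (rule sum.neutral) (use cm0 in auto)
    finally show ?thesis .
  qed
  define z' where "z' = zl + (\<Sum>w\<in>W. sc (cf z w) (e w))"
  have "(\<Sum>w\<in>W. sc (cf z w) (wd w - wd (rp (mset w)) - e w)) \<in> J"
    by (intro idl_sum idl_sc e)
  then have "top_part d z - (\<Sum>w\<in>W. sc (cf z w) (e w)) \<in> J"
    using rp0 by (simp add: top sum_subtractf)
  then have "z - z' \<in> J" by (simp add: z'_def zl_def algebra_simps)
  moreover have "z' \<in> FN GG" unfolding z'_def zl_def
    by (intro FN_add FN_diff FN_sum FN_sc e FN_top z)
  moreover have "deg_le (d - 1) z'"
  proof -
    have "deg_le (d - 1) zl" using z(2) by (force simp: zl_def deg_le_def cf_top)
    then show ?thesis unfolding z'_def by (intro deg_le_add deg_le_sum deg_le_sc e)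
  qed
  moreover have "z' = 0" if "hom d z" "z \<in> FN G" "\<forall>g\<in>G. \<forall>h\<in>G. B g h = 0"
  proof -
    have "e w = 0" if "w \<in> W" for w
      using e(4)[OF that] \<open>z \<in> FN G\<close> \<open>\<forall>g\<in>G. \<forall>h\<in>G. B g h = 0\<close> that by (auto simp: FN_iff W_def)
    then show ?thesis using that(1) by (simp add: z'_def zl_def top_hom)
  qed
  ultimately show ?thesis by blast
qed

section \<open>The centre\<close>

definition central :: "gen nc \<Rightarrow> bool" where
  "central z \<longleftrightarrow> z \<in> FN GG \<and> (\<forall>y\<in>FN GG. z * y - y * z \<in> J)"

lemma Zc_central: "z \<in> Zc t r \<longleftrightarrow> central (nc z)"
proof -
  have "(fsub (fmul z y) (fmul y z) \<in> UJ t r) = (nc z * nc y - nc y * nc z \<in> J)" for y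
    by (simp add: UJ_def idl_nc[symmetric] nc_simps)
  moreover have "(\<forall>y\<in>FN GG. P y) \<longleftrightarrow> (\<forall>y\<in>FA GG. P (nc y))" for P
    unfolding FN_def by (metis cf_inverse cf_nc mem_Collect_eq)
  ultimately show ?thesis by (simp add: Zc_def central_def FN_nc)
qed

lemma central_1: "central 1" by (simp add: central_def)

lemma central_add:
  assumes "central p" "central q" shows "central (p + q)"
  unfolding central_def
proof (intro conjI ballI)
  show "p + q \<in> FN GG" using assms by (auto simp: central_def)
  fix y assume "y \<in> FN GG"
  then have "(p * y - y * p) + (q * y - y * q) \<in> J" using assms by (intro idl_add) (auto simp: central_def)
  then show "(p + q) * y - y * (p + q) \<in> J" by (simp add: algebra_simps)
qed

lemma central_sc:
  assumes "central p" shows "central (sc c p)"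
  unfolding central_def
proof (intro conjI ballI)
  show "sc c p \<in> FN GG" using assms by (auto simp: central_def)
  fix y assume "y \<in> FN GG"
  then have "sc c (p * y - y * p) \<in> J" using assms by (intro idl_sc) (auto simp: central_def)
  then show "sc c p * y - y * sc c p \<in> J" by simp
qed

lemma central_mul:
  assumes "central p" "central q" shows "central (p * q)"
  unfolding central_def
proof (intro conjI ballI)
  show "p * q \<in> FN GG" using assms by (auto simp: central_def)
  fix y assume "y \<in> FN GG"
  then have "p * (q * y - y * q) + (p * y - y * p) * q \<in> J"
    using assms by (intro idl_add idl_mul_left idl_mul_right) (auto simp: central_def)
  then show "(p * q) * y - y * (p * q) \<in> J" by (simp add: algebra_simps)
qed

lemma central_cong:
  assumes "central p" "q \<in> FN GG" "q - p \<in> J" shows "central q"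
  unfolding central_def
proof (intro conjI ballI)
  fix y assume y: "y \<in> FN GG"
  then have "p * y - y * p \<in> J" "(q - p) * y \<in> J" "y * (q - p) \<in> J"
    using assms by (auto simp: central_def)
  then have "(p * y - y * p) + ((q - p) * y - y * (q - p)) \<in> J"
    by (intro idl_add idl_diff[of "(q - p) * y"])
  then show "q * y - y * q \<in> J" by (simp add: algebra_simps)
qed (rule assms)

lemma central_gens:
  assumes z: "z \<in> FN GG" "\<And>h. h \<in> GG \<Longrightarrow> z * wd [h] - wd [h] * z \<in> J" shows "central z"
  unfolding central_def
proof (intro conjI ballI)
  fix y assume "y \<in> FN GG"
  then show "z * y - y * z \<in> J"
  proof (induction rule: FN_induct)
    case (step c w p)
    have "z * wd w - wd w * z \<in> J" using step(1)
    proof (induction w)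
      case (Cons h w)
      then have "(z * wd [h] - wd [h] * z) * wd w + wd [h] * (z * wd w - wd w * z) \<in> J"
        by (intro idl_add idl_mul_left idl_mul_right z) auto
      moreover have "wd (h # w) = wd [h] * wd w" by (simp add: wd_append)
      ultimately show ?case by (simp add: algebra_simps)
    qed (simp add: wd_Nil)
    then have "sc c (z * wd w - wd w * z) + (z * p - p * z) \<in> J" using step by (intro idl_add idl_sc)
    then show ?case by (simp add: algebra_simps)
  qed auto
qed (rule z)

text \<open>The commutator with \<open>h\<close> lies in the ideal and is congruent to
  \<open>adz h z\<close>, whose symbol in degree d is the derivative of the symbol of
  \<open>z\<close> along the vector field of \<open>h\<close>.\<close>

lemma central_invariant:
  assumes "central z" "deg_le d z" "h \<in> GG" shows "dev (top_part d z) x (xi h x) = 0"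
proof -
  have z: "z \<in> FN GG" using assms by (simp add: central_def)
  have "z * wd [h] - wd [h] * z \<in> J" using assms by (auto simp: central_def intro!: FN_wd)
  then have "(z * wd [h] - wd [h] * z) - (z * wd [h] - wd [h] * z - adz h z) \<in> J"
    using adz_commutator[OF assms(3) z] by (rule idl_diff)
  then have "adz h z \<in> J" by simp
  from symbol_J[OF this adz_deg[OF assms(2)], of x] show ?thesis
    by (simp add: ev_top_adz assms z)
qed

text \<open>\<open>adz h z\<close> has vanishing symbol and involves only letters of the commuting
  set \<open>G\<close>; rearranging its words leaves no error, so it lies in the ideal and
  \<open>z\<close> commutes with \<open>h\<close> exactly.\<close>

lemma invariant_central:
  assumes G: "G \<subseteq> GG" "\<And>g h. g \<in> G \<Longrightarrow> h \<in> GG \<Longrightarrow> B g h \<in> FN G"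
      "\<And>g h. g \<in> G \<Longrightarrow> h \<in> G \<Longrightarrow> B g h = 0"
    and z: "z \<in> FN G" "hom d z" "\<And>h x. h \<in> GG \<Longrightarrow> dev z x (xi h x) = 0"
  shows "central z"
proof (rule central_gens)
  show zG: "z \<in> FN GG" using z(1) G(1) by (rule FN_mono)
  fix h assume h: "h \<in> GG"
  have "hom d (adz h z)" by (rule adz_hom[OF z(2)])
  moreover have "adz h z \<in> FN G" by (rule adz_closed[OF G(2)]) (use h z in auto)
  moreover have "ev (top_part d (adz h z)) x = 0" for x
    using z h zG by (simp add: ev_top_adz top_hom)
  ultimately have "\<exists>z'\<in>FN GG. adz h z - z' \<in> J \<and> deg_le (d - 1) z' \<and> z' = 0"
    using reorder[of "adz h z" d G] adz_FN[OF h zG] hom_deg_le[of d "adz h z" d] G(3) by blast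
  then have "adz h z \<in> J" by auto
  then have "(z * wd [h] - wd [h] * z - adz h z) + adz h z \<in> J"
    using adz_commutator[OF h zG] by (intro idl_add)
  then show "z * wd [h] - wd [h] * z \<in> J" by simp
qed

end

section \<open>The variables of an invariant\<close>

context nilrad
begin

text \<open>An index outside \<open>Up\<close> has infinitely many indices above it, hence one that
  does not occur in a given element; \<open>Up\<close> collects the indices where this choice may
  fail, and \<open>Lo\<close> does the same from below.\<close>

definition Up :: "nat set" where "Up = {a. 0 < a \<and> finite {c. 0 < c \<and> gt c a}}"
definition Lo :: "nat set" where "Lo = {b. 0 < b \<and> finite {c. 0 < c \<and> gt b c}}"

definition Gc :: "gen set" where
  "Gc = {D a b |a b. tA \<and> a \<in> Up \<and> b \<in> Lo} \<union> {S a b |a b. \<not> tA \<and> a \<in> Up \<and> b \<in> Up \<and> gt a b}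
      \<union> {L a |a. tC \<and> a \<in> Up}"

lemma Gc_iff:
  "D a b \<in> Gc \<longleftrightarrow> tA \<and> a \<in> Up \<and> b \<in> Lo"
  "S a b \<in> Gc \<longleftrightarrow> \<not> tA \<and> a \<in> Up \<and> b \<in> Up \<and> gt a b"
  "L a \<in> Gc \<longleftrightarrow> tC \<and> a \<in> Up"
  "H a \<notin> Gc"
  by (auto simp: Gc_def)

lemma Up_pos: "a \<in> Up \<Longrightarrow> 0 < a" and Lo_pos: "a \<in> Lo \<Longrightarrow> 0 < a"
  by (auto simp: Up_def Lo_def)

lemma Up_up: "a \<in> Up \<Longrightarrow> 0 < c \<Longrightarrow> gt c a \<Longrightarrow> c \<in> Up"
  unfolding Up_def by (auto elim!: rev_finite_subset intro: gt_trans)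

lemma Lo_down: "b \<in> Lo \<Longrightarrow> 0 < c \<Longrightarrow> gt b c \<Longrightarrow> c \<in> Lo"
  unfolding Lo_def by (auto elim!: rev_finite_subset intro: gt_trans)

lemma infinite_pos: "infinite {c::nat. 0 < c}"
  using infinite_Ioi[of "0::nat"] by (simp add: greaterThan_def)

text \<open>Otherwise every positive index would lie above \<open>a\<close>, below \<open>b\<close>
  or equal one of them, and these form a finite set.\<close>

lemma Up_Lo: assumes "a \<in> Up" "b \<in> Lo" shows "gt a b"
proof (rule ccontr)
  assume n: "\<not> gt a b"
  have p: "0 < a" "0 < b" using assms by (auto simp: Up_pos Lo_pos)
  have "{c. 0 < c} \<subseteq> {c. 0 < c \<and> gt c a} \<union> {c. 0 < c \<and> gt b c} \<union> {a, b}"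
  proof
    fix c assume "c \<in> {c::nat. 0 < c}"
    then have "c = a \<or> gt c a \<or> gt a c" "a = b \<or> gt b a" using gt_total[of c a] gt_total[of a b] n p by auto
    then show "c \<in> {c. 0 < c \<and> gt c a} \<union> {c. 0 < c \<and> gt b c} \<union> {a, b}"
      using \<open>c \<in> {c::nat. 0 < c}\<close> gt_trans[of b a c] by auto
  qed
  moreover have "finite ({c. 0 < c \<and> gt c a} \<union> {c. 0 < c \<and> gt b c} \<union> {a, b})"
    using assms by (auto simp: Up_def Lo_def)
  ultimately show False using infinite_pos finite_subset by blast
qed

lemma Up_Lo_disjoint: "a \<in> Up \<Longrightarrow> a \<notin> Lo"
  using Up_Lo[of a a] by auto

lemma Gc_GG: "Gc \<subseteq> GG"
  using Up_Lo Up_pos Lo_pos by (auto simp: Gc_def GG_iff)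

lemma FN_V: "\<not> tA \<Longrightarrow> a \<in> Up \<Longrightarrow> b \<in> Up \<Longrightarrow> V a b \<in> FN Gc"
  using gt_total[of a b] Up_pos[of a] Up_pos[of b]
  by (auto simp: nc_vv Gc_iff intro!: FN_sc FN_wd)

lemma Gc_ideal: assumes "g \<in> Gc" "h \<in> GG" shows "B g h \<in> FN Gc"
proof -
  have z: "sc (dl i j) p \<in> FN Gc" if "i = j \<Longrightarrow> p \<in> FN Gc" for i j p
    using that by (cases "i = j") (auto simp: dl_def)
  have z': "sc (c * dl i j) p \<in> FN Gc" if "i = j \<Longrightarrow> p \<in> FN Gc" for i j p c
    using that by (cases "i = j") (auto simp: dl_def)
  show ?thesis
    using assms
    by (cases g; cases h)
       (auto simp: B_simps Gc_iff GG_iff types_exclusive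
         intro!: z z' FN_diff FN_add FN_minus FN_V FN_wd intro: Up_up Lo_down)
qed

text \<open>Sum roots commute among themselves; in type A two difference roots compose only through
  an index in both \<open>Up\<close> and \<open>Lo\<close>.\<close>

lemma Gc_commute: assumes "g \<in> Gc" "h \<in> Gc" shows "B g h = 0"
proof -
  have "dl i j = 0" if "i \<in> Up" "j \<in> Lo" for i j
    using that Up_Lo_disjoint by (auto simp: dl_def)
  moreover have "dl j i = 0" if "i \<in> Up" "j \<in> Lo" for i j
    using that Up_Lo_disjoint by (auto simp: dl_def)
  ultimately show ?thesis
    using assms by (cases g; cases h) (auto simp: B_simps Gc_iff types_exclusive)
qed

lemma ev_V:
  "ev (V a b) x = (if a = b then (if tC then 2 * x (L a) else 0)
     else if gt a b then x (S a b) else eps * x (S b a))"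
  by (auto simp: nc_vv)

lemma xi_simps:
  "xi (D k l) x (D i j) = dl j k * x (D i l) - dl l i * x (D k j)"
  "xi (S k l) x (D i j) = dl j k * ev (V i l) x + eps * dl j l * ev (V i k) x"
  "xi (D i j) x (S k l) = - dl j k * ev (V i l) x - eps * dl j l * ev (V i k) x"
  "xi (L k) x (D i j) = dl j k * ev (V i k) x"
  "xi (D i j) x (L k) = - dl j k * ev (V i k) x"
  "xi (H k) x (D i j) = dl j k * x (H i)"
  "xi (D i j) x (H k) = - dl j k * x (H i)"
  "xi (H k) x (H i) = - ev (V i k) x"
  "xi (S k l) x (S i j) = 0" "xi (L k) x (S i j) = 0" "xi (H k) x (S i j) = 0"
  "xi (S k l) x (L i) = 0" "xi (L k) x (L i) = 0" "xi (H k) x (L i) = 0"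
  "xi (S k l) x (H i) = 0" "xi (L k) x (H i) = 0"
  by (simp_all add: FN_UNIV_V ev_add[where G=UNIV] ev_diff[where G=UNIV] B_simps xi_def)

definition invariant :: "gen nc \<Rightarrow> bool" where
  "invariant z \<longleftrightarrow> z \<in> FN GG \<and> (\<forall>h\<in>GG. \<forall>x. dev z x (xi h x) = 0)"

definition indep :: "gen nc \<Rightarrow> gen set \<Rightarrow> bool" where
  "indep z K \<longleftrightarrow> (\<forall>x y. (\<forall>g. g \<notin> K \<longrightarrow> x g = y g) \<longrightarrow> ev z x = ev z y)"

lemma indep_mono: "indep z K' \<Longrightarrow> K \<subseteq> K' \<Longrightarrow> indep z K"
  unfolding indep_def by (meson in_mono)

lemma indep_Un:
  assumes "indep z K" "indep z K'" shows "indep z (K \<union> K')"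
  unfolding indep_def
proof (intro allI impI)
  fix x y :: "gen \<Rightarrow> complex" assume a: "\<forall>g. g \<notin> K \<union> K' \<longrightarrow> x g = y g"
  define u where "u g = (if g \<in> K then y g else x g)" for g
  have "ev z x = ev z u" using assms(1)[unfolded indep_def, rule_format, of x u] by (simp add: u_def)
  also have "\<dots> = ev z y" using assms(2)[unfolded indep_def, rule_format, of u y] a by (simp add: u_def)
  finally show "ev z x = ev z y" .
qed

lemma indep_UN: "finite A \<Longrightarrow> (\<And>i. i \<in> A \<Longrightarrow> indep z (K i)) \<Longrightarrow> indep z (\<Union>i\<in>A. K i)"
proof (induction A rule: finite_induct)
  case empty
  then show ?case by (auto simp: indep_def intro!: arg_cong[of _ _ "ev z"])
qed (auto intro: indep_Un)

lemma indep_outside: "z \<in> FN G \<Longrightarrow> indep z (- G)"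
  unfolding indep_def by (auto intro!: ev_cong)

text \<open>If the flow of h sends the coordinates in K to pairwise distinct coordinates
  not occurring in z, then the latter can be prescribed arbitrarily, so z is constant along K.\<close>

lemma fresh_indep:
  assumes z: "invariant z" "z \<in> FN G0" "h \<in> GG"
    and K: "\<And>g. g \<in> G0 \<inter> K \<Longrightarrow> \<kappa> g \<noteq> 0 \<and> \<rho> g \<notin> G0 \<and> (\<forall>x. xi h x g = \<kappa> g * x (\<rho> g))"
    and inj: "inj_on \<rho> (G0 \<inter> K)"
    and nK: "\<And>g x. g \<in> G0 - K \<Longrightarrow> xi h x g = 0"
  shows "indep z K"
  unfolding indep_def
proof (intro allI impI)
  fix x y :: "gen \<Rightarrow> complex" assume xy: "\<forall>g. g \<notin> K \<longrightarrow> x g = y g"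
  define v where "v g = y g - x g" for g
  define \<gamma> where "\<gamma> s g = x g + s * v g" for s g
  have "ev z (\<gamma> 1) = ev z (\<gamma> 0)"
  proof (rule ev_const_path[OF z(2), where v="\<lambda>s. v"])
    show "((\<lambda>s. \<gamma> s g) has_field_derivative v g) (at s)" for s g
      unfolding \<gamma>_def by (auto intro!: derivative_eq_intros)
    fix s
    \<comment> \<open>A point with the coordinates of \<gamma> s at the letters of \<open>z\<close>,
      whose fresh coordinates are solved for so that the vector field of \<open>h\<close> has the
      prescribed value \<open>v\<close> at those letters.\<close>
    define x' where "x' g = (if g \<in> \<rho> ` (G0 \<inter> K) then v (inv_into (G0 \<inter> K) \<rho> g) / \<kappa> (inv_into (G0 \<inter> K) \<rho> g)
       else \<gamma> s g)" for g
    have "dev z (\<gamma> s) v = dev z x' (xi h x')"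
    proof (rule dev_cong[OF z(2)])
      fix g assume g: "g \<in> G0"
      then have "g \<notin> \<rho> ` (G0 \<inter> K)" using K by blast
      then show "\<gamma> s g = x' g" by (simp add: x'_def)
      show "v g = xi h x' g"
      proof (cases "g \<in> K")
        case True
        then have g': "g \<in> G0 \<inter> K" using g by auto
        then have "x' (\<rho> g) = v g / \<kappa> g" using inj by (simp add: x'_def)
        then show ?thesis using K[OF g'] by simp
      next
        case False
        then show ?thesis using nK[of g x'] g xy by (simp add: v_def)
      qed
    qed
    then show "dev z (\<gamma> s) v = 0" using z by (simp add: invariant_def)
  qed
  moreover have "\<gamma> 1 = y" "\<gamma> 0 = x" by (auto simp: \<gamma>_def v_def fun_eq_iff)
  ultimately show "ev z x = ev z y" by simp
qed

text \<open>The generator of a sum root without regard to the order of its indices;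
  \<open>kap\<close> is the sign by which \<open>V a b\<close> differs from it.\<close>

definition sg :: "nat \<Rightarrow> nat \<Rightarrow> gen" where "sg a b = (if gt a b then S a b else S b a)"
definition kap :: "nat \<Rightarrow> nat \<Rightarrow> complex" where "kap a b = (if gt a b then 1 else eps)"

lemma ev_V_sg: "a \<noteq> b \<Longrightarrow> ev (V a b) x = kap a b * x (sg a b)"
  by (simp add: ev_V sg_def kap_def)

lemma kap_nz: "kap a b \<noteq> 0" and eps_nz: "eps \<noteq> 0"
  by (auto simp: kap_def eps_def)

lemma sg_inj: "sg c b = sg c b' \<Longrightarrow> c \<noteq> b \<Longrightarrow> b = b'"
  by (auto simp: sg_def split: if_splits)

lemma sg_GG: "\<not> tA \<Longrightarrow> 0 < a \<Longrightarrow> 0 < b \<Longrightarrow> a \<noteq> b \<Longrightarrow> sg a b \<in> GG"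
  using gt_total[of a b] by (auto simp: sg_def GG_iff)

fun idx :: "gen \<Rightarrow> nat set" where
  "idx (D a b) = {a, b}" | "idx (S a b) = {a, b}" | "idx (L a) = {a}" | "idx (H a) = {a}"

lemma idx_sg: "idx (sg a b) = {a, b}" by (auto simp: sg_def)

lemma infinite_fresh:
  assumes "infinite A" "finite G0" obtains c where "c \<in> A" "c \<notin> \<Union> (idx ` G0)"
proof -
  have "finite (idx g)" for g by (cases g) auto
  then have "finite (\<Union> (idx ` G0))" using assms by auto
  then have "infinite (A - \<Union> (idx ` G0))" using assms(1) by simp
  then have "A - \<Union> (idx ` G0) \<noteq> {}" by (metis finite.emptyI)
  then show ?thesis using that by blast
qed

text \<open>Four families cover all coordinates outside \<open>Gc\<close>. For each of them a root
  vector with a fresh index c moves the whole family to coordinates containing c and fixes the other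
  coordinates that occur.\<close>

lemma invariant_indep_Gc:
  assumes z: "invariant z" shows "indep z (- Gc)"
proof -
  define G0 where "G0 = \<Union> (set ` {w. cf z w \<noteq> 0})"
  have zG: "z \<in> FN GG" using z by (simp add: invariant_def)
  have G0: "finite G0" "G0 \<subseteq> GG" "z \<in> FN G0" using zG by (auto simp: FN_iff G0_def)
  \<comment> \<open>An index \<open>a\<close> with infinitely many indices above it: the root vector
    \<open>D c a\<close> with c above replaces \<open>a\<close> by c.\<close>
  have 1: "indep z ({D a b |b. True} \<union> {S a b |b. True} \<union> {S b a |b. True} \<union> {L a, H a})"
    if a: "0 < a" "a \<notin> Up" for a
  proof -
    have "infinite {c. 0 < c \<and> gt c a}" using a by (auto simp: Up_def)
    then obtain c where c: "0 < c" "gt c a" "c \<notin> \<Union> (idx ` G0)"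
      using infinite_fresh[OF _ G0(1)] by (metis (mono_tags, lifting) mem_Collect_eq)
    have ca: "c \<noteq> a" using c by auto
    define \<rho> where "\<rho> g = (case g of D i j \<Rightarrow> D c j | S k l \<Rightarrow> if k = a then sg c l else sg c k
       | L k \<Rightarrow> sg c k | H k \<Rightarrow> H c)" for g
    define \<kappa> where "\<kappa> g = (case g of D i j \<Rightarrow> -1 | S k l \<Rightarrow> if k = a then - kap c l else - eps * kap c k
       | L k \<Rightarrow> - kap c k | H k \<Rightarrow> -1)" for g
    let ?K = "{D a b |b. True} \<union> {S a b |b. True} \<union> {S b a |b. True} \<union> {L a, H a}"
    show ?thesis
    proof (rule fresh_indep[OF z G0(3), of "D c a" _ \<kappa> \<rho>])
      show "D c a \<in> GG" using a c by (auto simp: GG_iff)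
    next
      fix g assume g: "g \<in> G0 \<inter> ?K"
      then have cg: "c \<notin> idx g" and gG: "g \<in> GG" using c G0 by auto
      have "c \<in> idx (\<rho> g)" by (auto simp: \<rho>_def idx_sg split: gen.splits)
      then have "\<rho> g \<notin> G0" using c by auto
      moreover have "\<kappa> g \<noteq> 0" by (auto simp: \<kappa>_def kap_nz eps_nz split: gen.splits)
      moreover have "xi (D c a) x g = \<kappa> g * x (\<rho> g)" for x
        using g cg gG by (cases g) (auto simp: xi_simps dl_def \<kappa>_def \<rho>_def ev_V_sg GG_iff)
      ultimately show "\<kappa> g \<noteq> 0 \<and> \<rho> g \<notin> G0 \<and> (\<forall>x. xi (D c a) x g = \<kappa> g * x (\<rho> g))" by blast
    next
      have cG: "c \<notin> idx g" "g \<in> GG" if "g \<in> G0" for g using that c G0 by auto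
      have sne: "sg p q \<noteq> D i j" "sg p q \<noteq> H i" for p q i j by (auto simp: sg_def)
      show "inj_on \<rho> (G0 \<inter> ?K)"
      proof (rule inj_onI)
        fix g g' assume g: "g \<in> G0 \<inter> ?K" "g' \<in> G0 \<inter> ?K" "\<rho> g = \<rho> g'"
        then have "c \<notin> idx g" "g \<in> GG" "c \<notin> idx g'" "g' \<in> GG" using cG by auto
        then show "g = g'" using g sne sne[symmetric]
          by (cases g; cases g') (auto simp: \<rho>_def GG_iff dest!: sg_inj dest: gt_asym split: if_splits)
      qed
    next
      fix g x assume g: "g \<in> G0 - ?K"
      then have "c \<notin> idx g" using c by auto
      then show "xi (D c a) x g = 0" using g by (cases g) (auto simp: xi_simps dl_def)
    qed
  qed
  \<comment> \<open>Type A from below: \<open>D b c\<close> replaces the second index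
    \<open>b\<close> by a fresh c under it.\<close>
  have 2: "indep z {D k b |k. True}" if b: "tA" "0 < b" "b \<notin> Lo" for b
  proof -
    have "infinite {c. 0 < c \<and> gt b c}" using b by (auto simp: Lo_def)
    then obtain c where c: "0 < c" "gt b c" "c \<notin> \<Union> (idx ` G0)"
      using infinite_fresh[OF _ G0(1)] by (metis (mono_tags, lifting) mem_Collect_eq)
    define \<rho> where "\<rho> g = (case g of D i j \<Rightarrow> D i c | _ \<Rightarrow> g)" for g
    show ?thesis
    proof (rule fresh_indep[OF z G0(3), of "D b c" _ "\<lambda>_. 1" \<rho>])
      show "D b c \<in> GG" using b c by (auto simp: GG_iff)
    next
      fix g assume g: "g \<in> G0 \<inter> {D k b |k. True}"
      then have "c \<notin> idx g" using c by auto
      moreover have "c \<in> idx (\<rho> g)" using g by (auto simp: \<rho>_def)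
      then have "\<rho> g \<notin> G0" using c by auto
      ultimately show "(1::complex) \<noteq> 0 \<and> \<rho> g \<notin> G0 \<and> (\<forall>x. xi (D b c) x g = 1 * x (\<rho> g))"
        using g by (auto simp: xi_simps dl_def \<rho>_def)
    next
      show "inj_on \<rho> (G0 \<inter> {D k b |k. True})" by (auto simp: inj_on_def \<rho>_def)
    next
      fix g x assume g: "g \<in> G0 - {D k b |k. True}"
      then have "c \<notin> idx g" "g \<in> GG" using c G0 by auto
      then show "xi (D b c) x g = 0" using g b
        by (cases g) (auto simp: xi_simps dl_def GG_iff types_exclusive)
    qed
  qed
  \<comment> \<open>Outside type A any fresh c serves: the sum root of \<open>b\<close> and c turns
    each difference root with second index \<open>b\<close> into a sum root with c. Hence no
    difference root survives.\<close>
  have 3: "indep z {D k b |k. True}" if b: "\<not> tA" "0 < b" for b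
  proof -
    have "infinite ({c. 0 < c} - {b})" using infinite_pos by simp
    then obtain c where c: "0 < c" "c \<noteq> b" "c \<notin> \<Union> (idx ` G0)"
      using infinite_fresh[OF _ G0(1)] by (metis (mono_tags, lifting) mem_Collect_eq DiffE singletonI)
    define \<rho> where "\<rho> g = (case g of D i j \<Rightarrow> sg i c | _ \<Rightarrow> g)" for g
    define \<kappa> where "\<kappa> g = (case g of D i j \<Rightarrow> kap b c * kap i c | _ \<Rightarrow> 1)" for g
    show ?thesis
    proof (rule fresh_indep[OF z G0(3), of "sg b c" _ \<kappa> \<rho>])
      show "sg b c \<in> GG" using b c by (auto intro: sg_GG)
    next
      fix g assume g: "g \<in> G0 \<inter> {D k b |k. True}"
      then have "c \<notin> idx g" using c by auto
      moreover have "c \<in> idx (\<rho> g)" using g by (auto simp: \<rho>_def idx_sg)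
      then have "\<rho> g \<notin> G0" using c by auto
      ultimately show "\<kappa> g \<noteq> 0 \<and> \<rho> g \<notin> G0 \<and> (\<forall>x. xi (sg b c) x g = \<kappa> g * x (\<rho> g))"
        using g c by (auto simp: sg_def[of b c] kap_def[of b c] xi_simps dl_def \<rho>_def \<kappa>_def ev_V_sg kap_nz eps_nz)
    next
      have "c \<noteq> k" if "D k b \<in> G0" for k using c that by auto
      moreover have "sg c i = sg i c" if "i \<noteq> c" "0 < i" for i
        using that c gt_total[of i c] gt_asym by (auto simp: sg_def)
      moreover have "0 < k" if "D k b \<in> G0" for k using G0 that by (auto simp: GG_iff)
      ultimately show "inj_on \<rho> (G0 \<inter> {D k b |k. True})"
        by (auto simp: inj_on_def \<rho>_def) (metis sg_inj)
    next
      fix g x assume g: "g \<in> G0 - {D k b |k. True}"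
      then have "c \<notin> idx g" "g \<in> GG" using c G0 by auto
      then show "xi (sg b c) x g = 0" using g b
        by (cases g) (auto simp: xi_simps dl_def sg_def)
    qed
  qed
  \<comment> \<open>In type B the bracket of two short root vectors is a sum root vector, so one
    fresh \<open>H c\<close> moves all short coordinates at once.\<close>
  have 4: "indep z {H k |k. True}"
  proof (cases "tB")
    case True
    obtain c where c: "0 < c" "c \<notin> \<Union> (idx ` G0)"
      using infinite_fresh[OF infinite_pos G0(1)] by (metis (mono_tags, lifting) mem_Collect_eq)
    define \<rho> where "\<rho> g = (case g of H i \<Rightarrow> sg i c | _ \<Rightarrow> g)" for g
    define \<kappa> where "\<kappa> g = (case g of H i \<Rightarrow> - kap i c | _ \<Rightarrow> 1)" for g
    show ?thesis
    proof (rule fresh_indep[OF z G0(3), of "H c" _ \<kappa> \<rho>])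
      show "H c \<in> GG" using True c by (auto simp: GG_iff)
    next
      fix g assume g: "g \<in> G0 \<inter> {H k |k. True}"
      then have "c \<notin> idx g" using c by auto
      moreover have "c \<in> idx (\<rho> g)" using g by (auto simp: \<rho>_def idx_sg)
      then have "\<rho> g \<notin> G0" using c by auto
      ultimately show "\<kappa> g \<noteq> 0 \<and> \<rho> g \<notin> G0 \<and> (\<forall>x. xi (H c) x g = \<kappa> g * x (\<rho> g))"
        using g c by (auto simp: xi_simps dl_def \<rho>_def \<kappa>_def ev_V_sg kap_nz eps_nz)
    next
      have "c \<noteq> k" if "H k \<in> G0" for k using c that by auto
      moreover have "sg c i = sg i c" if "i \<noteq> c" "0 < i" for i
        using that c gt_total[of i c] gt_asym by (auto simp: sg_def)
      moreover have "0 < k" if "H k \<in> G0" for k using G0 that by (auto simp: GG_iff)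
      ultimately show "inj_on \<rho> (G0 \<inter> {H k |k. True})"
        by (auto simp: inj_on_def \<rho>_def) (metis sg_inj)
    next
      fix g x assume g: "g \<in> G0 - {H k |k. True}"
      then have "c \<notin> idx g" "g \<in> GG" using c G0 by auto
      then show "xi (H c) x g = 0" using g
        by (cases g) (auto simp: xi_simps dl_def)
    qed
  next
    case False
    then have "{H k |k. True} \<subseteq> - G0" using G0 by (auto simp: GG_iff)
    then show ?thesis using indep_outside[OF G0(3)] indep_mono by blast
  qed
  have "\<exists>K. indep z K \<and> g \<in> K" if g: "g \<in> G0 - Gc" for g
  proof -
    have gG: "g \<in> GG" using g G0 by auto
    show ?thesis
    proof (cases g)
      case (D a b)
      then show ?thesis using g gG 1[of a] 2[of b] 3[of b] by (auto simp: Gc_iff GG_iff)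
    next
      case (S a b)
      then have "a \<notin> Up \<or> b \<notin> Up" using g gG by (auto simp: Gc_iff GG_iff)
      then show ?thesis using S gG 1[of a] 1[of b] by (fastforce simp: GG_iff)
    next
      case (L a)
      then show ?thesis using g gG 1[of a] by (auto simp: Gc_iff GG_iff)
    next
      case (H a)
      then show ?thesis using 4 by auto
    qed
  qed
  then obtain K where K: "\<And>g. g \<in> G0 - Gc \<Longrightarrow> indep z (K g) \<and> g \<in> K g" by metis
  have "indep z ((\<Union>g\<in>G0 - Gc. K g) \<union> - G0)"
    using K G0 by (intro indep_Un indep_UN indep_outside) auto
  then show ?thesis by (rule indep_mono) (use K in blast)
qed

lemma invariant_restrict:
  assumes z: "invariant z" "hom d z"
  obtains z1 where "z1 \<in> FN Gc" "hom d z1" "\<And>x. ev z1 x = ev z x" "invariant z1"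
proof -
  define z1 where "z1 = nc (\<lambda>w. if set w \<subseteq> Gc then cf z w else 0)"
  have zG: "z \<in> FN GG" using z by (simp add: invariant_def)
  then have f: "finite {w. cf z w \<noteq> 0}" by (simp add: FN_iff)
  have z1: "z1 \<in> FN Gc"
    using f by (auto simp: FN_iff z1_def elim: rev_finite_subset)
  have h: "hom d z1" using z(2) by (auto simp: hom_def z1_def)
  have e: "ev z1 x = ev z x" for x
  proof -
    define x' where "x' g = (if g \<in> Gc then x g else 0)" for g
    have "ev z x = ev z x'"
      using invariant_indep_Gc[OF z(1)] unfolding indep_def by (auto simp: x'_def)
    also have "\<dots> = ev z1 x"
    proof -
      have w: "(\<Prod>g\<leftarrow>w. x' g) = (if set w \<subseteq> Gc then \<Prod>g\<leftarrow>w. x g else 0)" for w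
        by (induction w) (auto simp: x'_def)
      show ?thesis unfolding ev_def
        by (subst (1 2) pair_superset[OF f]) (auto simp: w z1_def intro!: sum.cong)
    qed
    finally show ?thesis by simp
  qed
  have "invariant z1" unfolding invariant_def
  proof (intro conjI ballI allI)
    show "z1 \<in> FN GG" using z1 Gc_GG by (rule FN_mono)
    fix h x assume hG: "h \<in> GG"
    let ?\<gamma> = "\<lambda>s g. x g + s * xi h x g"
    have d: "((\<lambda>s. ?\<gamma> s g) has_field_derivative xi h x g) (at 0)" for g
      by (auto intro!: derivative_eq_intros)
    have "((\<lambda>s. ev z1 (?\<gamma> s)) has_field_derivative dev z1 (?\<gamma> 0) (xi h x)) (at 0)"
      by (rule ev_has_derivative[OF z1 d])
    moreover have "((\<lambda>s. ev z (?\<gamma> s)) has_field_derivative dev z (?\<gamma> 0) (xi h x)) (at 0)"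
      by (rule ev_has_derivative[OF zG d])
    ultimately have "dev z1 (?\<gamma> 0) (xi h x) = dev z (?\<gamma> 0) (xi h x)"
      unfolding e by (rule DERIV_unique)
    then show "dev z1 x (xi h x) = 0" using z(1) hG by (simp add: invariant_def)
  qed
  then show ?thesis using that z1 h e by blast
qed

end

section \<open>Alternating sums over permutations\<close>

text \<open>Composition with the transposition pairs permutations of opposite sign on which
  \<open>F\<close> agrees.\<close>

lemma alternating_sum_zero_left:
  fixes F :: "(nat \<Rightarrow> nat) \<Rightarrow> complex"
  assumes "a < N" "b < N" "a \<noteq> b"
    and F: "\<And>p. p permutes {..<N} \<Longrightarrow> F (Transposition.transpose a b \<circ> p) = F p"
  shows "(\<Sum>p | p permutes {..<N}. of_int (sign p) * F p) = 0"
proof -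
  have t: "Transposition.transpose a b permutes {..<N}" using assms by (auto intro: permutes_swap_id)
  have "(\<Sum>p | p permutes {..<N}. of_int (sign p) * F p)
     = (\<Sum>p | p permutes {..<N}. of_int (sign (Transposition.transpose a b \<circ> p)) * F (Transposition.transpose a b \<circ> p))"
    by (rule setum_permutations_compose_left[OF t])
  also have "\<dots> = (\<Sum>p | p permutes {..<N}. - (of_int (sign p) * F p))"
  proof (rule sum.cong[OF refl], clarify)
    fix p assume p: "p permutes {..<N}"
    have "permutation p" "permutation (Transposition.transpose a b)"
      using p t permutation_permutes finite_lessThan by blast+
    then have "sign (Transposition.transpose a b \<circ> p) = - sign p"
      using assms by (simp add: sign_compose sign_swap_id)
    then show "of_int (sign (Transposition.transpose a b \<circ> p)) * F (Transposition.transpose a b \<circ> p) = - (of_int (sign p) * F p)"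
      using F[OF p] by simp
  qed
  finally show ?thesis by (simp add: sum_negf)
qed

lemma alternating_sum_zero_right:
  fixes F :: "(nat \<Rightarrow> nat) \<Rightarrow> complex"
  assumes "a < N" "b < N" "a \<noteq> b"
    and F: "\<And>p. p permutes {..<N} \<Longrightarrow> F (p \<circ> Transposition.transpose a b) = F p"
  shows "(\<Sum>p | p permutes {..<N}. of_int (sign p) * F p) = 0"
proof -
  have t: "Transposition.transpose a b permutes {..<N}" using assms by (auto intro: permutes_swap_id)
  have "(\<Sum>p | p permutes {..<N}. of_int (sign p) * F p)
     = (\<Sum>p | p permutes {..<N}. of_int (sign (p \<circ> Transposition.transpose a b)) * F (p \<circ> Transposition.transpose a b))"
    by (rule sum_permutations_compose_right[OF t])
  also have "\<dots> = (\<Sum>p | p permutes {..<N}. - (of_int (sign p) * F p))"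
  proof (rule sum.cong[OF refl], clarify)
    fix p assume p: "p permutes {..<N}"
    have "permutation p" "permutation (Transposition.transpose a b)"
      using p t permutation_permutes finite_lessThan by blast+
    then have "sign (p \<circ> Transposition.transpose a b) = - sign p"
      using assms by (simp add: sign_compose sign_swap_id)
    then show "of_int (sign (p \<circ> Transposition.transpose a b)) * F (p \<circ> Transposition.transpose a b) = - (of_int (sign p) * F p)"
      using F[OF p] by simp
  qed
  finally show ?thesis by (simp add: sum_negf)
qed

text \<open>The derivative of a determinant when row i1 is added to row i0, that is, a determinant
  with two equal rows.\<close>

lemma det_row_zero:
  fixes M :: "nat \<Rightarrow> nat \<Rightarrow> complex"
  assumes i: "i0 < n" "i1 < n" "i0 \<noteq> i1"
  shows "(\<Sum>p | p permutes {..<n}. of_int (sign p) *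
     (\<Sum>i<n. (if i = i0 then M i1 (p i) else 0) * (\<Prod>j\<in>{..<n} - {i}. M j (p j)))) = 0"
proof -
  define \<tau> where "\<tau> j = (if j = i0 then i1 else j)" for j
  have *: "(\<Sum>i<n. (if i = i0 then M i1 (p i) else 0) * (\<Prod>j\<in>{..<n} - {i}. M j (p j)))
     = (\<Prod>j<n. M (\<tau> j) (p j))" for p
  proof -
    have "(\<Sum>i<n. (if i = i0 then M i1 (p i) else 0) * (\<Prod>j\<in>{..<n} - {i}. M j (p j)))
      = (\<Sum>i<n. if i = i0 then M i1 (p i) * (\<Prod>j\<in>{..<n} - {i}. M j (p j)) else 0)"
      by (intro sum.cong) auto
    also have "\<dots> = M i1 (p i0) * (\<Prod>j\<in>{..<n} - {i0}. M j (p j))" using i by simp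
    also have "\<dots> = M (\<tau> i0) (p i0) * (\<Prod>j\<in>{..<n} - {i0}. M (\<tau> j) (p j))"
      by (intro arg_cong2[of _ _ _ _ "(*)"] prod.cong) (auto simp: \<tau>_def)
    also have "\<dots> = (\<Prod>j<n. M (\<tau> j) (p j))" using i by (intro prod.remove[symmetric]) auto
    finally show ?thesis .
  qed
  show ?thesis unfolding *
  proof (rule alternating_sum_zero_right[OF i])
    fix p assume "p permutes {..<n}"
    have t: "Transposition.transpose i0 i1 permutes {..<n}" using i by (auto intro: permutes_swap_id)
    have "(\<Prod>j<n. M (\<tau> j) ((p \<circ> Transposition.transpose i0 i1) j))
      = (\<Prod>j<n. M (\<tau> (Transposition.transpose i0 i1 j)) ((p \<circ> Transposition.transpose i0 i1) (Transposition.transpose i0 i1 j)))"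
      using prod.permute[OF t, of "\<lambda>j. M (\<tau> j) ((p \<circ> Transposition.transpose i0 i1) j)"] by (simp add: o_def)
    also have "\<dots> = (\<Prod>j<n. M (\<tau> j) (p j))"
      by (intro prod.cong) (auto simp: \<tau>_def Transposition.transpose_def)
    finally show "(\<Prod>j<n. M (\<tau> j) ((p \<circ> Transposition.transpose i0 i1) j)) = (\<Prod>j<n. M (\<tau> j) (p j))" .
  qed
qed

lemma det_col_zero:
  fixes M :: "nat \<Rightarrow> nat \<Rightarrow> complex"
  assumes i: "j0 < n" "j1 < n" "j0 \<noteq> j1"
  shows "(\<Sum>p | p permutes {..<n}. of_int (sign p) *
     (\<Sum>i<n. (if p i = j0 then M i j1 else 0) * (\<Prod>j\<in>{..<n} - {i}. M j (p j)))) = 0"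
proof -
  define \<tau> where "\<tau> j = (if j = j0 then j1 else j)" for j
  have *: "(\<Sum>i<n. (if p i = j0 then M i j1 else 0) * (\<Prod>j\<in>{..<n} - {i}. M j (p j)))
     = (\<Prod>j<n. M j (\<tau> (p j)))" if p: "p permutes {..<n}" for p
  proof -
    obtain i0 where i0: "i0 < n" "p i0 = j0" using permutes_surj[OF p] permutes_in_image[OF p] i
      by (metis lessThan_iff surjD)
    have u: "p i = j0 \<longleftrightarrow> i = i0" for i using i0 permutes_inj[OF p] by (metis injD)
    have "(\<Sum>i<n. (if p i = j0 then M i j1 else 0) * (\<Prod>j\<in>{..<n} - {i}. M j (p j)))
      = (\<Sum>i<n. if i = i0 then M i j1 * (\<Prod>j\<in>{..<n} - {i}. M j (p j)) else 0)"
      by (intro sum.cong) (auto simp: u)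
    also have "\<dots> = M i0 j1 * (\<Prod>j\<in>{..<n} - {i0}. M j (p j))" using i0 by simp
    also have "\<dots> = M i0 (\<tau> (p i0)) * (\<Prod>j\<in>{..<n} - {i0}. M j (\<tau> (p j)))"
      by (intro arg_cong2[of _ _ _ _ "(*)"] prod.cong) (auto simp: \<tau>_def u)
    also have "\<dots> = (\<Prod>j<n. M j (\<tau> (p j)))" using i0 by (intro prod.remove[symmetric]) auto
    finally show ?thesis .
  qed
  have "(\<Sum>p | p permutes {..<n}. of_int (sign p) *
     (\<Sum>i<n. (if p i = j0 then M i j1 else 0) * (\<Prod>j\<in>{..<n} - {i}. M j (p j))))
     = (\<Sum>p | p permutes {..<n}. of_int (sign p) * (\<Prod>j<n. M j (\<tau> (p j))))"
    by (intro sum.cong) (auto simp: *)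
  also have "\<dots> = 0"
    by (rule alternating_sum_zero_left[OF i]) (auto simp: \<tau>_def Transposition.transpose_def intro!: prod.cong)
  finally show ?thesis .
qed

text \<open>The Pfaffian counterpart: the derivative along the congruence adding index m1 to index
  m0 is the same alternating sum with m0 replaced by m1 throughout, hence unchanged when the two are
  exchanged.\<close>

lemma pf_zero:
  fixes A :: "nat \<Rightarrow> nat \<Rightarrow> complex"
  assumes i: "m0 < 2 * n" "m1 < 2 * n" "m0 \<noteq> m1"
  shows "(\<Sum>p | p permutes {..<2*n}. of_int (sign p) *
     (\<Sum>i<n. ((if p (2*i) = m0 then A m1 (p (2*i+1)) else 0) + (if p (2*i+1) = m0 then A (p (2*i)) m1 else 0))
        * (\<Prod>j\<in>{..<n} - {i}. A (p (2*j)) (p (2*j+1))))) = 0"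
proof -
  define \<tau> where "\<tau> j = (if j = m0 then m1 else j)" for j
  have *: "(\<Sum>i<n. ((if p (2*i) = m0 then A m1 (p (2*i+1)) else 0) + (if p (2*i+1) = m0 then A (p (2*i)) m1 else 0))
        * (\<Prod>j\<in>{..<n} - {i}. A (p (2*j)) (p (2*j+1))))
     = (\<Prod>j<n. A (\<tau> (p (2*j))) (\<tau> (p (2*j+1))))" if p: "p permutes {..<2*n}" for p
  proof -
    obtain u where u: "u < 2 * n" "p u = m0" using permutes_surj[OF p] permutes_in_image[OF p] i
      by (metis lessThan_iff surjD)
    have uq: "p i = m0 \<longleftrightarrow> i = u" for i using u permutes_inj[OF p] by (metis injD)
    define i0 where "i0 = u div 2"
    have i0: "i0 < n" "u = 2 * i0 \<or> u = 2 * i0 + 1" using u by (auto simp: i0_def)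
    have ne: "2 * j \<noteq> u" "2 * j + 1 \<noteq> u" if "j \<noteq> i0" for j using that i0(2) by presburger+
    define f where "f i = ((if p (2*i) = m0 then A m1 (p (2*i+1)) else 0) + (if p (2*i+1) = m0 then A (p (2*i)) m1 else 0))" for i
    have f0: "f i = 0" if "i \<noteq> i0" for i using ne[OF that] by (simp add: f_def uq)
    have fi: "f i0 = A (\<tau> (p (2*i0))) (\<tau> (p (2*i0+1)))"
      using i0(2) uq[of "2*i0"] uq[of "2*i0+1"] by (auto simp: f_def \<tau>_def)
    have "(\<Sum>i<n. f i * (\<Prod>j\<in>{..<n} - {i}. A (p (2*j)) (p (2*j+1))))
      = (\<Sum>i<n. if i = i0 then f i * (\<Prod>j\<in>{..<n} - {i}. A (p (2*j)) (p (2*j+1))) else 0)"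
      by (intro sum.cong) (auto simp: f0)
    also have "\<dots> = f i0 * (\<Prod>j\<in>{..<n} - {i0}. A (p (2*j)) (p (2*j+1)))" using i0 by simp
    also have "\<dots> = A (\<tau> (p (2*i0))) (\<tau> (p (2*i0+1))) * (\<Prod>j\<in>{..<n} - {i0}. A (\<tau> (p (2*j))) (\<tau> (p (2*j+1))))"
      unfolding fi by (intro arg_cong2[of _ _ _ _ "(*)"] prod.cong refl) (use ne in \<open>auto simp: \<tau>_def uq\<close>)
    also have "\<dots> = (\<Prod>j<n. A (\<tau> (p (2*j))) (\<tau> (p (2*j+1))))" using i0 by (intro prod.remove[symmetric]) auto
    finally show ?thesis unfolding f_def .
  qed
  have "(\<Sum>p | p permutes {..<2*n}. of_int (sign p) *
     (\<Sum>i<n. ((if p (2*i) = m0 then A m1 (p (2*i+1)) else 0) + (if p (2*i+1) = m0 then A (p (2*i)) m1 else 0))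
        * (\<Prod>j\<in>{..<n} - {i}. A (p (2*j)) (p (2*j+1)))))
     = (\<Sum>p | p permutes {..<2*n}. of_int (sign p) * (\<Prod>j<n. A (\<tau> (p (2*j))) (\<tau> (p (2*j+1)))))"
    by (intro sum.cong refl) (use * in auto)
  also have "\<dots> = 0"
  proof (rule alternating_sum_zero_left[OF i])
    have t: "\<tau> (Transposition.transpose m0 m1 y) = \<tau> y" for y by (auto simp: \<tau>_def Transposition.transpose_def)
    fix p show "(\<Prod>j<n. A (\<tau> ((Transposition.transpose m0 m1 \<circ> p) (2*j))) (\<tau> ((Transposition.transpose m0 m1 \<circ> p) (2*j+1))))
      = (\<Prod>j<n. A (\<tau> (p (2*j))) (\<tau> (p (2*j+1))))" by (simp add: t)
  qed
  finally show ?thesis .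
qed

text \<open>Columns are read backwards, so a diagonal matrix leaves only the order-reversing
  permutation.\<close>

lemma det_slice:
  fixes M :: "nat \<Rightarrow> nat \<Rightarrow> complex"
  assumes "\<And>i j. i < n \<Longrightarrow> j < n \<Longrightarrow> i \<noteq> j \<Longrightarrow> M i j = 0"
  shows "(\<Sum>p | p permutes {..<n}. of_int (sign p) * (\<Prod>i<n. M i (n - 1 - p i)))
    = of_int (sign (\<lambda>i. if i < n then n - 1 - i else i)) * (\<Prod>i<n. M i i)"
proof -
  define q where "q i = (if i < n then n - 1 - i else i)" for i
  have q: "q permutes {..<n}"
  proof (rule bij_imp_permutes)
    show "bij_betw q {..<n} {..<n}"
      by (rule bij_betw_byWitness[where f'=q]) (auto simp: q_def)
  qed (auto simp: q_def)
  have "(\<Prod>i<n. M i (n - 1 - p i)) = 0" if p: "p permutes {..<n}" "p \<noteq> q" for p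
  proof -
    have "\<exists>i<n. n - 1 - p i \<noteq> i"
    proof (rule ccontr)
      assume a: "\<not> ?thesis"
      have "p i = q i" for i
      proof (cases "i < n")
        case True
        then have "p i < n" using permutes_in_image[OF p(1), of i] by auto
        then show ?thesis using a True by (auto simp: q_def)
      next
        case False
        then show ?thesis using permutes_not_in[OF p(1), of i] by (auto simp: q_def)
      qed
      then show False using p(2) by auto
    qed
    then obtain i where "i < n" "n - 1 - p i \<noteq> i" by blast
    then have "M i (n - 1 - p i) = 0" by (intro assms) auto
    then show ?thesis using \<open>i < n\<close> by (intro prod_zero) auto
  qed
  then have "(\<Sum>p | p permutes {..<n}. of_int (sign p) * (\<Prod>i<n. M i (n - 1 - p i)))
    = (\<Sum>p | p permutes {..<n}. if p = q then of_int (sign q) * (\<Prod>i<n. M i (n - 1 - q i)) else 0)"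
    by (intro sum.cong) auto
  also have "\<dots> = of_int (sign q) * (\<Prod>i<n. M i (n - 1 - q i))"
    using q by (simp add: finite_permutations)
  also have "(\<Prod>i<n. M i (n - 1 - q i)) = (\<Prod>i<n. M i i)"
    by (intro prod.cong) (auto simp: q_def)
  finally show ?thesis by (simp add: q_def[abs_def])
qed

text \<open>Exchange of the pairs k and n as blocks; as a product of two transpositions it does not
  affect signs.\<close>

lemma transpose_pair:
  fixes k n :: nat
  defines "\<tau> \<equiv> Transposition.transpose (2*k) (2*n) \<circ> Transposition.transpose (2*k+1) (2*n+1)"
  shows "\<tau> (2 * i) = 2 * Transposition.transpose k n i" "\<tau> (2 * i + 1) = 2 * Transposition.transpose k n i + 1"
  by (auto simp: \<tau>_def Transposition.transpose_def)

text \<open>A permutation that maps pairs to pairs permutes them as blocks, which is even, and flips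
  some of them; each flip costs a sign that skew symmetry returns. The induction brings the block
  mapped to the pair 2n, 2n + 1 to the last place.\<close>

lemma pf_slice_term:
  fixes A :: "nat \<Rightarrow> nat \<Rightarrow> complex"
  assumes "p permutes {..<2*n}" "\<And>a b. A b a = - A a b"
    "\<And>i. i < n \<Longrightarrow> p (2*i) div 2 = p (2*i+1) div 2"
  shows "of_int (sign p) * (\<Prod>i<n. A (p (2*i)) (p (2*i+1))) = (\<Prod>k<n. A (2*k) (2*k+1))"
  using assms(1,3)
proof (induction n arbitrary: p)
  case 0
  then show ?case by simp
next
  case (Suc n)
  note p = Suc.prems(1) and pr = Suc.prems(2)
  have fp: "permutation q" if "q permutes {..<2 * Suc n}" for q
    using that permutation_permutes finite_lessThan by blast
  obtain u where u: "p u = 2 * n" using permutes_surj[OF p] by (metis surjD)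
  have u2: "u < 2 * Suc n" using permutes_in_image[OF p, of u] u by auto
  define k where "k = u div 2"
  have k: "k \<le> n" "u = 2 * k \<or> u = 2 * k + 1" using u2 by (auto simp: k_def)
  define \<tau> where "\<tau> = Transposition.transpose (2*k) (2*n) \<circ> Transposition.transpose (2*k+1) (2*n+1)"
  have \<tau>: "\<tau> (2 * i) = 2 * Transposition.transpose k n i" "\<tau> (2 * i + 1) = 2 * Transposition.transpose k n i + 1" for i
    unfolding \<tau>_def by (rule transpose_pair)+
  have t1: "Transposition.transpose (2*k) (2*n) permutes {..<2 * Suc n}" "Transposition.transpose (2*k+1) (2*n+1) permutes {..<2 * Suc n}"
    using k by (auto intro!: permutes_swap_id)
  have \<tau>p: "\<tau> permutes {..<2 * Suc n}" unfolding \<tau>_def using t1 by (rule permutes_compose[rotated])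
  have s\<tau>: "sign \<tau> = 1"
    unfolding \<tau>_def using fp[OF t1(1)] fp[OF t1(2)]
    by (cases "k = n") (simp_all add: sign_compose sign_swap_id)
  define p1 where "p1 = p \<circ> \<tau>"
  have p1: "p1 permutes {..<2 * Suc n}" unfolding p1_def using \<tau>p p by (rule permutes_compose)
  have sp1: "sign p1 = sign p" unfolding p1_def using fp[OF p] fp[OF \<tau>p] s\<tau> by (simp add: sign_compose)
  have tk: "Transposition.transpose k n permutes {..<Suc n}" using k by (auto intro!: permutes_swap_id)
  have pr1: "p1 (2*i) div 2 = p1 (2*i+1) div 2" if "i < Suc n" for i
    using pr[of "Transposition.transpose k n i"] permutes_in_image[OF tk, of i] that by (simp add: p1_def \<tau>[simplified])
  have prod1: "(\<Prod>i<Suc n. A (p1 (2*i)) (p1 (2*i+1))) = (\<Prod>i<Suc n. A (p (2*i)) (p (2*i+1)))"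
    using prod.permute[OF tk, of "\<lambda>i. A (p (2*i)) (p (2*i+1))"] by (simp add: p1_def \<tau>[simplified] o_def)
  have "2 * n \<in> {p1 (2*n), p1 (2*n+1)}"
    using k(2) u by (auto simp: p1_def \<tau>[simplified])
  moreover have "p1 (2*n) \<noteq> p1 (2*n+1)" using permutes_inj[OF p1] by (metis add_eq_self_zero injD zero_neq_one)
  ultimately have c: "(p1 (2*n) = 2*n \<and> p1 (2*n+1) = 2*n+1) \<or> (p1 (2*n) = 2*n+1 \<and> p1 (2*n+1) = 2*n)"
    using pr1[of n] by (auto; presburger)
  \<comment> \<open>Undoes a possible flip of the last pair, so that what remains fixes it and
    permutes the first 2n indices.\<close>
  define p2 where "p2 = (if p1 (2*n) = 2*n then p1 else p1 \<circ> Transposition.transpose (2*n) (2*n+1))"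
  have t2: "Transposition.transpose (2*n) (2*n+1) permutes {..<2 * Suc n}" by (auto intro!: permutes_swap_id)
  have p2': "p2 permutes {..<2 * Suc n}" unfolding p2_def using permutes_compose[OF t2 p1] p1 by auto
  have fix2: "p2 (2*n) = 2*n" "p2 (2*n+1) = 2*n+1" using c by (auto simp: p2_def)
  have "p2 permutes {..<2*n}"
  proof (rule permutes_superset[OF p2'])
    fix x assume "x \<in> {..<2 * Suc n} - {..<2 * n}"
    then have "x = 2*n \<or> x = 2*n+1" by auto
    then show "p2 x = x" using fix2 by auto
  qed
  have low: "p2 (2*i) = p1 (2*i)" "p2 (2*i+1) = p1 (2*i+1)" if "i < n" for i
    using that by (auto simp: p2_def Transposition.transpose_def)
  have IH: "of_int (sign p2) * (\<Prod>i<n. A (p2 (2*i)) (p2 (2*i+1))) = (\<Prod>k<n. A (2*k) (2*k+1))"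
    using \<open>p2 permutes {..<2*n}\<close> by (rule Suc.IH) (use low pr1 in auto)
  have sl: "of_int (sign p1) * A (p1 (2*n)) (p1 (2*n+1)) = of_int (sign p2) * A (2*n) (2*n+1)"
  proof (cases "p1 (2*n) = 2*n")
    case True
    then show ?thesis using c by (simp add: p2_def)
  next
    case False
    then have "p1 (2*n) = 2*n+1" "p1 (2*n+1) = 2*n" using c by auto
    moreover have "sign p2 = - sign p1"
      using False fp[OF p1] fp[OF t2] by (simp add: p2_def sign_compose sign_swap_id)
    ultimately show ?thesis using assms(2)[of "2*n" "2*n+1"] by simp
  qed
  have "of_int (sign p) * (\<Prod>i<Suc n. A (p (2*i)) (p (2*i+1)))
    = (of_int (sign p1) * A (p1 (2*n)) (p1 (2*n+1))) * (\<Prod>i<n. A (p1 (2*i)) (p1 (2*i+1)))"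
    unfolding prod1[symmetric] sp1[symmetric] by simp
  also have "\<dots> = (of_int (sign p2) * (\<Prod>i<n. A (p2 (2*i)) (p2 (2*i+1)))) * A (2*n) (2*n+1)"
    unfolding sl using low by simp
  finally show ?case unfolding IH by simp
qed

text \<open>\<open>N\<close> is the number of permutations preserving the pairs. It depends on
  \<open>n\<close> alone, and being nonzero it can later be divided out.\<close>

lemma pf_slice:
  fixes n :: nat
  obtains N :: complex where "N \<noteq> 0"
    "\<And>A. (\<And>a b. A b a = - A a b) \<Longrightarrow>
       (\<And>a b. a < 2*n \<Longrightarrow> b < 2*n \<Longrightarrow> a div 2 \<noteq> b div 2 \<Longrightarrow> A a b = 0) \<Longrightarrow>
      (\<Sum>p | p permutes {..<2*n}. of_int (sign p) * (\<Prod>i<n. A (p (2*i)) (p (2*i+1))))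
        = N * (\<Prod>k<n. A (2*k) (2*k+1))"
proof
  define W where "W = {p. p permutes {..<2*n} \<and> (\<forall>i<n. p (2*i) div 2 = p (2*i+1) div 2)}"
  have fW: "finite W" unfolding W_def by (rule finite_subset[OF _ finite_permutations[of "{..<2*n}"]]) auto
  have "id \<in> W" by (auto simp: W_def permutes_id)
  then show "(of_nat (card W) :: complex) \<noteq> 0" using fW by (auto simp: card_eq_0_iff)
  fix A :: "nat \<Rightarrow> nat \<Rightarrow> complex"
  assume A: "\<And>a b. A b a = - A a b" "\<And>a b. a < 2*n \<Longrightarrow> b < 2*n \<Longrightarrow> a div 2 \<noteq> b div 2 \<Longrightarrow> A a b = 0"
  have "(\<Sum>p | p permutes {..<2*n}. of_int (sign p) * (\<Prod>i<n. A (p (2*i)) (p (2*i+1))))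
     = (\<Sum>p\<in>W. of_int (sign p) * (\<Prod>i<n. A (p (2*i)) (p (2*i+1))))"
  proof (rule sum.mono_neutral_right)
    show "\<forall>p\<in>{p. p permutes {..<2*n}} - W. of_int (sign p) * (\<Prod>i<n. A (p (2*i)) (p (2*i+1))) = 0"
    proof
      fix p assume "p \<in> {p. p permutes {..<2*n}} - W"
      then obtain i where p: "p permutes {..<2*n}" and i: "i < n" "p (2*i) div 2 \<noteq> p (2*i+1) div 2"
        by (auto simp: W_def)
      have "A (p (2*i)) (p (2*i+1)) = 0"
        using i permutes_in_image[OF p, of "2*i"] permutes_in_image[OF p, of "2*i+1"] by (intro A(2)) auto
      then have "(\<Prod>i<n. A (p (2*i)) (p (2*i+1))) = 0" using i by (intro prod_zero) auto
      then show "of_int (sign p) * (\<Prod>i<n. A (p (2*i)) (p (2*i+1))) = 0" by simp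
    qed
  qed (auto simp: W_def finite_permutations)
  also have "\<dots> = (\<Sum>p\<in>W. \<Prod>k<n. A (2*k) (2*k+1))"
    by (intro sum.cong refl pf_slice_term A) (auto simp: W_def)
  finally show "(\<Sum>p | p permutes {..<2*n}. of_int (sign p) * (\<Prod>i<n. A (p (2*i)) (p (2*i+1))))
        = of_nat (card W) * (\<Prod>k<n. A (2*k) (2*k+1))" by simp
qed

lemma prod_line_derivative:
  fixes f g :: "'a \<Rightarrow> complex"
  assumes "finite A"
  shows "((\<lambda>s. \<Prod>i\<in>A. f i + s * g i) has_field_derivative (\<Sum>i\<in>A. g i * (\<Prod>j\<in>A - {i}. f j))) (at 0)"
  using assms
proof (induction A rule: finite_induct)
  case (insert a A)
  have "((\<lambda>s. (f a + s * g a) * (\<Prod>i\<in>A. f i + s * g i)) has_field_derivative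
     g a * (\<Prod>i\<in>A. f i + 0 * g i) + (\<Sum>i\<in>A. g i * (\<Prod>j\<in>A - {i}. f j)) * (f a + 0 * g a)) (at 0)"
    by (intro DERIV_mult insert) (auto intro!: derivative_eq_intros)
  moreover have "(\<Prod>j\<in>insert a A - {i}. f j) = f a * (\<Prod>j\<in>A - {i}. f j)" if "i \<in> A" for i
  proof -
    have "insert a A - {i} = insert a (A - {i})" using that insert by auto
    then show ?thesis using insert by simp
  qed
  ultimately show ?case using insert
    by (simp add: sum_distrib_left sum_distrib_right algebra_simps)
qed simp

section \<open>The cascade\<close>

context nilrad
begin

abbreviation cs where "cs \<equiv> casc t r"
definition R :: "nat \<Rightarrow> nat set" where "R k = {s. 0 < s} - cs k"
definition ci :: "nat \<Rightarrow> nat" where "ci k = (THE i. ismax t r (R k) i)"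
text \<open>In type C a cascade root is twice a single index; repeating that index lets every type
  speak of a pivot at the position with row \<open>ci k\<close> and column
  \<open>cj k\<close>.\<close>

definition cj :: "nat \<Rightarrow> nat" where
  "cj k = (if tA then (THE j. ismin t r (R k) j) else if tC then ci k
     else (THE j. ismax t r (R k - {ci k}) j))"
text \<open>Steps are numbered from 0: \<open>ok k\<close> says that the cascade root of index k + 1
  exists.\<close>

definition ok :: "nat \<Rightarrow> bool" where "ok k \<longleftrightarrow> cs (Suc k) \<noteq> cs k"
definition steppable :: "nat set \<Rightarrow> bool" where
  "steppable A \<longleftrightarrow> (if tA then (\<exists>i. ismax t r A i) \<and> (\<exists>j. ismin t r A j)
     else if tC then (\<exists>i. ismax t r A i) else (\<exists>i. ismax t r A i \<and> (\<exists>j. ismax t r (A - {i}) j)))"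

lemma the_max: "ismax t r A i \<Longrightarrow> (THE i. ismax t r A i) = i"
  unfolding ismax_def by (rule the_equality) (blast, metis gt_asym)

lemma the_min: "ismin t r A i \<Longrightarrow> (THE i. ismin t r A i) = i"
  unfolding ismin_def by (rule the_equality) (blast, metis gt_asym)

lemma casc_Suc: "cs (Suc k) = (if steppable (R k) then cs k \<union> {ci k, cj k} else cs k)"
  unfolding casc.simps(2) Let_def R_def[symmetric] ci_def[symmetric] tA_def[symmetric] tC_def[symmetric]
  using types_exclusive by (cases tA; cases tC) (auto simp: steppable_def cj_def)

declare casc.simps(2) [simp del]

lemma steppableD:
  assumes "steppable (R k)"
  shows "ismax t r (R k) (ci k)" "tA \<Longrightarrow> ismin t r (R k) (cj k)" "tC \<Longrightarrow> cj k = ci k"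
    "\<not> tA \<Longrightarrow> \<not> tC \<Longrightarrow> ismax t r (R k - {ci k}) (cj k)"
proof -
  obtain i where i: "ismax t r (R k) i" using assms by (auto simp: steppable_def split: if_splits)
  then have ci: "ci k = i" by (simp add: ci_def the_max)
  then show "ismax t r (R k) (ci k)" using i by simp
  show "ismin t r (R k) (cj k)" if tA
  proof -
    obtain j where "ismin t r (R k) j" using assms \<open>tA\<close> by (auto simp: steppable_def)
    then show ?thesis using \<open>tA\<close> by (simp add: cj_def the_min)
  qed
  show "cj k = ci k" if tC using that types_exclusive by (auto simp: cj_def)
  show "ismax t r (R k - {ci k}) (cj k)" if "\<not> tA" "\<not> tC"
  proof -
    obtain i' j where ij: "ismax t r (R k) i'" "ismax t r (R k - {i'}) j" using assms \<open>\<not> tA\<close> \<open>\<not> tC\<close> by (auto simp: steppable_def)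
    have "i' = ci k" using ij(1) by (simp add: ci_def the_max)
    then show ?thesis using ij that by (simp add: cj_def the_max)
  qed
qed

lemma ok_steppable: "ok k \<longleftrightarrow> steppable (R k)"
proof -
  have "ci k \<notin> cs k" if "steppable (R k)" using steppableD(1)[OF that] by (auto simp: ismax_def R_def)
  then show ?thesis by (auto simp: ok_def casc_Suc)
qed

text \<open>A step without a new root leaves the remaining indices unchanged, so all later steps
  fail as well.\<close>

lemma ok_down: assumes "ok k" "l \<le> k" shows "ok l"
proof (rule ccontr)
  assume n: "\<not> ok l"
  have "cs (l + d) = cs l" for d
  proof (induction d)
    case (Suc d)
    have "\<not> ok (l + d)" using n Suc by (simp add: ok_steppable R_def)
    then show ?case using Suc by (simp add: ok_def)
  qed simp
  from this[of "k - l"] this[of "Suc (k - l)"] show False using assms by (simp add: ok_def)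
qed

lemma cs_finite: "finite (cs k)" by (induction k) (auto simp: casc_Suc)

lemma cs_mono: "k \<le> l \<Longrightarrow> cs k \<subseteq> cs l"
  by (induction l rule: dec_induct) (auto simp: casc_Suc)

lemma R_pos: "s \<in> R k \<Longrightarrow> 0 < s" by (simp add: R_def)

lemma ok_ci: assumes "ok k"
  shows "ci k \<in> R k" "cj k \<in> R k" "cs (Suc k) = cs k \<union> {ci k, cj k}"
    "\<And>s. s \<in> R k \<Longrightarrow> s \<noteq> ci k \<Longrightarrow> gt (ci k) s"
    "\<And>s. tA \<Longrightarrow> s \<in> R k \<Longrightarrow> s \<noteq> cj k \<Longrightarrow> gt s (cj k)"
    "tC \<longleftrightarrow> cj k = ci k"
    "\<And>s. \<not> tA \<Longrightarrow> s \<in> R k \<Longrightarrow> s \<noteq> ci k \<Longrightarrow> s \<noteq> cj k \<Longrightarrow> gt (cj k) s"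
proof -
  have s: "steppable (R k)" using assms ok_steppable by simp
  note d = steppableD[OF s]
  show a: "ci k \<in> R k" "\<And>s. s \<in> R k \<Longrightarrow> s \<noteq> ci k \<Longrightarrow> gt (ci k) s" using d(1) by (auto simp: ismax_def)
  show b: "\<And>s. tA \<Longrightarrow> s \<in> R k \<Longrightarrow> s \<noteq> cj k \<Longrightarrow> gt s (cj k)" using d(2) by (auto simp: ismin_def)
  show "cj k \<in> R k" using d(2,3,4) a(1) by (cases tA; cases tC) (auto simp: ismin_def ismax_def)
  show "cs (Suc k) = cs k \<union> {ci k, cj k}" using s by (simp add: casc_Suc)
  show "\<And>s. \<not> tA \<Longrightarrow> s \<in> R k \<Longrightarrow> s \<noteq> ci k \<Longrightarrow> s \<noteq> cj k \<Longrightarrow> gt (cj k) s"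
    using d(3,4) a(2) by (cases tC) (auto simp: ismax_def)
  show "tC \<longleftrightarrow> cj k = ci k"
  proof
    show "tC \<Longrightarrow> cj k = ci k" by (rule d(3))
    assume e: "cj k = ci k"
    show tC
    proof (rule ccontr)
      assume nC: "\<not> tC"
      show False
      proof (cases tA)
        case True
        \<comment> \<open>In type A the maximum and the minimum of the remaining indices differ
          because infinitely many indices remain.\<close>
        have "infinite (R k)" unfolding R_def using infinite_pos cs_finite by simp
        then have "R k - {ci k} \<noteq> {}" by (metis finite.emptyI finite_Diff2 finite_insert)
        then obtain s where "s \<in> R k" "s \<noteq> ci k" by blast
        then show False using a(2)[of s] b[OF True, of s] e gt_asym by auto
      next
        case False
        then show False using d(4) nC e by (auto simp: ismax_def)
      qed
    qed
  qed
qed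

lemma ok_pos: "ok k \<Longrightarrow> 0 < ci k" "ok k \<Longrightarrow> 0 < cj k"
  using ok_ci R_pos by blast+

lemma cs_eq: "(\<And>k. k < n \<Longrightarrow> ok k) \<Longrightarrow> cs n = ci ` {..<n} \<union> cj ` {..<n}"
proof (induction n)
  case (Suc n)
  then show ?case using ok_ci(3)[of n] by (auto simp: lessThan_Suc)
qed simp

lemma ci_in: "ok k \<Longrightarrow> k < n \<Longrightarrow> ci k \<in> cs n" and cj_in: "ok k \<Longrightarrow> k < n \<Longrightarrow> cj k \<in> cs n"
  using ok_ci(3)[of k] cs_mono[of "Suc k" n] by auto

lemma R_later: assumes "ok l" "k < l" shows "ci l \<in> R k" "cj l \<in> R k"
  using ok_ci(1,2)[OF assms(1)] cs_mono[of k l] assms(2) by (auto simp: R_def)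

lemma later_ne:
  assumes "ok l" "k < l"
  shows "ci l \<noteq> ci k" "ci l \<noteq> cj k" "cj l \<noteq> ci k" "cj l \<noteq> cj k"
  using ok_ci(1,2)[OF assms(1)] ci_in[OF ok_down[OF assms(1)], of k l] cj_in[OF ok_down[OF assms(1)], of k l] assms(2)
  by (auto simp: R_def)

lemma ci_inj: "ok k \<Longrightarrow> ok l \<Longrightarrow> ci k = ci l \<longleftrightarrow> k = l"
  using later_ne(1)[of k l] later_ne(1)[of l k] by (cases k l rule: linorder_cases) auto
lemma cj_inj: "ok k \<Longrightarrow> ok l \<Longrightarrow> cj k = cj l \<longleftrightarrow> k = l"
  using later_ne(4)[of k l] later_ne(4)[of l k] by (cases k l rule: linorder_cases) auto
lemma ci_cj: "ok k \<Longrightarrow> ok l \<Longrightarrow> ci k = cj l \<longleftrightarrow> tC \<and> k = l"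
  using later_ne(2)[of k l] later_ne(3)[of l k] ok_ci(6)[of k] by (cases k l rule: linorder_cases) auto

text \<open>Everything above a maximum of the remaining indices was removed in earlier steps, and
  those removed finitely many.\<close>

lemma ci_Up: assumes "ok k" shows "ci k \<in> Up"
proof -
  have "{c. 0 < c \<and> gt c (ci k)} \<subseteq> cs k"
    using ok_ci(4)[OF assms] gt_asym by (auto simp: R_def)
  then show ?thesis using cs_finite finite_subset ok_pos[OF assms] by (auto simp: Up_def)
qed

lemma cj_Up: assumes "ok k" "\<not> tA" shows "cj k \<in> Up"
proof -
  have "{c. 0 < c \<and> gt c (cj k)} \<subseteq> insert (ci k) (cs k)"
    using ok_ci(7)[OF assms] gt_asym by (auto simp: R_def)
  then show ?thesis using cs_finite finite_subset ok_pos[OF assms(1)] by (auto simp: Up_def)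
qed

lemma cj_Lo: assumes "ok k" "tA" shows "cj k \<in> Lo"
proof -
  have "{c. 0 < c \<and> gt (cj k) c} \<subseteq> cs k"
    using ok_ci(5)[OF assms] gt_asym by (auto simp: R_def)
  then show ?thesis using cs_finite finite_subset ok_pos[OF assms(1)] by (auto simp: Lo_def)
qed

text \<open>The order may be dense elsewhere, so the maximum is reached by descent on the finite
  number of elements above \<open>a\<close>.\<close>

lemma max_exists:
  assumes "finite {c \<in> A. gt c a}" "a \<in> A" "A \<subseteq> {s. 0 < s}" shows "\<exists>i. ismax t r A i"
  using assms(1,2)
proof (induction "card {c \<in> A. gt c a}" arbitrary: a rule: less_induct)
  case less
  show ?case
  proof (cases "ismax t r A a")
    case False
    then obtain s where s: "s \<in> A" "s \<noteq> a" "\<not> gt a s" using less.prems by (auto simp: ismax_def)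
    then have sa: "gt s a" using gt_total[of s a] less.prems assms(3) by auto
    have sub: "{c \<in> A. gt c s} \<subset> {c \<in> A. gt c a}" 
    proof
      show "{c \<in> A. gt c s} \<subseteq> {c \<in> A. gt c a}" using sa gt_trans by blast
      show "{c \<in> A. gt c s} \<noteq> {c \<in> A. gt c a}" using s(1) sa gt_irrefl[of s] by blast
    qed
    have "finite {c \<in> A. gt c s}" using sub less.prems(1) by (meson finite_subset psubset_imp_subset)
    then show ?thesis using less.hyps[OF psubset_card_mono[OF less.prems(1) sub]] s by blast
  qed blast
qed

lemma min_exists:
  assumes "finite {c \<in> A. gt a c}" "a \<in> A" "A \<subseteq> {s. 0 < s}" shows "\<exists>i. ismin t r A i"
  using assms(1,2)
proof (induction "card {c \<in> A. gt a c}" arbitrary: a rule: less_induct)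
  case less
  show ?case
  proof (cases "ismin t r A a")
    case False
    then obtain s where s: "s \<in> A" "s \<noteq> a" "\<not> gt s a" using less.prems by (auto simp: ismin_def)
    then have sa: "gt a s" using gt_total[of s a] less.prems assms(3) by auto
    have sub: "{c \<in> A. gt s c} \<subset> {c \<in> A. gt a c}" 
    proof
      show "{c \<in> A. gt s c} \<subseteq> {c \<in> A. gt a c}" using sa gt_trans by blast
      show "{c \<in> A. gt s c} \<noteq> {c \<in> A. gt a c}" using s(1) sa gt_irrefl[of s] by blast
    qed
    have "finite {c \<in> A. gt s c}" using sub less.prems(1) by (meson finite_subset psubset_imp_subset)
    then show ?thesis using less.hyps[OF psubset_card_mono[OF less.prems(1) sub]] s by blast
  qed blast
qed

text \<open>The matrix positions that may be nonzero: all pairs from \<open>Up\<close>, or in type A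
  the two blocks between \<open>Up\<close> and \<open>Lo\<close>.\<close>

definition pairok :: "nat \<Rightarrow> nat \<Rightarrow> bool" where
  "pairok a b \<longleftrightarrow> (if tA then (a \<in> Up \<and> b \<in> Lo) \<or> (a \<in> Lo \<and> b \<in> Up) else a \<in> Up \<and> b \<in> Up)"

lemma Up_max: assumes "a \<in> Up" "a \<in> A" "A \<subseteq> {s. 0 < s}" shows "\<exists>i. ismax t r A i"
proof (rule max_exists[OF _ assms(2,3)])
  show "finite {c \<in> A. gt c a}"
    using assms by (auto simp: Up_def elim!: rev_finite_subset)
qed

lemma Lo_min: assumes "a \<in> Lo" "a \<in> A" "A \<subseteq> {s. 0 < s}" shows "\<exists>i. ismin t r A i"
proof (rule min_exists[OF _ assms(2,3)])
  show "finite {c \<in> A. gt a c}"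
    using assms by (auto simp: Lo_def elim!: rev_finite_subset)
qed

text \<open>If the cascade never stops, an index of \<open>Up\<close> that it avoids has all the
  \<open>ci k\<close> above it, which is impossible. If it stops while \<open>a\<close> and
  \<open>b\<close> both remain, they guarantee the extremal elements for one more step; in types B
  and D that takes two different indices.\<close>

lemma cover:
  assumes p: "pairok a b" and ab: "tC \<or> a \<noteq> b"
  shows "\<exists>n. (\<forall>k<n. ok k) \<and> (a \<in> cs n \<or> b \<in> cs n)"
proof (rule ccontr)
  assume n: "\<not> ?thesis"
  have pos: "0 < a" "0 < b" using p Up_pos Lo_pos by (auto simp: pairok_def split: if_splits)
  have abR: "a \<in> R k" "b \<in> R k" if "\<forall>l<k. ok l" for k using n that pos by (auto simp: R_def)
  show False
  proof (cases "\<forall>k. ok k")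
    case True
    have "\<exists>u. u \<in> Up \<and> (\<forall>k. u \<in> R k)" using p abR True by (auto simp: pairok_def split: if_splits)
    then obtain u where u: "u \<in> Up" "\<And>k. u \<in> R k" by blast
    have "ci k \<in> {c. 0 < c \<and> gt c u}" for k
    proof -
      have "u \<noteq> ci k" using u(2)[of "Suc k"] True ci_in[of k "Suc k"] by (auto simp: R_def)
      then show ?thesis using ok_ci(4)[of k u] True u ok_pos[of k] by auto
    qed
    then have "range ci \<subseteq> {c. 0 < c \<and> gt c u}" by auto
    moreover have "infinite (range ci)"
      using True ci_inj by (intro range_inj_infinite injI) auto
    ultimately show False using u(1) finite_subset by (auto simp: Up_def)
  next
    case False
    define k where "k = (LEAST k. \<not> ok k)"
    have nk: "\<not> ok k" using False unfolding k_def by (metis (mono_tags, lifting) LeastI_ex)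
    have "\<forall>l<k. ok l" unfolding k_def using not_less_Least by blast
    then have R: "a \<in> R k" "b \<in> R k" using abR by auto
    have Rp: "R k \<subseteq> {s. 0 < s}" by (auto simp: R_def)
    have "steppable (R k)"
    proof (cases tA)
      case True
      then show ?thesis using p R Rp Up_max Lo_min by (auto simp: steppable_def pairok_def)
    next
      case nA: False
      then have U: "a \<in> Up" "b \<in> Up" using p by (auto simp: pairok_def)
      obtain i where i: "ismax t r (R k) i" using Up_max[OF U(1) R(1) Rp] by blast
      show ?thesis
      proof (cases tC)
        case False
        then obtain u where "u \<in> Up" "u \<in> R k - {i}" using ab U R by (cases "a = i") auto
        then have "\<exists>j. ismax t r (R k - {i}) j" using Rp by (intro Up_max[of u]) auto
        then show ?thesis using i nA False by (auto simp: steppable_def)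
      qed (use i nA in \<open>auto simp: steppable_def\<close>)
    qed
    then show False using nk ok_steppable by simp
  qed
qed

lemma cover_finite:
  assumes "finite P" "\<And>a b. (a, b) \<in> P \<Longrightarrow> pairok a b \<and> (tC \<or> a \<noteq> b)"
  shows "\<exists>n. (\<forall>k<n. ok k) \<and> (\<forall>(a, b)\<in>P. a \<in> cs n \<or> b \<in> cs n)"
  using assms
proof (induction P rule: finite_induct)
  case (insert x P)
  obtain a b where x: "x = (a, b)" by (cases x)
  obtain n where n: "\<forall>k<n. ok k" "\<forall>(a, b)\<in>P. a \<in> cs n \<or> b \<in> cs n"
    using insert.IH insert.prems by auto
  obtain m where m: "\<forall>k<m. ok k" "a \<in> cs m \<or> b \<in> cs m" using cover[of a b] insert.prems x by auto
  show ?case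
    using n m cs_mono[of n "max n m"] cs_mono[of m "max n m"] x
    by (intro exI[of _ "max n m"]) (auto simp: less_max_iff_disj)
qed (auto intro: exI[of _ 0])

section \<open>Forms and elementary moves\<close>

text \<open>Up to the factor 2 on the diagonal in type C, the coordinates in Gc are the entries of
  a skew-symmetric (A, B, D) or symmetric (C) matrix; in type A it has a zero block on Up
  and on Lo.\<close>

definition form :: "(nat \<Rightarrow> nat \<Rightarrow> complex) \<Rightarrow> bool" where
  "form Y \<longleftrightarrow> (\<forall>a b. Y b a = eps * Y a b) \<and> (\<forall>a b. \<not> pairok a b \<longrightarrow> Y a b = 0)"

definition X :: "(gen \<Rightarrow> complex) \<Rightarrow> nat \<Rightarrow> nat \<Rightarrow> complex" where
  "X x a b = (if \<not> pairok a b then 0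
     else if tA then (if a \<in> Up then x (D a b) else - x (D b a)) else ev (V a b) x)"

text \<open>Inverse of \<open>X\<close> on forms. The coordinate at \<open>L a\<close> is half the
  diagonal entry, because \<open>V a a\<close> is twice the root vector.\<close>

definition gx :: "(nat \<Rightarrow> nat \<Rightarrow> complex) \<Rightarrow> gen \<Rightarrow> complex" where
  "gx Y g = (case g of D a b \<Rightarrow> Y a b | S a b \<Rightarrow> Y a b | L a \<Rightarrow> Y a a / 2 | H a \<Rightarrow> 0)"

text \<open>Index c may be added to index a: from larger to smaller indices within
  \<open>Up\<close>, and in type A from smaller to larger ones within \<open>Lo\<close>. These are
  the congruences induced by the root vectors \<open>D\<close>.\<close>

definition allowed :: "nat \<Rightarrow> nat \<Rightarrow> bool" where
  "allowed a c \<longleftrightarrow> a \<in> Up \<and> c \<in> Up \<and> gt c a \<or> tA \<and> a \<in> Lo \<and> c \<in> Lo \<and> gt a c"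

definition dY :: "nat \<Rightarrow> nat \<Rightarrow> (nat \<Rightarrow> nat \<Rightarrow> complex) \<Rightarrow> nat \<Rightarrow> nat \<Rightarrow> complex" where
  "dY a c Y u v = (if u = a then Y c v else 0) + (if v = a then Y u c else 0)"

text \<open>Congruence by the unipotent matrix 1 + s E_ac; \<open>dY\<close> is its derivative at s
  = 0, and the quadratic term is the diagonal entry that is changed twice.\<close>

definition flow :: "nat \<Rightarrow> nat \<Rightarrow> complex \<Rightarrow> (nat \<Rightarrow> nat \<Rightarrow> complex) \<Rightarrow> nat \<Rightarrow> nat \<Rightarrow> complex" where
  "flow a c s Y u v = Y u v + s * dY a c Y u v + s\<^sup>2 * (if u = a \<and> v = a then Y c c else 0)"

lemma pairok_sym: "pairok a b \<longleftrightarrow> pairok b a" by (auto simp: pairok_def)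

lemma allowed_ne: "allowed a c \<Longrightarrow> a \<noteq> c" by (auto simp: allowed_def)

lemma allowed_pairok: "allowed a c \<Longrightarrow> pairok a b \<longleftrightarrow> pairok c b"
  using Up_Lo_disjoint by (auto simp: allowed_def pairok_def)

lemma form_sym: "form Y \<Longrightarrow> Y b a = eps * Y a b" and form_0: "form Y \<Longrightarrow> \<not> pairok a b \<Longrightarrow> Y a b = 0"
  unfolding form_def by blast+

lemma form_diag: "form Y \<Longrightarrow> \<not> tC \<Longrightarrow> Y a a = 0"
proof -
  assume "form Y" "\<not> tC"
  then have "Y a a + Y a a = Y a a - Y a a" using form_sym[of Y a a] by (simp only: eps_def) simp
  then show "Y a a = 0" by (simp add: add_eq_0_iff)
qed

lemma form_X: "form (X x)"
  unfolding form_def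
proof (intro conjI allI impI)
  fix a b
  have "ev (V b a) x = eps * ev (V a b) x" if "0 < a" "0 < b"
    using gt_total[OF that] gt_asym[of a b] by (auto simp: ev_V eps_def)
  then show "X x b a = eps * X x a b"
    using pairok_sym[of a b] Up_Lo_disjoint Up_pos types_exclusive
    by (auto simp: X_def pairok_def eps_def split: if_splits)
qed (simp add: X_def)

lemma X_gx: assumes "form Y" shows "X (gx Y) = Y"
proof (intro ext)
  fix a b
  show "X (gx Y) a b = Y a b"
  proof (cases "pairok a b")
    case True
    show ?thesis
    proof (cases tA)
      case A: True
      then show ?thesis using True Up_Lo_disjoint form_sym[OF assms, of a b] types_exclusive
        by (auto simp: X_def gx_def eps_def pairok_def)
    next
      case False
      then have "0 < a" "0 < b" using True Up_pos by (auto simp: pairok_def)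
      then show ?thesis using True False gt_total[of a b] form_sym[OF assms, of b a] form_diag[OF assms, of a]
        by (auto simp: X_def gx_def ev_V)
    qed
  qed (use form_0[OF assms] in \<open>simp add: X_def\<close>)
qed

lemma gx_X: "g \<in> Gc \<Longrightarrow> gx (X x) g = x g"
  by (cases g) (auto simp: gx_def X_def Gc_iff pairok_def ev_V types_exclusive dest: types_exclusive)

lemma X_add: "X (\<lambda>g. x g + s * y g) a b = X x a b + s * X y a b"
  by (auto simp: X_def ev_V algebra_simps)

section \<open>The coadjoint action expressed through forms\<close>

lemma X_xi_Up:
  assumes "l \<in> Up" "gt k l" "0 < k" shows "X (xi (D k l) x) u v = - dY l k (X x) u v"
proof -
  have k: "k \<in> Up" using assms Up_up by blast
  have kl: "k \<noteq> l" using assms by auto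
  have al: "allowed l k" using assms k by (auto simp: allowed_def)
  show ?thesis
  proof (cases "pairok u v")
    case False
    then show ?thesis
      using al allowed_pairok[OF al] pairok_sym by (auto simp: X_def dY_def)
  next
    case True
    show ?thesis
    proof (cases tA)
      case A: True
      then show ?thesis using True k assms(1) Up_Lo_disjoint
        by (auto simp: X_def pairok_def xi_simps dY_def dl_def)
    next
      case False
      then have U: "u \<in> Up" "v \<in> Up" "0 < u" "0 < v" using True Up_pos by (auto simp: pairok_def)
      have p: "pairok k v" "pairok u k" using U k False by (auto simp: pairok_def)
      have X: "X y u' v' = ev (V u' v') y" if "u' \<in> Up" "v' \<in> Up" for y u' v'
        using that False by (simp add: X_def pairok_def)
      have sym: "ev (V u' v') y = eps * ev (V v' u') y" if "u' \<in> Up" "v' \<in> Up" for y u' v'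
        using form_sym[OF form_X, of y u' v'] X that by simp
      have "ev (V u v) (xi (D k l) x) = - dl l u * ev (V k v) x - eps * dl l v * ev (V k u) x"
      proof (cases "u = v")
        case True
        then show ?thesis by (auto simp: ev_V[of v v] xi_simps eps_def)
      next
        case uv: False
        show ?thesis
        proof (cases "gt u v")
          case True
          then show ?thesis using uv by (simp add: ev_V[of u v] xi_simps)
        next
          case False
          then show ?thesis using uv by (simp add: ev_V[of u v] xi_simps algebra_simps)
        qed
      qed
      then show ?thesis using U k X sym[of k u] by (auto simp: dY_def dl_def)
    qed
  qed
qed

lemma X_xi_Lo:
  assumes "tA" "k \<in> Lo" "gt k l" "0 < l" shows "X (xi (D k l) x) u v = dY k l (X x) u v"
proof -
  have l: "l \<in> Lo" using assms Lo_down by blast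
  have al: "allowed k l" using assms l by (auto simp: allowed_def)
  show ?thesis
  proof (cases "pairok u v")
    case False
    then show ?thesis
      using al allowed_pairok[OF al] pairok_sym by (auto simp: X_def dY_def)
  next
    case True
    then show ?thesis using True l assms Up_Lo_disjoint
      by (auto simp: X_def pairok_def xi_simps dY_def dl_def)
  qed
qed

text \<open>On sum roots only difference roots act, and \<open>D k l\<close> acts through the index
  l alone. In type A it acts through l on the upper index and through k on the lower one.\<close>

lemma X_xi_0:
  assumes "h \<in> GG" "\<And>k l. h = D k l \<Longrightarrow> l \<notin> Up \<and> \<not> (tA \<and> k \<in> Lo)"
  shows "X (xi h x) u v = 0"
proof (cases "pairok u v")
  case True
  show ?thesis
  proof (cases tA)
    case A: True
    then obtain k l where h: "h = D k l" using assms(1) by (cases h) (auto simp: GG_iff types_exclusive)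
    show ?thesis using assms(2)[OF h] True A
      by (auto simp: h X_def pairok_def xi_simps dl_def dest: Up_Lo_disjoint)
  next
    case False
    then have "u \<in> Up" "v \<in> Up" using True by (auto simp: pairok_def)
    then show ?thesis using assms(2) False
      by (cases h) (auto simp: X_def xi_simps dl_def ev_V[of u v])
  qed
qed (simp add: X_def)

lemma allowed_xi:
  assumes "allowed a c"
  shows "\<exists>h\<in>GG. \<exists>\<kappa>. \<kappa> \<noteq> 0 \<and> (\<forall>x. X (xi h x) = (\<lambda>u v. \<kappa> * dY a c (X x) u v))"
proof -
  have p: "0 < a" "0 < c" using assms Up_pos Lo_pos by (auto simp: allowed_def)
  show ?thesis
  proof (cases "a \<in> Up \<and> gt c a")
    case True
    then have "X (xi (D c a) x) = (\<lambda>u v. - 1 * dY a c (X x) u v)" for x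
      using X_xi_Up[of a c x] p by (simp add: fun_eq_iff)
    moreover have "D c a \<in> GG" using True p by (simp add: GG_iff)
    ultimately show ?thesis by (metis zero_neq_neg_one)
  next
    case False
    then have l: "tA" "a \<in> Lo" "gt a c" using assms by (auto simp: allowed_def)
    then have "X (xi (D a c) x) = (\<lambda>u v. 1 * dY a c (X x) u v)" for x
      using X_xi_Lo[of a c x] p by (simp add: fun_eq_iff)
    moreover have "D a c \<in> GG" using l p by (simp add: GG_iff)
    ultimately show ?thesis by (metis zero_neq_one)
  qed
qed

lemma form_flow: assumes "form Y" "allowed a c" shows "form (flow a c s Y)"
  unfolding form_def
proof (intro conjI allI impI)
  fix u v
  have cc: "eps * Y c c = Y c c" using form_sym[OF assms(1), of c c] by (rule sym)
  have cc': "eps * (Y c c * q) = Y c c * q" for q using cc by (simp flip: mult.assoc)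
  show "flow a c s Y v u = eps * flow a c s Y u v"
    by (simp add: flow_def dY_def algebra_simps cc' form_sym[OF assms(1), of a c] form_sym[OF assms(1), of u v]
        form_sym[OF assms(1), of c v] form_sym[OF assms(1), of u c])
next
  fix u v assume n: "\<not> pairok u v"
  then have "\<not> pairok c v" if "u = a" using that allowed_pairok[OF assms(2)] by blast
  moreover have "\<not> pairok u c" if "v = a" using that n allowed_pairok[OF assms(2)] pairok_sym by blast
  moreover have "\<not> pairok c c" if "u = a" "v = a" using that n allowed_pairok[OF assms(2)] pairok_sym by blast
  ultimately show "flow a c s Y u v = 0" using n form_0[OF assms(1)] by (auto simp: flow_def dY_def)
qed

text \<open>The flow is an integral curve of the field \<open>dY\<close>, which on the coordinates
  in \<open>Gc\<close> is a nonzero multiple of a coadjoint field; an invariant has zero derivative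
  along it.\<close>

lemma flow_invariant:
  assumes z: "z \<in> FN Gc" "invariant z" and Y: "form Y" "allowed a c"
  shows "ev z (gx (flow a c s Y)) = ev z (gx Y)"
proof -
  obtain h \<kappa> where h: "h \<in> GG" "\<kappa> \<noteq> 0" "\<forall>x. X (xi h x) = (\<lambda>u v. \<kappa> * dY a c (X x) u v)"
    using allowed_xi[OF Y(2)] by blast
  have ac: "a \<noteq> c" by (rule allowed_ne[OF Y(2)])
  define v where "v s = gx (dY a c (flow a c s Y))" for s
  have "ev z (gx (flow a c s Y)) = ev z (gx (flow a c 0 Y))"
  proof (rule ev_const_path[OF z(1), where \<gamma>="\<lambda>s. gx (flow a c s Y)" and v=v])
    fix s g
    have f: "((\<lambda>s. flow a c s Y u w) has_field_derivative dY a c (flow a c s Y) u w) (at s)" for u w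
    proof -
      have q: "((\<lambda>s. p + s * q + s\<^sup>2 * e) has_field_derivative q + 2 * s * e) (at s)" for p q e :: complex
        by (auto intro!: derivative_eq_intros)
      \<comment> \<open>Since a and c differ, the flow changes row c only in column a, and column c
        only in row a; this accounts for the term with 2 s.\<close>
      have "dY a c (flow a c s Y) u w = dY a c Y u w + 2 * s * (if u = a \<and> w = a then Y c c else 0)"
        using ac by (auto simp: dY_def flow_def)
      moreover have "((\<lambda>s. flow a c s Y u w) has_field_derivative
          dY a c Y u w + 2 * s * (if u = a \<and> w = a then Y c c else 0)) (at s)"
        unfolding flow_def by (rule q)
      ultimately show ?thesis by (simp only:)
    qed
    show "((\<lambda>s. gx (flow a c s Y) g) has_field_derivative v s g) (at s)"
    proof (cases g)
      case (D i j)
      then show ?thesis using f[of i j] by (simp add: v_def gx_def)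
    next
      case (S i j)
      then show ?thesis using f[of i j] by (simp add: v_def gx_def)
    next
      case (L i)
      then show ?thesis using DERIV_cdivide[OF f[of i i], of 2] by (simp add: v_def gx_def)
    next
      case (H i)
      then show ?thesis by (simp add: v_def gx_def)
    qed
  next
    fix s
    define x where "x = gx (flow a c s Y)"
    have Xx: "X x = flow a c s Y" unfolding x_def by (rule X_gx[OF form_flow[OF Y]])
    have "dev z x (\<lambda>g. \<kappa> * v s g) = dev z x (xi h x)"
    proof (rule dev_cong[OF z(1)])
      fix g assume g: "g \<in> Gc"
      have "X (xi h x) = (\<lambda>u w. \<kappa> * dY a c (flow a c s Y) u w)" using h(3)[rule_format, of x] unfolding Xx .
      then show "\<kappa> * v s g = xi h x g"
        using gx_X[OF g, of "xi h x"] by (cases g) (simp_all add: v_def gx_def)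
    qed simp
    then have "\<kappa> * dev z x (v s) = 0" using z(2) h(1) by (simp add: dev_scale invariant_def)
    then show "dev z (gx (flow a c s Y)) (v s) = 0" using h(2) by (simp add: x_def)
  qed
  moreover have "flow a c 0 Y = Y" by (auto simp: flow_def fun_eq_iff)
  ultimately show ?thesis by simp
qed

end

section \<open>The generators\<close>

lemma prod_list_upt: "(\<Prod>i\<leftarrow>[0..<n]. f i) = (\<Prod>i<n. f i :: complex)"
  by (induction n) (auto simp: mult.commute)

context nilrad
begin

lemma sorted_gt_distinct: "sorted_wrt gt xs \<Longrightarrow> distinct xs"
  by (induction xs) auto

lemma sorted_gt_unique:
  "sorted_wrt gt xs \<Longrightarrow> sorted_wrt gt ys \<Longrightarrow> set xs = set ys \<Longrightarrow> xs = ys"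
proof (induction xs arbitrary: ys)
  case (Cons a xs)
  then obtain b zs where ys: "ys = b # zs" by (cases ys) auto
  have ab: "a = b"
  proof (rule ccontr)
    assume "a \<noteq> b"
    then have "b \<in> set xs" "a \<in> set zs" using Cons.prems(3) by (auto simp: ys)
    then show False using Cons.prems(1,2) gt_asym[of a b] by (auto simp: ys)
  qed
  have "a \<notin> set xs" "b \<notin> set zs" using Cons.prems(1,2) by (auto simp: ys)
  then have "set xs = set zs" using Cons.prems(3) ab by (auto simp: ys)
  then show ?case using Cons.IH[of zs] Cons.prems ys ab by auto
qed auto

lemma thsort_eq: assumes "sorted_wrt gt xs" shows "thsort t r (set xs) = xs"
  unfolding thsort_def
  by (rule the_equality) (use assms sorted_gt_distinct sorted_gt_unique in auto)

text \<open>The cascade letters of types B and D in decreasing order: the pair of step k occupies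
  the places 2k and 2k + 1.\<close>

definition lt :: "nat \<Rightarrow> nat" where "lt m = (if even m then ci (m div 2) else cj (m div 2))"

lemma gt_ci_ci: "ok l \<Longrightarrow> k < l \<Longrightarrow> gt (ci k) (ci l)"
  using ok_ci(4)[of k "ci l"] ok_down[of l k] R_later[of l k] later_ne[of l k] by auto

lemma gt_ci_cj: "ok l \<Longrightarrow> ok k \<Longrightarrow> tA \<Longrightarrow> gt (ci k) (cj l)"
  using Up_Lo ci_Up cj_Lo by blast

lemma gt_cj_cj: "ok l \<Longrightarrow> k < l \<Longrightarrow> tA \<Longrightarrow> gt (cj l) (cj k)"
  using ok_ci(5)[of k "cj l"] ok_down[of l k] R_later[of l k] later_ne[of l k] by auto

lemma gt_lt: assumes "\<not> tA" "\<not> tC" "ok (j div 2)" "i < j" shows "gt (lt i) (lt j)"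
proof (cases "i div 2 = j div 2")
  case True
  then have "even i" "odd j" using assms(4) by presburger+
  then show ?thesis
    using ok_ci(2)[OF assms(3)] ok_ci(4)[OF assms(3), of "cj (j div 2)"] ok_ci(6)[OF assms(3)] assms(2) True
    by (auto simp: lt_def)
next
  case False
  then have l: "i div 2 < j div 2" using assms(4) div_le_mono[of i j 2] by linarith
  have o: "ok (i div 2)" using ok_down[OF assms(3)] l by auto
  have "lt j \<in> R (i div 2)" "lt j \<noteq> ci (i div 2)" "lt j \<noteq> cj (i div 2)"
    using R_later[OF assms(3) l] later_ne[OF assms(3) l] by (auto simp: lt_def)
  then show ?thesis using ok_ci(4)[OF o, of "lt j"] ok_ci(7)[OF o assms(1), of "lt j"] by (simp add: lt_def[of i])
qed

lemma lt_inj: "\<not> tA \<Longrightarrow> \<not> tC \<Longrightarrow> ok (i div 2) \<Longrightarrow> ok (j div 2) \<Longrightarrow> lt i = lt j \<longleftrightarrow> i = j"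
  using gt_lt[of i j] gt_lt[of j i] by (cases i j rule: linorder_cases) auto

definition Vn :: "nat \<Rightarrow> nat \<Rightarrow> gen nc" where "Vn a b = (if tA then wd [D a b] else V a b)"

text \<open>Matrix position of the i-th factor in the term of \<open>p\<close>. The determinants of
  types A and C run backwards through the columns, the Pfaffian takes consecutive values of
  \<open>p\<close>; one description serves all types.\<close>

definition entry :: "nat \<Rightarrow> (nat \<Rightarrow> nat) \<Rightarrow> nat \<Rightarrow> nat \<times> nat" where
  "entry n p i = (if tA \<or> tC then (ci i, cj (n - 1 - p i)) else (lt (p (2*i)), lt (p (2*i+1))))"

definition psize :: "nat \<Rightarrow> nat" where "psize n = (if tA \<or> tC then n else 2 * n)"

definition pcoef :: "nat \<Rightarrow> complex" where
  "pcoef n = (if tA \<or> tC then 1 else 1 / (2 ^ n * fact n))"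

text \<open>The generator of index n read as a polynomial in the entries of a form.\<close>

definition Th :: "nat \<Rightarrow> (nat \<Rightarrow> nat \<Rightarrow> complex) \<Rightarrow> complex" where
  "Th n Y = pcoef n * (\<Sum>p | p permutes {..<psize n}. of_int (sign p) *
      (\<Prod>i<n. Y (fst (entry n p i)) (snd (entry n p i))))"

lemma nc_fdet: "nc (fdet n M) = (\<Sum>p | p permutes {..<n}. sc (of_int (sign p))
     (prod_list (map (\<lambda>i. nc (M i (p i))) [0..<n])))"
  by (simp add: fdet_def nc_fsum nc_simps nc_fprod o_def)

lemma nc_fpf: "nc (fpf n M) = sc (1 / (2 ^ n * fact n)) (\<Sum>p | p permutes {..<2*n}. sc (of_int (sign p))
     (prod_list (map (\<lambda>i. nc (M (p (2*i)) (p (2*i+1)))) [0..<n])))"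
  by (simp add: fpf_def nc_fsum nc_simps nc_fprod o_def)

text \<open>The point is to identify the sorted cascade letters: in type A the \<open>ci\<close>
  followed by the \<open>cj\<close> in reverse, in type C the \<open>ci\<close>, in types B and D
  the sequence \<open>lt\<close>. A strictly sorted list is determined by its elements.\<close>

lemma nc_cgen:
  assumes ok: "\<And>k. k < n \<Longrightarrow> ok k"
  shows "nc (cgen t r n) = sc (pcoef n) (\<Sum>p | p permutes {..<psize n}. sc (of_int (sign p))
     (prod_list (map (\<lambda>i. Vn (fst (entry n p i)) (snd (entry n p i))) [0..<n])))"
proof (cases "tA \<or> tC")
  case True
  define Ls where "Ls = (if tA then map ci [0..<n] @ map (\<lambda>j. cj (n - 1 - j)) [0..<n] else map ci [0..<n])"
  have "set Ls = cs n"
  proof (cases tA)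
    case True
    have "cj ` {..<n} \<subseteq> (\<lambda>j. cj (n - Suc j)) ` {..<n}"
    proof
      fix y assume "y \<in> cj ` {..<n}"
      then obtain k where "k < n" "y = cj k" by auto
      then have "y = cj (n - Suc (n - Suc k))" "n - Suc k < n" by auto
      then show "y \<in> (\<lambda>j. cj (n - Suc j)) ` {..<n}" by blast
    qed
    moreover have "(\<lambda>j. cj (n - Suc j)) ` {..<n} \<subseteq> cj ` {..<n}" by auto
    ultimately show ?thesis using cs_eq[of n] ok True by (auto simp: Ls_def lessThan_atLeast0)
  next
    case False
    then have "cj k = ci k" if "k < n" for k using ok[OF that] ok_ci(6)[of k] \<open>tA \<or> tC\<close> by auto
    then show ?thesis using cs_eq[of n] ok False by (auto simp: Ls_def)
  qed
  moreover have "sorted_wrt gt Ls"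
  proof (cases tA)
    case True
    have "sorted_wrt gt (map ci [0..<n])"
      using ok gt_ci_ci by (auto simp: sorted_wrt_iff_nth_less)
    moreover have "sorted_wrt gt (map (\<lambda>j. cj (n - 1 - j)) [0..<n])"
      using ok gt_cj_cj True by (auto simp: sorted_wrt_iff_nth_less)
    ultimately show ?thesis using True gt_ci_cj ok by (auto simp: Ls_def sorted_wrt_append)
  next
    case False
    then show ?thesis using ok gt_ci_ci by (auto simp: sorted_wrt_iff_nth_less Ls_def)
  qed
  ultimately have th: "thsort t r (cs n) = Ls" using thsort_eq[of Ls] by simp
  have "nc (cgen t r n) = nc (fdet n (\<lambda>i j. if tA then fgen (D (Ls ! i) (Ls ! (n + j)))
     else vv t r (Ls ! i) (Ls ! (n - 1 - j))))"
    using True unfolding cgen_def th Let_def tA_def[symmetric] tC_def[symmetric] by auto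
  also have "\<dots> = (\<Sum>p | p permutes {..<n}. sc (of_int (sign p))
     (prod_list (map (\<lambda>i. Vn (ci i) (cj (n - 1 - p i))) [0..<n])))"
    unfolding nc_fdet
  proof (rule sum.cong[OF refl], clarify, rule arg_cong[of _ _ "sc _"], rule arg_cong[of _ _ prod_list],
      rule map_cong[OF refl])
    fix p i assume p: "p permutes {..<n}" and i: "i \<in> set [0..<n]"
    then have i: "i < n" "p i < n" using permutes_in_image[OF p, of i] by auto
    show "nc (if tA then fgen (D (Ls ! i) (Ls ! (n + p i))) else vv t r (Ls ! i) (Ls ! (n - 1 - p i)))
       = Vn (ci i) (cj (n - 1 - p i))"
    proof (cases tA)
      case True
      then show ?thesis using i by (simp add: Vn_def nc_simps Ls_def nth_append)
    next
      case False
      then have "cj (n - 1 - p i) = ci (n - 1 - p i)"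
        using ok[of "n - 1 - p i"] ok_ci(6)[of "n - 1 - p i"] \<open>tA \<or> tC\<close> i by auto
      then show ?thesis using i False by (simp add: Vn_def Ls_def)
    qed
  qed
  finally show ?thesis using True by (simp add: pcoef_def psize_def entry_def)
next
  case False
  define Ls where "Ls = map lt [0..<2*n]"
  have "set Ls = cs n"
  proof -
    have "lt ` {..<2*n} \<subseteq> ci ` {..<n} \<union> cj ` {..<n}" by (auto simp: lt_def)
    moreover have "ci k \<in> lt ` {..<2*n}" if "k < n" for k
      using that by (intro image_eqI[of _ _ "2*k"]) (auto simp: lt_def)
    moreover have "cj k \<in> lt ` {..<2*n}" if "k < n" for k
      using that by (intro image_eqI[of _ _ "2*k+1"]) (auto simp: lt_def)
    ultimately show ?thesis using cs_eq[of n] ok by (auto simp: Ls_def lessThan_atLeast0)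
  qed
  moreover have "sorted_wrt gt Ls"
    using False ok gt_lt by (auto simp: Ls_def sorted_wrt_iff_nth_less)
  ultimately have th: "thsort t r (cs n) = Ls" using thsort_eq[of Ls] by simp
  have "nc (cgen t r n) = nc (fpf n (\<lambda>i j. if i < j then fgen (S (Ls ! i) (Ls ! j))
                       else if j < i then fscale (-1) (fgen (S (Ls ! j) (Ls ! i))) else fzero))"
    using False unfolding cgen_def th Let_def tA_def[symmetric] tC_def[symmetric] by simp
  also have "\<dots> = sc (1 / (2 ^ n * fact n)) (\<Sum>p | p permutes {..<2*n}. sc (of_int (sign p))
     (prod_list (map (\<lambda>i. Vn (lt (p (2*i))) (lt (p (2*i+1)))) [0..<n])))"
    unfolding nc_fpf
  proof (rule arg_cong[of _ _ "sc _"], rule sum.cong[OF refl], clarify, rule arg_cong[of _ _ "sc _"], rule arg_cong[of _ _ prod_list],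
      rule map_cong[OF refl])
    fix p i assume p: "p permutes {..<2*n}" and i: "i \<in> set [0..<n]"
    define a b where "a = p (2*i)" and "b = p (2*i+1)"
    have ab: "a < 2*n" "b < 2*n"
      using permutes_in_image[OF p, of "2*i"] permutes_in_image[OF p, of "2*i+1"] i by (auto simp: a_def b_def)
    then have ok': "ok (a div 2)" "ok (b div 2)" using ok by auto
    have g: "gt (lt a) (lt b) \<longleftrightarrow> a < b" "lt a = lt b \<longleftrightarrow> a = b"
      using gt_lt[of b a] gt_lt[of a b] False ok' gt_asym[of "lt a" "lt b"]
      by (cases a b rule: linorder_cases; force)+
    show "nc (if p (2*i) < p (2*i+1) then fgen (S (Ls ! p (2*i)) (Ls ! p (2*i+1)))
          else if p (2*i+1) < p (2*i) then fscale (-1) (fgen (S (Ls ! p (2*i+1)) (Ls ! p (2*i)))) else fzero)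
       = Vn (lt (p (2*i))) (lt (p (2*i+1)))"
      unfolding a_def[symmetric] b_def[symmetric]
      using ab g False by (auto simp: Vn_def nc_vv nc_simps Ls_def eps_def)
  qed
  finally show ?thesis using False by (simp add: pcoef_def psize_def entry_def)
qed

lemma entry_pairok:
  assumes ok: "\<And>k. k < n \<Longrightarrow> ok k" and p: "p permutes {..<psize n}" and i: "i < n"
  shows "pairok (fst (entry n p i)) (snd (entry n p i))" "tA \<Longrightarrow> fst (entry n p i) \<in> Up"
proof -
  have "pairok (fst (entry n p i)) (snd (entry n p i)) \<and> (tA \<longrightarrow> fst (entry n p i) \<in> Up)"
  proof (cases "tA \<or> tC")
    case True
    then have "ok i" "ok (n - 1 - p i)" using ok i by auto
    then show ?thesis using True ci_Up cj_Up cj_Lo by (auto simp: entry_def pairok_def)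
  next
    case False
    have "p (2*i) < 2*n" "p (2*i+1) < 2*n"
      using permutes_in_image[OF p, of "2*i"] permutes_in_image[OF p, of "2*i+1"] i False by (auto simp: psize_def)
    then have "ok (p (2*i) div 2)" "ok (p (2*i+1) div 2)" using ok by auto
    then show ?thesis using False ci_Up cj_Up by (auto simp: entry_def pairok_def lt_def)
  qed
  then show "pairok (fst (entry n p i)) (snd (entry n p i))" "tA \<Longrightarrow> fst (entry n p i) \<in> Up" by auto
qed

lemma Vn_props:
  assumes "pairok a b" "tA \<Longrightarrow> a \<in> Up"
  shows "Vn a b \<in> FN Gc" "hom 1 (Vn a b)" "ev (Vn a b) x = X x a b"
proof -
  show "Vn a b \<in> FN Gc"
    using assms FN_V[of a b] Up_Lo_disjoint by (auto simp: Vn_def pairok_def Gc_iff intro!: FN_wd split: if_splits)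
  show "hom 1 (Vn a b)" using hom_vv by (auto simp: Vn_def intro!: hom_wd)
  show "ev (Vn a b) x = X x a b" using assms by (auto simp: Vn_def X_def)
qed

lemma cgen_props:
  assumes ok: "\<And>k. k < n \<Longrightarrow> ok k"
  shows "nc (cgen t r n) \<in> FN Gc" "hom n (nc (cgen t r n))" "ev (nc (cgen t r n)) x = Th n (X x)"
proof -
  define E where "E p i = Vn (fst (entry n p i)) (snd (entry n p i))" for p i
  have E: "E p i \<in> FN Gc" "hom 1 (E p i)" "ev (E p i) x = X x (fst (entry n p i)) (snd (entry n p i))"
    if "p permutes {..<psize n}" "i < n" for p i
    using Vn_props[of "fst (entry n p i)" "snd (entry n p i)"] entry_pairok[where n=n, OF ok that] by (auto simp: E_def)
  have P: "prod_list (map (E p) [0..<n]) \<in> FN Gc" "hom n (prod_list (map (E p) [0..<n]))"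
    "ev (prod_list (map (E p) [0..<n])) x = (\<Prod>i<n. X x (fst (entry n p i)) (snd (entry n p i)))"
    if p: "p permutes {..<psize n}" for p
  proof -
    show "prod_list (map (E p) [0..<n]) \<in> FN Gc" using E[OF p] by (intro FN_prod_list) auto
    have "hom (length (map (E p) [0..<n])) (prod_list (map (E p) [0..<n]))"
      using E[OF p] by (intro hom_prod_list) auto
    then show "hom n (prod_list (map (E p) [0..<n]))" by simp
    have "ev (prod_list (map (E p) [0..<n])) x = (\<Prod>i\<leftarrow>[0..<n]. ev (E p i) x)"
      using E[OF p] by (subst ev_prod_list[where G=Gc]) (auto simp: o_def)
    also have "\<dots> = (\<Prod>i<n. X x (fst (entry n p i)) (snd (entry n p i)))"
      unfolding prod_list_upt using E[OF p] by (intro prod.cong) auto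
    finally show "ev (prod_list (map (E p) [0..<n])) x = (\<Prod>i<n. X x (fst (entry n p i)) (snd (entry n p i)))" .
  qed
  have c: "nc (cgen t r n) = sc (pcoef n) (\<Sum>p | p permutes {..<psize n}. sc (of_int (sign p))
     (prod_list (map (E p) [0..<n])))"
  proof -
    have "map (E p) [0..<n] = map (\<lambda>i. Vn (fst (entry n p i)) (snd (entry n p i))) [0..<n]" for p
      by (simp add: E_def)
    then show ?thesis using nc_cgen[where n=n, OF ok] by (simp del: map_eq_conv)
  qed
  show "nc (cgen t r n) \<in> FN Gc" unfolding c using P by (intro FN_sc FN_sum) auto
  show "hom n (nc (cgen t r n))" unfolding c using P by (intro hom_sc hom_sum) auto
  have "ev (\<Sum>p | p permutes {..<psize n}. sc (of_int (sign p)) (prod_list (map (E p) [0..<n]))) x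
    = (\<Sum>p | p permutes {..<psize n}. ev (sc (of_int (sign p)) (prod_list (map (E p) [0..<n]))) x)"
    using P by (intro ev_sum[where G=Gc]) (auto intro!: FN_sc)
  also have "\<dots> = (\<Sum>p | p permutes {..<psize n}. of_int (sign p) * (\<Prod>i<n. X x (fst (entry n p i)) (snd (entry n p i))))"
    using P by (intro sum.cong) auto
  finally show "ev (nc (cgen t r n)) x = Th n (X x)" unfolding c by (simp add: Th_def)
qed

section \<open>Invariance of the generators\<close>

lemma above_ci: "ok k \<Longrightarrow> gt c (ci k) \<Longrightarrow> 0 < c \<Longrightarrow> c \<in> cs k"
  using ok_ci(4)[of k c] gt_asym by (auto simp: R_def)

lemma above_cj: "ok k \<Longrightarrow> \<not> tA \<Longrightarrow> gt c (cj k) \<Longrightarrow> 0 < c \<Longrightarrow> c \<in> insert (ci k) (cs k)"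
  using ok_ci(7)[of k c] gt_asym by (auto simp: R_def)

lemma below_cj: "ok k \<Longrightarrow> tA \<Longrightarrow> gt (cj k) c \<Longrightarrow> 0 < c \<Longrightarrow> c \<in> cs k"
  using ok_ci(5)[of k c] gt_asym by (auto simp: R_def)

lemma cs_cases: "ok k \<Longrightarrow> c \<in> cs k \<Longrightarrow> \<exists>l<k. ok l \<and> (c = ci l \<or> c = cj l)"
  using cs_eq[of k] ok_down[of k] by (auto dest: less_imp_le)

text \<open>Indices above a cascade letter were chosen earlier, so a move into a row of the
  determinant adds an earlier row of the same determinant.\<close>

lemma allowed_ci:
  assumes "allowed (ci i0) c" "ok i0" "tA \<or> tC" shows "\<exists>i1<i0. c = ci i1"
proof -
  have c: "gt c (ci i0)" "c \<in> Up" using assms ci_Up Up_Lo_disjoint by (auto simp: allowed_def)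
  then obtain l where l: "l < i0" "ok l" "c = ci l \<or> c = cj l"
    using above_ci[OF assms(2)] cs_cases[OF assms(2)] Up_pos by blast
  then show ?thesis using assms(3) ok_ci(6)[of l] cj_Lo[of l] c Up_Lo_disjoint by auto
qed

lemma allowed_cj:
  assumes "allowed (cj i0) c" "ok i0" "tA \<or> tC" shows "\<exists>i1<i0. c = cj i1"
proof (cases tC)
  case True
  then have "cj i0 = ci i0" using ok_ci(6)[OF assms(2)] by auto
  then obtain i1 where "i1 < i0" "c = ci i1" using allowed_ci assms by auto
  then show ?thesis using True ok_ci(6)[of i1] ok_down[OF assms(2), of i1] by (intro exI[of _ i1]) auto
next
  case False
  then have A: tA using assms by auto
  have c: "gt (cj i0) c" "c \<in> Lo" using assms cj_Lo[OF assms(2) A] Up_Lo_disjoint by (auto simp: allowed_def)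
  then obtain l where l: "l < i0" "ok l" "c = ci l \<or> c = cj l"
    using below_cj[OF assms(2) A] cs_cases[OF assms(2)] Lo_pos by blast
  then show ?thesis using ci_Up[of l] c Up_Lo_disjoint by auto
qed

lemma allowed_lt:
  assumes "allowed (lt m0) c" "ok (m0 div 2)" "\<not> tA" "\<not> tC" shows "\<exists>m1<m0. c = lt m1"
proof -
  have c: "gt c (lt m0)" "0 < c" using assms Up_pos by (auto simp: allowed_def)
  have *: "\<exists>m1<m0. c = lt m1" if cc: "c \<in> cs (m0 div 2)"
  proof -
    obtain l where l: "l < m0 div 2" "c = ci l \<or> c = cj l" using cs_cases[OF assms(2) cc] by auto
    then have "c = lt (2*l) \<or> c = lt (2*l+1)" "2*l+1 < m0" by (auto simp: lt_def)
    then show ?thesis by (metis add_lessD1)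
  qed
  show ?thesis
  proof (cases "even m0")
    case True
    then show ?thesis using * above_ci[OF assms(2)] c by (auto simp: lt_def)
  next
    case False
    then have "c \<in> insert (ci (m0 div 2)) (cs (m0 div 2))" using above_cj[OF assms(2,3)] c by (auto simp: lt_def)
    moreover have "ci (m0 div 2) = lt (m0 - 1)" "m0 - 1 < m0" using False by (auto simp: lt_def elim!: oddE)
    ultimately show ?thesis using * by auto
  qed
qed

text \<open>Along a move the derivative repeats a row or a column of the determinant, or an index of
  the Pfaffian. In type C rows and columns change together, and the two contributions vanish
  separately.\<close>

lemma Th_derivative:
  assumes ok: "\<And>k. k < n \<Longrightarrow> ok k" and al: "allowed a c"
  shows "((\<lambda>s. Th n (\<lambda>u v. Y u v + s * (\<kappa> * dY a c Y u v))) has_field_derivative 0) (at 0)"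
proof -
  define P where "P p i = Y (fst (entry n p i)) (snd (entry n p i))" for p i
  define Q where "Q p i = dY a c Y (fst (entry n p i)) (snd (entry n p i))" for p i
  have "((\<lambda>s. Th n (\<lambda>u v. Y u v + s * (\<kappa> * dY a c Y u v))) has_field_derivative
      pcoef n * (\<Sum>p | p permutes {..<psize n}. of_int (sign p) *
         (\<Sum>i<n. (\<kappa> * Q p i) * (\<Prod>j\<in>{..<n} - {i}. P p j)))) (at 0)"
    unfolding Th_def P_def[symmetric] Q_def[symmetric]
    by (intro DERIV_cmult DERIV_sum prod_line_derivative) auto
  moreover have "(\<Sum>p | p permutes {..<psize n}. of_int (sign p) *
         (\<Sum>i<n. (\<kappa> * Q p i) * (\<Prod>j\<in>{..<n} - {i}. P p j)))
     = \<kappa> * (\<Sum>p | p permutes {..<psize n}. of_int (sign p) *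
         (\<Sum>i<n. Q p i * (\<Prod>j\<in>{..<n} - {i}. P p j)))"
    by (simp add: sum_distrib_left algebra_simps)
  moreover have "(\<Sum>p | p permutes {..<psize n}. of_int (sign p) *
         (\<Sum>i<n. Q p i * (\<Prod>j\<in>{..<n} - {i}. P p j))) = 0"
  proof (cases "tA \<or> tC")
    case True
    define M where "M i j = Y (ci i) (cj (n - 1 - j))" for i j
    define Q1 where "Q1 p i = (if ci i = a then Y c (cj (n - 1 - p i)) else 0)" for p i
    define Q2 where "Q2 p i = (if cj (n - 1 - p i) = a then Y (ci i) c else 0)" for p i
    have PM: "P p i = M i (p i)" for p i using True by (simp add: P_def M_def entry_def)
    have QQ: "Q p i = Q1 p i + Q2 p i" for p i using True by (simp add: Q_def Q1_def Q2_def dY_def entry_def)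
    have 1: "(\<Sum>p | p permutes {..<n}. of_int (sign p) * (\<Sum>i<n. Q1 p i * (\<Prod>j\<in>{..<n} - {i}. M j (p j)))) = 0"
    proof (cases "\<exists>i0<n. a = ci i0")
      case False
      then have "Q1 p i = 0" if "i < n" for p i using that by (auto simp: Q1_def)
      then show ?thesis by simp
    next
      case T: True
      then obtain i0 where i0: "i0 < n" "a = ci i0" by auto
      then obtain i1 where i1: "i1 < i0" "c = ci i1" using allowed_ci[of i0 c] al True ok by auto
      have "Q1 p i = (if i = i0 then M i1 (p i) else 0)" if "i < n" for p i
        using that i0 i1 ci_inj[of i i0] ok by (auto simp: Q1_def M_def)
      then have "(\<Sum>p | p permutes {..<n}. of_int (sign p) * (\<Sum>i<n. Q1 p i * (\<Prod>j\<in>{..<n} - {i}. M j (p j))))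
         = (\<Sum>p | p permutes {..<n}. of_int (sign p) *
           (\<Sum>i<n. (if i = i0 then M i1 (p i) else 0) * (\<Prod>j\<in>{..<n} - {i}. M j (p j))))" by simp
      also have "\<dots> = 0" by (rule det_row_zero) (use i0 i1 in auto)
      finally show ?thesis .
    qed
    have 2: "(\<Sum>p | p permutes {..<n}. of_int (sign p) * (\<Sum>i<n. Q2 p i * (\<Prod>j\<in>{..<n} - {i}. M j (p j)))) = 0"
    proof (cases "\<exists>i0<n. a = cj i0")
      case False
      have "Q2 p i = 0" if "i < n" for p i
      proof -
        have "n - 1 - p i < n" using that by auto
        then show ?thesis using False by (auto simp: Q2_def)
      qed
      then show ?thesis by simp
    next
      case T: True
      then obtain i0 where i0: "i0 < n" "a = cj i0" by auto
      then obtain i1 where i1: "i1 < i0" "c = cj i1" using allowed_cj[of i0 c] al True ok by auto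
      \<comment> \<open>Columns run backwards, so the index \<open>cj i0\<close> heads column n - 1
        - i0.\<close>
      have "Q2 p i = (if p i = n - 1 - i0 then M i (n - 1 - i1) else 0)" if "i < n" "p permutes {..<n}" for p i
      proof -
        have "p i < n" using that permutes_in_image[OF that(2), of i] by auto
        then show ?thesis
          using that i0 i1 cj_inj[of "n - 1 - p i" i0] ok by (auto simp: Q2_def M_def)
      qed
      then have "(\<Sum>p | p permutes {..<n}. of_int (sign p) * (\<Sum>i<n. Q2 p i * (\<Prod>j\<in>{..<n} - {i}. M j (p j))))
         = (\<Sum>p | p permutes {..<n}. of_int (sign p) *
           (\<Sum>i<n. (if p i = n - 1 - i0 then M i (n - 1 - i1) else 0) * (\<Prod>j\<in>{..<n} - {i}. M j (p j))))" by simp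
      also have "\<dots> = 0" by (rule det_col_zero) (use i0 i1 in auto)
      finally show ?thesis .
    qed
    have ps: "psize n = n" using True by (simp add: psize_def)
    show ?thesis unfolding ps QQ PM using 1 2 by (simp add: distrib_right distrib_left sum.distrib)
  next
    case False
    define M where "M i j = Y (lt i) (lt j)" for i j
    have PM: "P p i = M (p (2*i)) (p (2*i+1))" for p i using False by (simp add: P_def M_def entry_def)
    have ps: "psize n = 2 * n" using False by (simp add: psize_def)
    have QQ: "Q p i = (if lt (p (2*i)) = a then Y c (lt (p (2*i+1))) else 0) + (if lt (p (2*i+1)) = a then Y (lt (p (2*i))) c else 0)"
      for p i using False by (simp add: Q_def dY_def entry_def)
    have pn: "p (2*i) < 2*n" "p (2*i+1) < 2*n" if "i < n" "p permutes {..<2*n}" for p i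
      using permutes_in_image[OF that(2), of "2*i"] permutes_in_image[OF that(2), of "2*i+1"] that by auto
    show ?thesis
    proof (cases "\<exists>m0<2*n. a = lt m0")
      case F: False
      have "Q p i = 0" if "i < n" "p permutes {..<2*n}" for p i using pn[OF that] F by (auto simp: QQ)
      then show ?thesis unfolding ps by simp
    next
      case T: True
      then obtain m0 where m0: "m0 < 2*n" "a = lt m0" by auto
      then have o0: "ok (m0 div 2)" using ok by auto
      then obtain m1 where m1: "m1 < m0" "c = lt m1" using allowed_lt[of m0 c] al False m0 by auto
      have Q: "Q p i = (if p (2*i) = m0 then M m1 (p (2*i+1)) else 0) + (if p (2*i+1) = m0 then M (p (2*i)) m1 else 0)"
        if "i < n" "p permutes {..<2*n}" for p i
      proof -
        have "ok (p (2*i) div 2)" "ok (p (2*i+1) div 2)" using pn[OF that] ok by auto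
        then have "lt (p (2*i)) = a \<longleftrightarrow> p (2*i) = m0" "lt (p (2*i+1)) = a \<longleftrightarrow> p (2*i+1) = m0"
          using lt_inj[of "p (2*i)" m0] lt_inj[of "p (2*i+1)" m0] o0 False m0 by auto
        then show ?thesis using m1 by (simp add: QQ M_def)
      qed
      have "(\<Sum>p | p permutes {..<2*n}. of_int (sign p) * (\<Sum>i<n. Q p i * (\<Prod>j\<in>{..<n} - {i}. P p j)))
         = (\<Sum>p | p permutes {..<2*n}. of_int (sign p) *
     (\<Sum>i<n. ((if p (2*i) = m0 then M m1 (p (2*i+1)) else 0) + (if p (2*i+1) = m0 then M (p (2*i)) m1 else 0))
        * (\<Prod>j\<in>{..<n} - {i}. M (p (2*j)) (p (2*j+1)))))"
        unfolding PM by (intro sum.cong refl arg_cong2[of _ _ _ _ "(*)"]) (use Q in auto)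
      also have "\<dots> = 0" by (rule pf_zero) (use m0 m1 in auto)
      finally show ?thesis unfolding ps .
    qed
  qed
  ultimately show ?thesis by simp
qed

lemma cgen_invariant:
  assumes ok: "\<And>k. k < n \<Longrightarrow> ok k"
  shows "invariant (nc (cgen t r n))"
  unfolding invariant_def
proof (intro conjI ballI allI)
  note c = cgen_props[where n=n, OF ok]
  show "nc (cgen t r n) \<in> FN GG" using c(1) Gc_GG by (rule FN_mono)
  fix h x assume h: "h \<in> GG"
  let ?\<gamma> = "\<lambda>s g. x g + s * xi h x g"
  have "((\<lambda>s. ?\<gamma> s g) has_field_derivative xi h x g) (at 0)" for g
    by (auto intro!: derivative_eq_intros)
  then have "((\<lambda>s. ev (nc (cgen t r n)) (?\<gamma> s)) has_field_derivative dev (nc (cgen t r n)) (?\<gamma> 0) (xi h x)) (at 0)"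
    by (intro ev_has_derivative[OF c(1)])
  moreover have "ev (nc (cgen t r n)) (?\<gamma> s) = Th n (\<lambda>u v. X x u v + s * X (xi h x) u v)" for s
  proof -
    have "X (?\<gamma> s) = (\<lambda>u v. X x u v + s * X (xi h x) u v)" using X_add[of x s "xi h x"] by (simp add: fun_eq_iff)
    then show ?thesis using c(3)[where x="?\<gamma> s"] by simp
  qed
  moreover have "((\<lambda>s. Th n (\<lambda>u v. X x u v + s * X (xi h x) u v)) has_field_derivative 0) (at 0)"
  proof (cases "\<exists>k l. h = D k l \<and> (l \<in> Up \<or> tA \<and> k \<in> Lo)")
    case False
    then have "X (xi h x) u v = 0" for u v using X_xi_0[OF h] by blast
    then show ?thesis by simp
  next
    case True
    then obtain k l where kl: "h = D k l" "l \<in> Up \<or> tA \<and> k \<in> Lo" by blast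
    have g: "gt k l" "0 < k" "0 < l" using h kl by (auto simp: GG_iff)
    show ?thesis
    proof (cases "l \<in> Up")
      case True
      then have "allowed l k" using g Up_up by (auto simp: allowed_def)
      from Th_derivative[where n=n, OF ok this, of "X x" "-1"] show ?thesis
        using X_xi_Up[OF True g(1,2)] by (simp add: kl)
    next
      case False
      then have "tA" "k \<in> Lo" using kl by auto
      then have "allowed k l" using g Lo_down by (auto simp: allowed_def)
      from Th_derivative[where n=n, OF ok this, of "X x" "1"] show ?thesis
        using X_xi_Lo[OF \<open>tA\<close> \<open>k \<in> Lo\<close> g(1,3)] by (simp add: kl)
    qed
  qed
  ultimately have "dev (nc (cgen t r n)) (?\<gamma> 0) (xi h x) = 0" by (simp add: DERIV_unique)
  then show "dev (nc (cgen t r n)) x (xi h x) = 0" by simp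
qed

text \<open>All entries lie in the abelian ideal spanned by \<open>Gc\<close>, so invariance gives
  centrality without correction terms.\<close>

lemma cgen_central:
  assumes ok: "\<And>k. k < n \<Longrightarrow> ok k"
  shows "central (nc (cgen t r n))"
  using cgen_invariant[where n=n, OF ok] cgen_props(1,2)[where n=n, OF ok]
  by (intro invariant_central[OF Gc_GG, where d=n]) (auto simp: Gc_ideal Gc_commute invariant_def)

definition clean :: "nat set \<Rightarrow> nat \<Rightarrow> (nat \<Rightarrow> nat \<Rightarrow> complex) \<Rightarrow> bool" where
  "clean A k Y \<longleftrightarrow> (\<forall>v\<in>A. (v \<noteq> cj k \<longrightarrow> Y (ci k) v = 0) \<and> (v \<noteq> ci k \<longrightarrow> Y (cj k) v = 0))"

text \<open>On the cascade letters such a form pairs each \<open>ci k\<close> with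
  \<open>cj k\<close> only. One permutation survives in the determinant; in the Pfaffian all
  pair-preserving permutations contribute the same product.\<close>

lemma Th_slice:
  assumes ok: "\<And>k. k < n \<Longrightarrow> ok k"
  shows "\<exists>N. N \<noteq> 0 \<and> (\<forall>Y. form Y \<longrightarrow> (\<forall>k<n. clean (cs n) k Y) \<longrightarrow> Th n Y = N * (\<Prod>k<n. Y (ci k) (cj k)))"
proof (cases "tA \<or> tC")
  case True
  let ?N = "of_int (sign (\<lambda>i. if i < n then n - 1 - i else i)) :: complex"
  have "Th n Y = ?N * (\<Prod>k<n. Y (ci k) (cj k))" if Y: "form Y" "\<forall>k<n. clean (cs n) k Y" for Y
  proof -
    have "Y (ci i) (cj j) = 0" if "i < n" "j < n" "i \<noteq> j" for i j
      using Y(2) that cj_in[of j n] cj_inj[of i j] ok by (auto simp: clean_def)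
    from det_slice[of n "\<lambda>i j. Y (ci i) (cj j)", OF this] show ?thesis
      using True by (simp add: Th_def pcoef_def psize_def entry_def)
  qed
  moreover have "?N \<noteq> 0" by (simp add: sign_def)
  ultimately show ?thesis by blast
next
  case False
  obtain N :: complex where N: "N \<noteq> 0"
    "\<And>A. (\<And>a b. A b a = - A a b) \<Longrightarrow>
       (\<And>a b. a < 2*n \<Longrightarrow> b < 2*n \<Longrightarrow> a div 2 \<noteq> b div 2 \<Longrightarrow> A a b = 0) \<Longrightarrow>
      (\<Sum>p | p permutes {..<2*n}. of_int (sign p) * (\<Prod>i<n. A (p (2*i)) (p (2*i+1))))
        = N * (\<Prod>k<n. A (2*k) (2*k+1))"
    by (rule pf_slice[of n]) blast
  have "Th n Y = pcoef n * N * (\<Prod>k<n. Y (ci k) (cj k))" if Y: "form Y" "\<forall>k<n. clean (cs n) k Y" for Y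
  proof -
    have 1: "Y (lt b) (lt a) = - Y (lt a) (lt b)" for a b
      using form_sym[OF Y(1), of "lt b" "lt a"] False by (simp add: eps_def)
    have 2: "Y (lt a) (lt b) = 0" if "a < 2*n" "b < 2*n" "a div 2 \<noteq> b div 2" for a b
    proof -
      have k: "a div 2 < n" "b div 2 < n" using that by auto
      then have "lt b \<in> cs n" using ok ci_in cj_in by (auto simp: lt_def)
      moreover have "lt b \<noteq> ci (a div 2)" "lt b \<noteq> cj (a div 2)"
        using ci_inj[of "b div 2" "a div 2"] cj_inj[of "b div 2" "a div 2"] ci_cj[of "b div 2" "a div 2"]
          ci_cj[of "a div 2" "b div 2"] ok k that False by (auto simp: lt_def)
      ultimately show ?thesis using Y(2) k by (auto simp: clean_def lt_def[of a])
    qed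
    show ?thesis using N(2)[of "\<lambda>a b. Y (lt a) (lt b)", OF 1 2] False
      by (simp add: Th_def psize_def entry_def lt_def)
  qed
  moreover have "pcoef n * N \<noteq> 0" using N(1) False by (simp add: pcoef_def)
  ultimately show ?thesis by blast
qed

end

section \<open>Elimination\<close>

context nilrad
begin

inductive mv :: "(nat \<Rightarrow> nat \<Rightarrow> complex) \<Rightarrow> (nat \<Rightarrow> nat \<Rightarrow> complex) \<Rightarrow> bool" for Y where
  mv_refl: "mv Y Y"
| mv_step: "mv Y Y' \<Longrightarrow> allowed a c \<Longrightarrow> mv Y (flow a c s Y')"

lemma mv_trans: assumes "mv Y Y'" "mv Y' Y''" shows "mv Y Y''"
  using assms(2,1) by (induction rule: mv.induct) (auto intro: mv_step)

lemma mv_form: "mv Y Y' \<Longrightarrow> form Y \<Longrightarrow> form Y'"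
  by (induction rule: mv.induct) (auto intro: form_flow)

lemma mv_invariant:
  assumes "mv Y Y'" "form Y" "z \<in> FN Gc" "invariant z" shows "ev z (gx Y') = ev z (gx Y)"
  using assms by (induction rule: mv.induct) (auto simp: flow_invariant mv_form)

lemma mv_Th:
  assumes ok: "\<And>k. k < n \<Longrightarrow> ok k" and mv: "mv Y Y'" "form Y" shows "Th n Y' = Th n Y"
  using mv_invariant[OF mv cgen_props(1)[where n=n, OF ok] cgen_invariant[where n=n, OF ok]]
    cgen_props(3)[where n=n, OF ok] X_gx[OF mv(2)] X_gx[OF mv_form[OF mv]] by simp

lemma clear_step:
  assumes v: "allowed v j" and ij: "Y i j \<noteq> 0" "i \<noteq> v"
  shows "\<exists>Y' s. mv Y Y' \<and> Y' i v = 0 \<and> (\<forall>u w. u \<noteq> v \<longrightarrow> w \<noteq> v \<longrightarrow> Y' u w = Y u w) \<and>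
    (\<forall>u. u \<noteq> v \<longrightarrow> Y' u v = Y u v + s * Y u j)"
proof (intro exI conjI)
  let ?s = "- Y i v / Y i j"
  let ?Y = "flow v j ?s Y"
  show "mv Y ?Y" using v by (intro mv_step mv_refl)
  show "?Y i v = 0" using ij by (simp add: flow_def dY_def)
  show "\<forall>u w. u \<noteq> v \<longrightarrow> w \<noteq> v \<longrightarrow> ?Y u w = Y u w" by (simp add: flow_def dY_def)
  show "\<forall>u. u \<noteq> v \<longrightarrow> ?Y u v = Y u v + ?s * Y u j" by (simp add: flow_def dY_def)
qed

text \<open>Row \<open>ci k\<close> is cleared with the pivot in column \<open>cj k\<close>, then
  row \<open>cj k\<close> with the transposed pivot. The second move spares row \<open>ci k\<close>
  because its diagonal entry vanishes outside type C; in type C the two rows coincide.\<close>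

lemma clear_letter:
  assumes Y: "form Y" "ok k" "\<And>l. l < k \<Longrightarrow> clean A l Y" "Y (ci k) (cj k) \<noteq> 0"
    and A: "v \<in> A" "cs (Suc k) \<subseteq> A" and v: "v \<notin> cs (Suc k)" "0 < v"
  shows "\<exists>Y'. mv Y Y' \<and> (\<forall>l<k. clean A l Y') \<and> Y' (ci k) v = 0 \<and> Y' (cj k) v = 0 \<and>
    (\<forall>w. w \<noteq> v \<longrightarrow> Y' (ci k) w = Y (ci k) w \<and> Y' (cj k) w = Y (cj k) w)"
proof -
  have vk: "v \<noteq> ci k" "v \<noteq> cj k" "v \<in> R k" using v ok_ci(3)[OF Y(2)] by (auto simp: R_def)
  have ijA: "ci k \<in> A" "cj k \<in> A" using A ok_ci(3)[OF Y(2)] by auto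
  have vl: "v \<noteq> ci l" "v \<noteq> cj l" if "l < k" for l
    using v that ci_in[of l "Suc k"] cj_in[of l "Suc k"] ok_down[OF Y(2), of l] by auto
  \<comment> \<open>The column that is added belongs to a letter of step k, where the clean rows of
    earlier steps already vanish, so these rows do not change.\<close>
  have preserve: "clean A l Y'"
    if "l < k" "clean A l Y0" "j = ci k \<or> j = cj k"
      "\<forall>u w. u \<noteq> v \<longrightarrow> w \<noteq> v \<longrightarrow> Y' u w = Y0 u w" "\<forall>u. u \<noteq> v \<longrightarrow> Y' u v = Y0 u v + s * Y0 u j"
    for l Y0 Y' j s
  proof -
    have "j \<in> A" "j \<noteq> ci l" "j \<noteq> cj l" using that ijA later_ne[OF Y(2), of l] by auto
    then have "Y0 (ci l) j = 0" "Y0 (cj l) j = 0" "Y0 (ci l) v = 0" "Y0 (cj l) v = 0"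
      using that(2) vl[OF that(1)] A by (auto simp: clean_def)
    then have "Y' (ci l) v = 0" "Y' (cj l) v = 0" using that(5) vl[OF that(1)] by simp_all
    moreover have "Y' (ci l) w = Y0 (ci l) w" "Y' (cj l) w = Y0 (cj l) w" if "w \<noteq> v" for w
      using \<open>\<forall>u w. u \<noteq> v \<longrightarrow> w \<noteq> v \<longrightarrow> Y' u w = Y0 u w\<close> that vl[OF \<open>l < k\<close>] by simp_all
    ultimately show ?thesis using that(2) unfolding clean_def by (metis (no_types))
  qed
  have "\<exists>Y1. mv Y Y1 \<and> (\<forall>l<k. clean A l Y1) \<and> Y1 (ci k) v = 0 \<and>
      (\<forall>w. w \<noteq> v \<longrightarrow> Y1 (ci k) w = Y (ci k) w \<and> Y1 (cj k) w = Y (cj k) w)"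
  proof (cases "Y (ci k) v = 0")
    case True
    then show ?thesis using Y(3) mv_refl[of Y] by blast
  next
    case False
    then have "pairok (ci k) v" using form_0[OF Y(1)] by blast
    \<comment> \<open>A nonzero entry puts \<open>v\<close> in \<open>Up\<close>, or in
      \<open>Lo\<close> for type A, and \<open>v\<close> is still left after step k; hence
      \<open>cj k\<close> may be added to it.\<close>
    then have "allowed v (cj k)"
      using vk ok_ci(5)[OF Y(2)] ok_ci(7)[OF Y(2)] ci_Up[OF Y(2)] cj_Up[OF Y(2)] cj_Lo[OF Y(2)] Up_Lo_disjoint
      by (auto simp: pairok_def allowed_def split: if_splits)
    from clear_step[of v "cj k" Y "ci k", OF this Y(4) vk(1)[symmetric]] obtain Y1 s where
      Y1: "mv Y Y1" "Y1 (ci k) v = 0" "\<forall>u w. u \<noteq> v \<longrightarrow> w \<noteq> v \<longrightarrow> Y1 u w = Y u w"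
       "\<forall>u. u \<noteq> v \<longrightarrow> Y1 u v = Y u v + s * Y u (cj k)" by blast
    have "\<forall>l<k. clean A l Y1" using preserve[OF _ Y(3) _ Y1(3,4)] by blast
    then show ?thesis using Y1 vk by (intro exI[of _ Y1]) auto
  qed
  then obtain Y1 where Y1: "mv Y Y1" "\<And>l. l < k \<Longrightarrow> clean A l Y1" "Y1 (ci k) v = 0"
      "\<And>w. w \<noteq> v \<Longrightarrow> Y1 (ci k) w = Y (ci k) w \<and> Y1 (cj k) w = Y (cj k) w" by blast
  have fY1: "form Y1" using mv_form[OF Y1(1) Y(1)] .
  show ?thesis
  proof (cases "Y1 (cj k) v = 0")
    case True
    then show ?thesis using Y1 by blast
  next
    case False
    then have "cj k \<noteq> ci k" using Y1(3) by auto
    then have nC: "\<not> tC" using ok_ci(6)[OF Y(2)] by blast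
    have "pairok (cj k) v" using False form_0[OF fY1] by blast
    then have "allowed v (ci k)"
      using vk ok_ci(4)[OF Y(2)] ci_Up[OF Y(2)] cj_Up[OF Y(2)] cj_Lo[OF Y(2)] Up_Lo_disjoint
      by (auto simp: pairok_def allowed_def split: if_splits)
    moreover have "Y1 (cj k) (ci k) \<noteq> 0"
      using form_sym[OF Y(1), of "cj k" "ci k"] Y1(4)[of "ci k"] Y(4) vk(1) eps_nz by auto
    ultimately obtain Y2 s where
      Y2: "mv Y1 Y2" "Y2 (cj k) v = 0" "\<forall>u w. u \<noteq> v \<longrightarrow> w \<noteq> v \<longrightarrow> Y2 u w = Y1 u w"
       "\<forall>u. u \<noteq> v \<longrightarrow> Y2 u v = Y1 u v + s * Y1 u (ci k)"
      using clear_step[of v "ci k" Y1 "cj k"] vk(2) by blast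
    have "Y2 (ci k) v = 0" using Y2(4)[rule_format, of "ci k"] Y1(3) form_diag[OF fY1 nC] vk by simp
    moreover have "\<forall>l<k. clean A l Y2" using preserve[OF _ Y1(2) _ Y2(3,4)] by blast
    ultimately show ?thesis using Y1 Y2 vk mv_trans[OF Y1(1) Y2(1)] by (intro exI[of _ Y2]) auto
  qed
qed

lemma clear_letters:
  assumes "finite F" "F \<subseteq> A - cs (Suc k)" "\<And>v. v \<in> F \<Longrightarrow> 0 < v"
    and Y: "form Y" "ok k" "\<And>l. l < k \<Longrightarrow> clean A l Y" "Y (ci k) (cj k) \<noteq> 0" and A: "cs (Suc k) \<subseteq> A"
  shows "\<exists>Y'. mv Y Y' \<and> (\<forall>l<k. clean A l Y') \<and> Y' (ci k) (cj k) \<noteq> 0 \<and>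
    (\<forall>v\<in>F. Y' (ci k) v = 0 \<and> Y' (cj k) v = 0)"
  using assms(1-3)
proof (induction F rule: finite_induct)
  case empty
  then show ?case using Y mv_refl[of Y] by blast
next
  case (insert v F)
  then obtain Y1 where Y1: "mv Y Y1" "\<forall>l<k. clean A l Y1" "Y1 (ci k) (cj k) \<noteq> 0"
    "\<forall>v\<in>F. Y1 (ci k) v = 0 \<and> Y1 (cj k) v = 0" by auto
  have f1: "form Y1" by (rule mv_form[OF Y1(1) Y(1)])
  obtain Y2 where Y2: "mv Y1 Y2" "\<forall>l<k. clean A l Y2" "Y2 (ci k) v = 0" "Y2 (cj k) v = 0"
    "\<forall>w. w \<noteq> v \<longrightarrow> Y2 (ci k) w = Y1 (ci k) w \<and> Y2 (cj k) w = Y1 (cj k) w"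
    using clear_letter[OF f1 Y(2) _ Y1(3), of A v] Y1(2) insert.prems A by auto
  have "v \<noteq> cj k" using insert.prems ok_ci(3)[OF Y(2)] by auto
  moreover have "v \<notin> F" by fact
  ultimately show ?case using Y1 Y2 mv_trans[OF Y1(1) Y2(1)] by (intro exI[of _ Y2]) auto
qed

text \<open>Against letters chosen up to step n the new rows are clean without any move: the earlier
  rows vanish there, symmetry of the form carries this over, and the diagonal vanishes outside type
  C.\<close>

lemma clean_last:
  assumes Y: "form Y" "ok n" "\<And>k. k < n \<Longrightarrow> clean A k Y" and A: "cs (Suc n) \<subseteq> A" and v: "v \<in> cs (Suc n)"
  shows "v \<noteq> cj n \<Longrightarrow> Y (ci n) v = 0" "v \<noteq> ci n \<Longrightarrow> Y (cj n) v = 0"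
proof -
  have ijA: "ci n \<in> A" "cj n \<in> A" using A ok_ci(3)[OF Y(2)] by auto
  have "v \<in> cs n \<or> v = ci n \<or> v = cj n" using v ok_ci(3)[OF Y(2)] by auto
  then consider (a) k where "k < n" "v = ci k \<or> v = cj k" | (b) "v = ci n" | (c) "v = cj n"
    using cs_cases[OF Y(2), of v] by auto
  then have "(v \<noteq> cj n \<longrightarrow> Y (ci n) v = 0) \<and> (v \<noteq> ci n \<longrightarrow> Y (cj n) v = 0)"
  proof cases
    case a
    then have "Y v (ci n) = 0 \<and> Y v (cj n) = 0"
      using Y(3)[OF a(1)] ijA later_ne[OF Y(2) a(1)] by (auto simp: clean_def)
    then show ?thesis using form_sym[OF Y(1), of "ci n" v] form_sym[OF Y(1), of "cj n" v] by simp
  next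
    case b
    then show ?thesis using form_diag[OF Y(1)] ok_ci(6)[OF Y(2)] by auto
  next
    case c
    then show ?thesis using form_diag[OF Y(1)] ok_ci(6)[OF Y(2)] by auto
  qed
  then show "v \<noteq> cj n \<Longrightarrow> Y (ci n) v = 0" "v \<noteq> ci n \<Longrightarrow> Y (cj n) v = 0" by auto
qed

lemma clean_mono: "clean A k Y \<Longrightarrow> A' \<subseteq> A \<Longrightarrow> clean A' k Y"
  by (auto simp: clean_def)

text \<open>The pivot of step m is nonzero because the generator of index m + 1 is a constant times
  the product of the pivots up to step m, and moves do not change the generators.\<close>

lemma eliminate:
  assumes A: "finite A" "cs n \<subseteq> A" "\<And>v. v \<in> A \<Longrightarrow> 0 < v"
    and ok: "\<And>k. k < n \<Longrightarrow> ok k" and Y: "form Y" "\<And>q. q \<le> n \<Longrightarrow> Th q Y \<noteq> 0"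
  shows "\<exists>Y'. mv Y Y' \<and> (\<forall>k<n. clean A k Y')"
proof -
  have "\<exists>Y'. mv Y Y' \<and> (\<forall>k<m. clean A k Y')" if "m \<le> n" for m
    using that
  proof (induction m)
    case 0
    then show ?case using mv_refl[of Y] by blast
  next
    case (Suc m)
    then obtain Y1 where Y1: "mv Y Y1" "\<And>k. k < m \<Longrightarrow> clean A k Y1" by auto
    have f1: "form Y1" by (rule mv_form[OF Y1(1) Y(1)])
    have okm: "ok m" "\<And>k. k < Suc m \<Longrightarrow> ok k" using Suc.prems ok by auto
    have csA: "cs (Suc m) \<subseteq> A" using A(2) cs_mono[OF Suc.prems] by auto
    have cl: "clean (cs (Suc m)) k Y1" if "k < Suc m" for k
    proof (cases "k = m")
      case True
      then show ?thesis using clean_last[OF f1 okm(1) Y1(2) csA] by (auto simp: clean_def)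
    next
      case False
      then show ?thesis using Y1(2)[of k] that csA clean_mono by auto
    qed
    obtain N where N: "N \<noteq> 0" "Th (Suc m) Y1 = N * (\<Prod>k<Suc m. Y1 (ci k) (cj k))"
      using Th_slice[of "Suc m", OF okm(2)] f1 cl by blast
    have "Th (Suc m) Y1 \<noteq> 0" using mv_Th[of "Suc m", OF okm(2) Y1(1) Y(1)] Y(2)[OF Suc.prems] by simp
    then have piv: "Y1 (ci m) (cj m) \<noteq> 0" using N by auto
    obtain Y2 where Y2: "mv Y1 Y2" "\<forall>l<m. clean A l Y2"
      "\<forall>v\<in>A - cs (Suc m). Y2 (ci m) v = 0 \<and> Y2 (cj m) v = 0"
      using clear_letters[of "A - cs (Suc m)" A m Y1] A f1 okm(1) Y1(2) piv csA by auto
    have f2: "form Y2" by (rule mv_form[OF Y2(1) f1])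
    have "clean A m Y2"
      unfolding clean_def using Y2(3) clean_last[OF f2 okm(1) _ csA] Y2(2) by blast
    then have "\<forall>k<Suc m. clean A k Y2" using Y2(2) by (auto simp: less_Suc_eq)
    then show ?case using mv_trans[OF Y1(1) Y2(1)] by blast
  qed
  then show ?thesis by blast
qed

section \<open>The slice\<close>

definition ee :: "nat \<Rightarrow> nat \<Rightarrow> complex" where "ee m a = (if a = m then 1 else 0)"

text \<open>Rank-two form u v^T + eps v u^T. For u = v in type C it is twice a square, which is why
  the pivots carry the factor \<open>bc\<close>.\<close>

definition PP :: "(nat \<Rightarrow> complex) \<Rightarrow> (nat \<Rightarrow> complex) \<Rightarrow> nat \<Rightarrow> nat \<Rightarrow> complex" where
  "PP u v a b = u a * v b + eps * v a * u b"

text \<open>Normal form of the elimination, scaled so that the coordinate at the cascade root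
  \<open>beta k\<close> is \<open>d k\<close>.\<close>

definition SL :: "nat \<Rightarrow> (nat \<Rightarrow> complex) \<Rightarrow> nat \<Rightarrow> nat \<Rightarrow> complex" where
  "SL n d a b = (\<Sum>k<n. d k * PP (ee (ci k)) (ee (cj k)) a b)"

definition beta :: "nat \<Rightarrow> gen" where
  "beta k = (if tA then D (ci k) (cj k) else if tC then L (ci k) else S (ci k) (cj k))"

definition bc :: complex where "bc = (if tC then 2 else 1)"

lemma PP_sym: "PP u v b a = eps * PP u v a b"
  by (simp add: PP_def algebra_simps)

lemma PP_form: assumes "pairok a b" shows "form (PP (ee a) (ee b))"
  unfolding form_def
proof (intro conjI allI impI)
  show "PP (ee a) (ee b) v u = eps * PP (ee a) (ee b) u v" for u v by (rule PP_sym)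
  show "PP (ee a) (ee b) u v = 0" if "\<not> pairok u v" for u v
    using that assms pairok_sym by (auto simp: PP_def ee_def)
qed

lemma beta_pairok: "ok k \<Longrightarrow> pairok (ci k) (cj k)"
  using ci_Up cj_Up cj_Lo by (auto simp: pairok_def)

lemma SL_form: assumes "\<And>k. k < n \<Longrightarrow> ok k" shows "form (SL n d)"
  unfolding form_def
proof (intro conjI allI impI)
  show "SL n d b a = eps * SL n d a b" for a b
    unfolding SL_def sum_distrib_left by (intro sum.cong) (auto simp: PP_sym[of _ _ b a])
  show "SL n d a b = 0" if "\<not> pairok a b" for a b
    unfolding SL_def using form_0[OF PP_form[OF beta_pairok] that] assms by (intro sum.neutral) auto
qed

lemma SL_ci:
  assumes ok: "\<And>k. k < n \<Longrightarrow> ok k" and k: "k < n"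
  shows "SL n d (ci k) b = (if b = cj k then bc * d k else 0)"
proof -
  have "PP (ee (ci l)) (ee (cj l)) (ci k) b = (if l = k \<and> b = cj k then bc else 0)" if "l < n" for l
    using that k ok ci_inj[of k l] ci_cj[of k l] ok_ci(6)[of k] types_exclusive
    by (auto simp: PP_def ee_def bc_def eps_def)
  then have "SL n d (ci k) b = (\<Sum>l<n. if l = k then (if b = cj k then bc * d k else 0) else 0)"
    unfolding SL_def by (intro sum.cong) auto
  then show ?thesis using k by simp
qed

lemma SL_cj:
  assumes ok: "\<And>k. k < n \<Longrightarrow> ok k" and k: "k < n"
  shows "SL n d (cj k) b = (if b = ci k then eps * bc * d k else 0)"
proof -
  have "PP (ee (ci l)) (ee (cj l)) (cj k) b = (if l = k \<and> b = ci k then eps * bc else 0)" if "l < n" for l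
    using that k ok cj_inj[of k l] ci_cj[of l k] ok_ci(6)[of k] types_exclusive
    by (auto simp: PP_def ee_def bc_def eps_def)
  then have "SL n d (cj k) b = (\<Sum>l<n. if l = k then (if b = ci k then eps * bc * d k else 0) else 0)"
    unfolding SL_def by (intro sum.cong) auto
  then show ?thesis using k by simp
qed

lemma SL_clean: assumes "\<And>k. k < n \<Longrightarrow> ok k" "k < n" shows "clean A k (SL n d)"
  using SL_ci[of n k d, OF assms] SL_cj[of n k d, OF assms] by (auto simp: clean_def)

lemma bc_nz: "bc \<noteq> 0" by (simp add: bc_def)

text \<open>The constant is uniform in the form and the pivots, so it can be named once as
  \<open>NN n\<close> and divided out.\<close>

lemma Th_clean:
  assumes ok: "\<And>k. k < n \<Longrightarrow> ok k"
  shows "\<exists>N. N \<noteq> 0 \<and> (\<forall>Y d. form Y \<longrightarrow> (\<forall>k<n. clean (cs n) k Y) \<longrightarrow> (\<forall>k<n. Y (ci k) (cj k) = bc * d k)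
     \<longrightarrow> Th n Y = N * (\<Prod>k<n. d k))"
proof -
  obtain N where N: "N \<noteq> 0" "\<forall>Y. form Y \<longrightarrow> (\<forall>k<n. clean (cs n) k Y) \<longrightarrow> Th n Y = N * (\<Prod>k<n. Y (ci k) (cj k))"
    using Th_slice[of n, OF ok] by blast
  have "Th n Y = N * bc ^ n * (\<Prod>k<n. d k)"
    if "form Y" "\<forall>k<n. clean (cs n) k Y" "\<forall>k<n. Y (ci k) (cj k) = bc * d k" for Y d
  proof -
    have "(\<Prod>k<n. Y (ci k) (cj k)) = (\<Prod>k<n. bc * d k)" using that(3) by (intro prod.cong) auto
    also have "\<dots> = bc ^ n * (\<Prod>k<n. d k)" by (simp add: prod.distrib)
    finally show ?thesis using N(2) that by simp
  qed
  moreover have "N * bc ^ n \<noteq> 0" using N bc_nz by simp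
  ultimately show ?thesis by blast
qed

definition NN :: "nat \<Rightarrow> complex" where
  "NN n = (SOME N. N \<noteq> 0 \<and> (\<forall>Y d. form Y \<longrightarrow> (\<forall>k<n. clean (cs n) k Y) \<longrightarrow> (\<forall>k<n. Y (ci k) (cj k) = bc * d k)
     \<longrightarrow> Th n Y = N * (\<Prod>k<n. d k)))"

lemma NN:
  assumes ok: "\<And>k. k < n \<Longrightarrow> ok k"
  shows "NN n \<noteq> 0" "form Y \<Longrightarrow> (\<And>k. k < n \<Longrightarrow> clean (cs n) k Y) \<Longrightarrow> (\<And>k. k < n \<Longrightarrow> Y (ci k) (cj k) = bc * d k)
     \<Longrightarrow> Th n Y = NN n * (\<Prod>k<n. d k)"
  using someI_ex[OF Th_clean[of n, OF ok], folded NN_def] by blast+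

lemma Th_SL:
  assumes ok: "\<And>k. k < n \<Longrightarrow> ok k" and q: "q \<le> n"
  shows "Th q (SL n d) = NN q * (\<Prod>k<q. d k)"
proof (rule NN(2))
  show "form (SL n d)" by (rule SL_form[OF ok])
  show "ok k" if "k < q" for k using that q ok by auto
  show "clean (cs q) k (SL n d)" if "k < q" for k using SL_clean[of n k, OF ok] that q by auto
  show "SL n d (ci k) (cj k) = bc * d k" if "k < q" for k using SL_ci[of n k, OF ok] that q by auto
qed


section \<open>Evaluation on the slice\<close>

fun gpair :: "gen \<Rightarrow> nat \<times> nat" where
  "gpair (D a b) = (a, b)" | "gpair (S a b) = (a, b)" | "gpair (L a) = (a, a)" | "gpair (H a) = (a, a)"

lemma gpair_Gc:
  assumes "g \<in> Gc" "gpair g = (a, b)" shows "pairok a b" "tC \<or> a \<noteq> b" "0 < a" "0 < b"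
  using assms Up_Lo_disjoint Up_pos Lo_pos types_exclusive by (cases g; auto simp: Gc_iff pairok_def)+

lemma gx_eq: "gpair g = (a, b) \<Longrightarrow> Y a b = Y' a b \<Longrightarrow> gx Y g = gx Y' g"
  by (cases g) (auto simp: gx_def)

lemma gx_add: "gx (\<lambda>a b. Y a b + c * Y' a b) g = gx Y g + c * gx Y' g"
  by (cases g) (auto simp: gx_def add_divide_distrib)

lemma gx_beta: "ok k \<Longrightarrow> gx Y (beta k) = Y (ci k) (cj k) / bc"
  using ok_ci(6)[of k] types_exclusive by (auto simp: beta_def gx_def bc_def)

lemma beta_inj: "ok k \<Longrightarrow> ok l \<Longrightarrow> beta k = beta l \<Longrightarrow> k = l"
  using ci_inj[of k l] by (auto simp: beta_def split: if_splits)

text \<open>One index in the cascade is enough: the clean row through it, or by symmetry the clean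
  column, determines the entry.\<close>

lemma gx_clean:
  assumes ok: "\<And>k. k < n \<Longrightarrow> ok k" and Y: "form Y" "\<And>k. k < n \<Longrightarrow> clean A k Y"
    and g: "gpair g = (a, b)" "a \<in> A" "b \<in> A" "a \<in> cs n \<or> b \<in> cs n"
  shows "gx Y g = gx (SL n (\<lambda>k. gx Y (beta k))) g"
proof (rule gx_eq[OF g(1)])
  let ?d = "\<lambda>k. gx Y (beta k)"
  have d: "Y (ci k) (cj k) = bc * ?d k" if "k < n" for k using gx_beta[OF ok[OF that]] bc_nz by simp
  have *: "Y a b = SL n ?d a b" if ab: "a \<in> cs n" "b \<in> A" for a b
  proof -
    obtain k where k: "k < n" "a = ci k \<or> a = cj k" using ab cs_eq[of n, OF ok] by auto
    have "Y (ci k) b = SL n ?d (ci k) b"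
      using SL_ci[of n k, OF ok k(1)] d[OF k(1)] Y(2)[OF k(1)] ab by (auto simp: clean_def)
    moreover have "Y (cj k) b = SL n ?d (cj k) b"
      using SL_cj[of n k, OF ok k(1)] d[OF k(1)] Y(2)[OF k(1)] ab form_sym[OF Y(1), of "cj k" "ci k"] by (auto simp: clean_def)
    ultimately show ?thesis using k by auto
  qed
  show "Y a b = SL n ?d a b"
    using g(2-4) *[of a b] *[of b a] form_sym[OF Y(1), of a b] form_sym[OF SL_form[of n, OF ok], of ?d a b] by auto
qed

lemma gx_SL:
  assumes ok: "\<And>k. k < n \<Longrightarrow> ok k" and g: "g \<in> Gc"
  shows "k < n \<Longrightarrow> g = beta k \<Longrightarrow> gx (SL n d) g = d k"
    "g \<notin> beta ` {..<n} \<Longrightarrow> gx (SL n d) g = 0"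
proof -
  show "gx (SL n d) g = d k" if "k < n" "g = beta k"
    using that gx_beta[OF ok[OF that(1)]] SL_ci[of n k, OF ok that(1)] bc_nz by simp
  assume nb: "g \<notin> beta ` {..<n}"
  obtain a b where ab: "gpair g = (a, b)" by (cases "gpair g")
  have "PP (ee (ci k)) (ee (cj k)) a b = 0" if k: "k < n" for k
  proof -
    have nk: "g \<noteq> beta k" using nb k by auto
    note o = ok[OF k]
    have 1: "\<not> (a = ci k \<and> b = cj k)"
      using nk g ab types_exclusive ok_ci(6)[OF o] by (cases tA; cases tC; cases g) (auto simp: beta_def Gc_iff)
    have 2: "\<not> (a = cj k \<and> b = ci k)"
    proof
      assume e: "a = cj k \<and> b = ci k"
      show False
      proof (cases tC)
        case True
        then show False using 1 e ok_ci(6)[OF o] by auto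
      next
        case nC: False
        then have ne: "cj k \<noteq> ci k" using ok_ci(6)[OF o] by auto
        then have "gt (ci k) (cj k)" using ok_ci(2,4)[OF o] by auto
        then show False using e g ab ne gt_asym cj_Lo[OF o] Up_Lo_disjoint by (cases g) (auto simp: Gc_iff)
      qed
    qed
    show ?thesis using 1 2 by (auto simp: PP_def ee_def)
  qed
  then have "SL n d a b = (\<lambda>a b. 0) a b" unfolding SL_def by (intro sum.neutral) auto
  then have "gx (SL n d) g = gx (\<lambda>a b. 0) g" by (rule gx_eq[OF ab])
  then show "gx (SL n d) g = 0" by (cases g) (auto simp: gx_def)
qed

text \<open>On the slice only words in the cascade generators survive, and such a word contributes
  the monomial of its pivots.\<close>

lemma slice_expand:
  assumes ok: "\<And>k. k < n \<Longrightarrow> ok k" and z: "z \<in> FN Gc" "hom e z"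
  shows "\<exists>A c. finite A \<and> (\<forall>m\<in>A. set_mset m \<subseteq> {..<n} \<and> size m = e) \<and>
    (\<forall>d. ev z (gx (SL n d)) = (\<Sum>m\<in>A. c m * (\<Prod>k\<in>#m. d k)))"
proof -
  define \<kappa> where "\<kappa> = inv_into {..<n} beta"
  define W where "W = {w. cf z w \<noteq> 0 \<and> set w \<subseteq> beta ` {..<n}}"
  define \<mu> where "\<mu> w = image_mset \<kappa> (mset w)" for w
  define c where "c m = (\<Sum>w | w \<in> W \<and> \<mu> w = m. cf z w)" for m
  have inj: "inj_on beta {..<n}" using ok beta_inj by (auto simp: inj_on_def)
  have \<kappa>: "\<kappa> (beta k) = k" if "k < n" for k using that inj by (simp add: \<kappa>_def)
  have fW: "finite W" using z(1) by (auto simp: W_def FN_iff)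
  have "ev z (gx (SL n d)) = (\<Sum>m\<in>\<mu> ` W. c m * (\<Prod>k\<in>#m. d k))" for d
  proof -
    have w: "(\<Prod>g\<leftarrow>w. gx (SL n d) g) = (if set w \<subseteq> beta ` {..<n} then \<Prod>k\<in>#\<mu> w. d k else 0)"
      if "set w \<subseteq> Gc" for w
      using that
    proof (induction w)
      case (Cons g w)
      show ?case
      proof (cases "g \<in> beta ` {..<n}")
        case True
        then obtain k where k: "k < n" "g = beta k" by auto
        then show ?thesis using Cons gx_SL(1)[of n g k d, OF ok] \<kappa> by (auto simp: \<mu>_def)
      next
        case False
        then show ?thesis using Cons gx_SL(2)[of n g d, OF ok] by auto
      qed
    qed (simp add: \<mu>_def)
    have "ev z (gx (SL n d)) = (\<Sum>w | cf z w \<noteq> 0. cf z w * (if set w \<subseteq> beta ` {..<n} then \<Prod>k\<in>#\<mu> w. d k else 0))"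
      unfolding ev_def pair_def by (intro sum.cong refl) (use w z(1) in \<open>auto simp: FN_iff\<close>)
    also have "\<dots> = (\<Sum>w\<in>W. cf z w * (\<Prod>k\<in>#\<mu> w. d k))"
      by (rule sum.mono_neutral_cong_right) (use z(1) in \<open>auto simp: W_def FN_iff\<close>)
    also have "\<dots> = (\<Sum>m\<in>\<mu> ` W. \<Sum>w | w \<in> W \<and> \<mu> w = m. cf z w * (\<Prod>k\<in>#\<mu> w. d k))"
      by (rule sum.image_gen[OF fW])
    also have "\<dots> = (\<Sum>m\<in>\<mu> ` W. c m * (\<Prod>k\<in>#m. d k))"
      unfolding c_def sum_distrib_right by (intro sum.cong) auto
    finally show ?thesis .
  qed
  moreover have "set_mset m \<subseteq> {..<n} \<and> size m = e" if "m \<in> \<mu> ` W" for m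
  proof -
    obtain w where w: "w \<in> W" "m = \<mu> w" using \<open>m \<in> \<mu> ` W\<close> by auto
    have "\<kappa> g < n" if "g \<in> set w" for g
    proof -
      obtain k where "k < n" "g = beta k" using w(1) \<open>g \<in> set w\<close> by (auto simp: W_def)
      then show ?thesis using \<kappa> by simp
    qed
    then show ?thesis using w z(2) by (auto simp: \<mu>_def W_def hom_def)
  qed
  ultimately show ?thesis using fW by (intro exI[of _ "\<mu> ` W"] exI[of _ c]) auto
qed

section \<open>Degeneration of a pivot\<close>

definition gs :: "nat \<Rightarrow> nat \<Rightarrow> complex \<Rightarrow> (nat \<Rightarrow> complex) \<Rightarrow> nat \<Rightarrow> complex" where
  "gs l c s u a = u a + (if a = l then s * u c else 0)"

text \<open>A congruence of a rank-two form acts on its two vectors by the unipotent matrix.\<close>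

lemma flow_PP: "l \<noteq> c \<Longrightarrow> flow l c s (PP u v) a b = PP (gs l c s u) (gs l c s v) a b"
  by (auto simp: flow_def dY_def PP_def gs_def algebra_simps power2_eq_square)

lemma flow_sum:
  "flow l c s (\<lambda>a b. \<Sum>k\<in>I. d k * Q k a b) a b = (\<Sum>k\<in>I. d k * flow l c s (Q k) a b)"
  by (simp add: flow_def dY_def sum_distrib_left sum.distrib algebra_simps)

lemma flow_SL:
  assumes "l \<noteq> c"
  shows "flow l c s (\<lambda>a b. \<Sum>k\<in>I. d k * PP (u k) (v k) a b)
    = (\<lambda>a b. \<Sum>k\<in>I. d k * PP (gs l c s (u k)) (gs l c s (v k)) a b)"
  using flow_sum[where l=l and c=c and s=s and I=I and d=d and Q="\<lambda>k. PP (u k) (v k)"] flow_PP[OF assms]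
  by (simp add: fun_eq_iff)

lemma gs_fix: "u c = 0 \<Longrightarrow> gs l c s u = u"
  by (auto simp: gs_def fun_eq_iff)

lemma gs_ee: "l \<noteq> c \<Longrightarrow> gs l c s (ee c) = (\<lambda>a. ee c a + s * ee l a)"
  by (auto simp: gs_def ee_def fun_eq_iff)

text \<open>Adding the letters of step q to those of step q + 1 shears the rank-two form of step q.
  This takes one move for each vector, and a single move in type C, where both vectors are the
  same.\<close>

lemma slice_block:
  assumes ok: "\<And>k. k < n \<Longrightarrow> ok k" and q: "Suc q < n"
  shows "mv (SL n d) (\<lambda>a b. \<Sum>k<n. d k *
     PP (if k = q then (\<lambda>a. ee (ci q) a + s * ee (ci (Suc q)) a) else ee (ci k))
        (if k = q then (\<lambda>a. ee (cj q) a + s * ee (cj (Suc q)) a) else ee (cj k)) a b)"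
proof -
  have oq: "ok q" "ok (Suc q)" using ok q by auto
  let ?i = "ci q" and ?i' = "ci (Suc q)" and ?j = "cj q" and ?j' = "cj (Suc q)"
  let ?u = "\<lambda>a. ee ?i a + s * ee ?i' a" and ?v = "\<lambda>a. ee ?j a + s * ee ?j' a"
  note ne = later_ne[OF oq(2), of q, simplified]
  have al: "allowed ?i' ?i"
    using gt_ci_ci[OF oq(2), of q] ci_Up oq by (auto simp: allowed_def)
  have al': "allowed ?j' ?j"
  proof (cases tA)
    case True
    then show ?thesis using gt_cj_cj[OF oq(2), of q] cj_Lo oq by (auto simp: allowed_def)
  next
    case False
    then have "gt ?j ?j'" using ok_ci(7)[OF oq(1) False, of ?j'] R_later[OF oq(2), of q] ne by auto
    then show ?thesis using False cj_Up oq by (auto simp: allowed_def)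
  qed
  have SLd: "SL n d = (\<lambda>a b. \<Sum>k<n. d k * PP (ee (ci k)) (ee (cj k)) a b)" by (auto simp: SL_def fun_eq_iff)
  let ?U = "\<lambda>k. if k = q then ?u else ee (ci k)"
  have g1: "gs ?i' ?i s (ee (ci k)) = ?U k" if "k < n" for k
  proof (cases "k = q")
    case True
    then show ?thesis using gs_ee[OF ne(1)] by simp
  next
    case False
    then have "ee (ci k) ?i = 0" using ci_inj[OF ok[OF that] oq(1)] by (auto simp: ee_def)
    then show ?thesis using False by (simp add: gs_fix)
  qed
  have F1: "flow ?i' ?i s (SL n d) = (\<lambda>a b. \<Sum>k<n. d k * PP (?U k) (gs ?i' ?i s (ee (cj k))) a b)"
    unfolding SLd flow_SL[OF ne(1)] by (intro ext sum.cong refl) (simp add: g1)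
  have m1: "mv (SL n d) (flow ?i' ?i s (SL n d))" using al by (intro mv_step mv_refl)
  show ?thesis
  proof (cases tC)
    case True
    then have e: "cj k = ci k" if "k < n" for k using ok_ci(6)[OF ok[OF that]] by auto
    have "gs ?i' ?i s (ee (cj k)) = (if k = q then ?v else ee (cj k))" if "k < n" for k
    proof -
      have "?U k = (if k = q then ?v else ee (cj k))" using e[OF that] e[of q] e[of "Suc q"] q by simp
      then show ?thesis using g1[OF that] e[OF that] by (simp only:)
    qed
    then have "flow ?i' ?i s (SL n d) = (\<lambda>a b. \<Sum>k<n. d k * PP (?U k) (if k = q then ?v else ee (cj k)) a b)"
      unfolding F1 by (intro ext sum.cong refl) simp
    then show ?thesis using m1 by (simp only:)
  next
    case False
    have g2: "gs ?i' ?i s (ee (cj k)) = ee (cj k)" if "k < n" for k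
      by (rule gs_fix) (use ci_cj[OF oq(1) ok[OF that]] False in \<open>simp add: ee_def\<close>)
    have F1': "flow ?i' ?i s (SL n d) = (\<lambda>a b. \<Sum>k<n. d k * PP (?U k) (ee (cj k)) a b)"
      unfolding F1 by (intro ext sum.cong refl) (simp add: g2)
    have g3: "gs ?j' ?j s (?U k) = ?U k" if "k < n" for k
      by (rule gs_fix)
        (use ci_cj[OF ok[OF that] oq(1)] ci_cj[OF oq(2,1)] ci_cj[OF oq(1,1)] False in \<open>auto simp: ee_def\<close>)
    have g4: "gs ?j' ?j s (ee (cj k)) = (if k = q then ?v else ee (cj k))" if "k < n" for k
    proof (cases "k = q")
      case True
      then show ?thesis using gs_ee[OF ne(4)] by simp
    next
      case False
      then have "ee (cj k) ?j = 0" using cj_inj[OF ok[OF that] oq(1)] by (auto simp: ee_def)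
      then show ?thesis using False by (simp add: gs_fix)
    qed
    have "flow ?j' ?j s (flow ?i' ?i s (SL n d))
       = (\<lambda>a b. \<Sum>k<n. d k * PP (gs ?j' ?j s (?U k)) (gs ?j' ?j s (ee (cj k))) a b)"
      unfolding F1' by (rule flow_SL[OF ne(4)])
    also have "\<dots> = (\<lambda>a b. \<Sum>k<n. d k * PP (?U k) (if k = q then ?v else ee (cj k)) a b)"
      by (intro ext sum.cong refl) (simp only: g3 g4 lessThan_iff)
    finally show ?thesis using mv_step[OF m1 al', of s] by (simp only:)
  qed
qed

lemma PP_bilinear:
  "PP (\<lambda>a. u a + s * u' a) (\<lambda>a. v a + s * v' a) a b
    = PP u v a b + s * PP u v' a b + s * PP u' v a b + s\<^sup>2 * PP u' v' a b"
  by (simp add: PP_def algebra_simps power2_eq_square)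

text \<open>Degenerating the q-th pivot to 0 while the form stays bounded sends the next
  one to infinity; hence the exponents of the pivots must decrease.\<close>

lemma slice_dominant:
  assumes ok: "\<And>k. k < n \<Longrightarrow> ok k" and q: "Suc q < n" and z: "z \<in> FN Gc" "invariant z"
    and A: "finite A" "\<And>d. ev z (gx (SL n d)) = (\<Sum>m\<in>A. c m * (\<Prod>k\<in>#m. d k))"
    and m: "m0 \<in> A" "count m0 q < count m0 (Suc q)"
  shows "c m0 = 0"
proof -
  define K where "K = (\<Sum>m\<in>A. count m (Suc q))"
  have K: "count m (Suc q) \<le> K" if "m \<in> A" for m
    unfolding K_def using A(1) that by (intro member_le_sum) auto
  \<comment> \<open>Exponent of \<mu> in the monomial of m when the pivots q and q + 1 are scaled by
    \<mu> and its inverse, shifted by \<open>K\<close> so that the subtraction is not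
    truncated.\<close>
  define ex where "ex m = K + count m q - count m (Suc q)" for m
  have ex0: "ex m0 < K" using m K[OF m(1)] by (auto simp: ex_def)
  have fA: "finite {m \<in> A. ex m = ex m0}" using A(1) by simp
  show ?thesis
  proof (rule mset_poly_zero[OF fA])
    show "m0 \<in> {m \<in> A. ex m = ex m0}" using m by simp
    fix y :: "nat \<Rightarrow> complex" assume y: "\<And>g. y g \<noteq> 0"
    \<comment> \<open>With s = \<tau> / (\<mu> y_q) the shear yields d_q s^2 = - d_(q+1): the block
      of step q + 1, of order 1/\<mu>, cancels, and the sheared form is \<open>Y0\<close> + \<mu>
      \<open>Y1\<close>, polynomial in \<mu>.\<close>
    define \<tau> where "\<tau> = csqrt (- (y q * y (Suc q)))"
    have \<tau>: "\<tau>\<^sup>2 = - (y q * y (Suc q))" by (simp add: \<tau>_def)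
    let ?P = "\<lambda>i j. PP (ee i) (ee j)"
    let ?I = "{..<n} - {q} - {Suc q}"
    have split: "sum f {..<n} = f q + (f (Suc q) + sum f ?I)" for f :: "nat \<Rightarrow> complex"
      using sum.remove[of "{..<n}" q f] sum.remove[of "{..<n} - {q}" "Suc q" f] q by simp
    define Y0 where "Y0 a b = (\<Sum>k\<in>?I. y k * ?P (ci k) (cj k) a b) + \<tau> * ?P (ci q) (cj (Suc q)) a b
       + \<tau> * ?P (ci (Suc q)) (cj q) a b" for a b
    define Y1 where "Y1 a b = y q * ?P (ci q) (cj q) a b" for a b
    obtain p where p: "\<And>s. ev z (\<lambda>g. gx Y0 g + s * gx Y1 g) = poly p s"
      using ev_line_poly[OF z(1), of "gx Y0" "gx Y1"] by auto
    have main: "(\<Sum>m\<in>A. c m * ((\<mu> ^ count m q / \<mu> ^ count m (Suc q)) * (\<Prod>k\<in>#m. y k))) = poly p \<mu>"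
      if \<mu>: "\<mu> \<noteq> 0" for \<mu>
    proof -
      define y1 where "y1 = y(q := \<mu> * y q)"
      define d where "d = y1(Suc q := (1 / \<mu>) * y1 (Suc q))"
      define s where "s = \<tau> / (\<mu> * y q)"
      have dq: "d q = \<mu> * y q" "d (Suc q) = y (Suc q) / \<mu>" "\<And>k. k \<noteq> q \<Longrightarrow> k \<noteq> Suc q \<Longrightarrow> d k = y k"
        by (auto simp: d_def y1_def)
      have 1: "(\<Prod>k\<in>#m. d k) = (\<mu> ^ count m q / \<mu> ^ count m (Suc q)) * (\<Prod>k\<in>#m. y k)" for m
      proof -
        have "(\<Prod>k\<in>#m. d k) = (1 / \<mu>) ^ count m (Suc q) * (\<Prod>k\<in>#m. y1 k)"
          unfolding d_def by (rule prod_mset_scale)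
        also have "(\<Prod>k\<in>#m. y1 k) = \<mu> ^ count m q * (\<Prod>k\<in>#m. y k)"
          unfolding y1_def by (rule prod_mset_scale)
        finally show ?thesis by (simp add: power_one_over)
      qed
      let ?U = "\<lambda>k. if k = q then (\<lambda>a. ee (ci q) a + s * ee (ci (Suc q)) a) else ee (ci k)"
      let ?V = "\<lambda>k. if k = q then (\<lambda>a. ee (cj q) a + s * ee (cj (Suc q)) a) else ee (cj k)"
      have eq: "(\<Sum>k<n. d k * PP (?U k) (?V k) a b) = Y0 a b + \<mu> * Y1 a b" for a b
      proof -
        have "(\<Sum>k<n. d k * PP (?U k) (?V k) a b)
          = d q * PP (?U q) (?V q) a b + (d (Suc q) * PP (?U (Suc q)) (?V (Suc q)) a b + (\<Sum>k\<in>?I. d k * PP (?U k) (?V k) a b))"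
          by (rule split)
        also have "(\<Sum>k\<in>?I. d k * PP (?U k) (?V k) a b) = (\<Sum>k\<in>?I. y k * ?P (ci k) (cj k) a b)"
          using dq(3) by (intro sum.cong) auto
        also have "PP (?U q) (?V q) a b = PP (\<lambda>a. ee (ci q) a + s * ee (ci (Suc q)) a) (\<lambda>a. ee (cj q) a + s * ee (cj (Suc q)) a) a b"
          by simp
        also have "PP (?U (Suc q)) (?V (Suc q)) a b = ?P (ci (Suc q)) (cj (Suc q)) a b" by simp
        also have "d q * PP (\<lambda>a. ee (ci q) a + s * ee (ci (Suc q)) a) (\<lambda>a. ee (cj q) a + s * ee (cj (Suc q)) a) a b = d q * ?P (ci q) (cj q) a b + (d q * s) * ?P (ci q) (cj (Suc q)) a b
            + (d q * s) * ?P (ci (Suc q)) (cj q) a b + (d q * s\<^sup>2) * ?P (ci (Suc q)) (cj (Suc q)) a b"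
          unfolding PP_bilinear by (simp add: distrib_left mult.assoc)
        also have "d q * s = \<tau>" using \<mu> y by (simp add: dq s_def)
        also have "d q * s\<^sup>2 = - d (Suc q)"
        proof -
          have "d q * s\<^sup>2 = \<tau>\<^sup>2 / (\<mu> * y q)" using \<mu> y by (simp add: dq s_def power2_eq_square)
          then show ?thesis using \<mu> y by (simp add: \<tau> dq)
        qed
        finally show ?thesis unfolding Y0_def Y1_def dq(1) by (simp add: add_ac mult.assoc)
      qed
      have "mv (SL n d) (\<lambda>a b. Y0 a b + \<mu> * Y1 a b)"
        using slice_block[of n q d s, OF ok q] unfolding eq .
      from mv_invariant[OF this SL_form[of n, OF ok] z]
      have "ev z (gx (\<lambda>a b. Y0 a b + \<mu> * Y1 a b)) = ev z (gx (SL n d))" .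
      moreover have "gx (\<lambda>a b. Y0 a b + \<mu> * Y1 a b) = (\<lambda>g. gx Y0 g + \<mu> * gx Y1 g)"
        by (rule ext) (rule gx_add)
      ultimately have "poly p \<mu> = (\<Sum>m\<in>A. c m * (\<Prod>k\<in>#m. d k))" using p[of \<mu>] A(2)[of d] by (simp only:)
      then show ?thesis unfolding 1 by (rule sym)
    qed
    define LP where "LP = (\<Sum>m\<in>A. monom (c m * (\<Prod>k\<in>#m. y k)) (ex m))"
    have "poly LP \<mu> = poly (monom 1 K * p) \<mu>" if \<mu>: "\<mu> \<noteq> 0" for \<mu>
    proof -
      have "poly (monom 1 K * p) \<mu> = \<mu> ^ K * (\<Sum>m\<in>A. c m * ((\<mu> ^ count m q / \<mu> ^ count m (Suc q)) * (\<Prod>k\<in>#m. y k)))"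
        using main[OF \<mu>] by (simp add: poly_monom)
      also have "\<dots> = (\<Sum>m\<in>A. c m * (\<Prod>k\<in>#m. y k) * \<mu> ^ ex m)"
        unfolding sum_distrib_left
      proof (intro sum.cong refl)
        fix m assume "m \<in> A"
        then have "\<mu> ^ ex m * \<mu> ^ count m (Suc q) = \<mu> ^ K * \<mu> ^ count m q"
        proof -
          have "ex m + count m (Suc q) = K + count m q" using K[OF \<open>m \<in> A\<close>] by (simp add: ex_def)
          then show ?thesis by (simp only: power_add[symmetric])
        qed
        then have e: "\<mu> ^ K * (\<mu> ^ count m q / \<mu> ^ count m (Suc q)) = \<mu> ^ ex m" using \<mu> by (simp add: field_simps)
        have "\<mu> ^ K * (c m * (\<mu> ^ count m q / \<mu> ^ count m (Suc q) * (\<Prod>k\<in>#m. y k)))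
           = c m * (\<Prod>k\<in>#m. y k) * (\<mu> ^ K * (\<mu> ^ count m q / \<mu> ^ count m (Suc q)))" by (simp only: mult_ac)
        then show "\<mu> ^ K * (c m * (\<mu> ^ count m q / \<mu> ^ count m (Suc q) * (\<Prod>k\<in>#m. y k)))
           = c m * (\<Prod>k\<in>#m. y k) * \<mu> ^ ex m" unfolding e .
      qed
      also have "\<dots> = poly LP \<mu>" by (simp add: LP_def poly_sum poly_monom)
      finally show ?thesis by simp
    qed
    \<comment> \<open>The linear factor takes care of the excluded point \<mu> = 0.\<close>
    then have "poly ([:0, 1:] * (LP - monom 1 K * p)) \<mu> = 0" for \<mu> by (cases "\<mu> = 0") auto
    then have "[:0, 1:] * (LP - monom 1 K * p) = 0" by (subst poly_all_0_iff_0[symmetric]) blast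
    then have LPe: "LP = monom 1 K * p" by simp
    \<comment> \<open>Boundedness at \<mu> = 0 becomes divisibility by the K-th power, while the
      exponent of \<open>m0\<close> lies below \<open>K\<close>.\<close>
    have "coeff LP (ex m0) = 0" unfolding LPe using ex0 by (simp add: coeff_monom_mult)
    moreover have "coeff LP (ex m0) = (\<Sum>m\<in>A. if ex m = ex m0 then c m * (\<Prod>k\<in>#m. y k) else 0)"
      by (simp add: LP_def coeff_sum)
    ultimately show "(\<Sum>m\<in>{m \<in> A. ex m = ex m0}. c m * (\<Prod>k\<in>#m. y k)) = 0"
      using A(1) by (simp add: sum.inter_filter)
  qed
qed

section \<open>Generation and independence\<close>

definition Alg :: "gen nc set" where "Alg = nc ` falg (cgen t r ` cindex t r)"

lemma Alg_1: "1 \<in> Alg" unfolding Alg_def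
  by (rule image_eqI[of _ _ fone]) (auto simp: nc_simps wd_Nil intro: falg_one)
lemma Alg_add: "p \<in> Alg \<Longrightarrow> q \<in> Alg \<Longrightarrow> p + q \<in> Alg"
  unfolding Alg_def by (auto simp: nc_simps(3)[symmetric] intro!: imageI falg_add)
lemma Alg_mul: "p \<in> Alg \<Longrightarrow> q \<in> Alg \<Longrightarrow> p * q \<in> Alg"
  unfolding Alg_def by (auto simp: nc_simps(6)[symmetric] intro!: imageI falg_mul)
lemma Alg_sc: "p \<in> Alg \<Longrightarrow> sc c p \<in> Alg"
  unfolding Alg_def by (auto simp: nc_simps(5)[symmetric] intro!: imageI falg_scale)
lemma Alg_0: "0 \<in> Alg" using Alg_sc[OF Alg_1, of 0] by simp
lemma Alg_sum: "(\<And>i. i \<in> I \<Longrightarrow> f i \<in> Alg) \<Longrightarrow> (\<Sum>i\<in>I. f i) \<in> Alg"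
  by (induction I rule: infinite_finite_induct) (auto simp: Alg_0 Alg_add)

text \<open>The generator of index q exists when step q - 1 succeeds, steps being numbered from
  0.\<close>

lemma cindex_iff: "q \<in> cindex t r \<longleftrightarrow> 1 \<le> q \<and> ok (q - 1)"
  by (cases q) (auto simp: cindex_def ok_def)

lemma Alg_gen: "q \<in> cindex t r \<Longrightarrow> nc (cgen t r q) \<in> Alg"
  unfolding Alg_def by (auto intro: falg_gen)

lemma cindex_ok: "q \<in> cindex t r \<Longrightarrow> k < q \<Longrightarrow> ok k"
  using ok_down[of "q - 1" k] by (auto simp: cindex_iff)

lemma Alg_central: "p \<in> Alg \<Longrightarrow> central p"
proof -
  have "central (nc y)" if "y \<in> falg (cgen t r ` cindex t r)" for y
    using that
  proof (induction rule: falg.induct)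
    case falg_one then show ?case by (simp add: nc_simps wd_Nil central_1)
  next
    case (falg_gen x)
    then show ?case using cgen_central cindex_ok by auto
  qed (simp_all add: nc_simps central_add central_sc central_mul)
  then show "p \<in> Alg \<Longrightarrow> central p" by (auto simp: Alg_def)
qed

text \<open>A weakly decreasing exponent sequence is a sum of indicators of initial segments, as for
  a conjugate partition; the segment of length p comes from the generator of index p divided by
  \<open>NN p\<close>. The evaluation refers to generator values and not to the slice, so that it
  also applies at generic points.\<close>

lemma dominant_generator:
  assumes ok: "\<And>k. k < n \<Longrightarrow> ok k"
    and m: "set_mset m \<subseteq> {..<n}" "\<And>q. Suc q < n \<Longrightarrow> count m (Suc q) \<le> count m q"
  shows "\<exists>y\<in>Alg. y \<in> FN Gc \<and> hom (size m) y \<and>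
    (\<forall>x d. (\<forall>q\<le>n. Th q (X x) = NN q * (\<Prod>k<q. d k)) \<longrightarrow> ev y x = (\<Prod>k\<in>#m. d k))"
  using m
proof (induction "size m" arbitrary: m rule: less_induct)
  case less
  show ?case
  proof (cases "m = {#}")
    case True
    then show ?thesis using Alg_1 hom_1 by (intro bexI[of _ 1]) auto
  next
    case False
    \<comment> \<open>All exponents below p are positive by monotonicity, so one initial segment of
      length p can be split off.\<close>
    define p where "p = Suc (Max (set_mset m))"
    have mp: "p - 1 \<in># m" "\<And>k. k \<in># m \<Longrightarrow> k < p"
      using False Max_in[of "set_mset m"] Max_ge[of "set_mset m"] by (auto simp: p_def less_Suc_eq_le)
    have pn: "0 < p" "p \<le> n" using mp(1) less.prems(1) by (auto simp: p_def)
    have cnt: "1 \<le> count m k" if "k < p" for k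
    proof -
      have "1 \<le> count m (p - 1 - j)" for j
      proof (induction j)
        case 0
        then show ?case using mp(1) by (simp add: Suc_le_eq)
      next
        case (Suc j)
        show ?case
        proof (cases "p - 1 - j = 0")
          case False
          then have "Suc (p - 1 - Suc j) = p - 1 - j" by auto
          moreover have "p - 1 - j < n" using pn by auto
          ultimately have "count m (p - 1 - j) \<le> count m (p - 1 - Suc j)"
            using less.prems(2)[of "p - 1 - Suc j"] by (simp only:)
          then show ?thesis using Suc by (rule order_trans[rotated])
        qed (use Suc in auto)
      qed
      from this[of "p - 1 - k"] show ?thesis using that by auto
    qed
    define m' where "m' = m - mset_set {..<p}"
    have sub: "mset_set {..<p} \<subseteq># m"
      using cnt by (auto simp: subseteq_mset_def count_mset_set')
    then have m: "m = mset_set {..<p} + m'" by (simp add: m'_def)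
    have sz: "size m = p + size m'" unfolding m by simp
    have "set_mset m' \<subseteq> {..<n}" using less.prems(1) unfolding m by auto
    moreover have "count m' (Suc q) \<le> count m' q" if "Suc q < n" for q
    proof (cases "Suc q < p")
      case True
      then show ?thesis using less.prems(2)[OF that] by (simp add: m'_def count_mset_set')
    next
      case False
      then have "Suc q \<notin># m" using mp(2) by auto
      then show ?thesis by (simp add: m'_def not_in_iff)
    qed
    ultimately obtain y where y: "y \<in> Alg" "y \<in> FN Gc" "hom (size m') y"
      "\<And>x d. \<forall>q\<le>n. Th q (X x) = NN q * (\<Prod>k<q. d k) \<Longrightarrow> ev y x = (\<Prod>k\<in>#m'. d k)"
      using less.hyps[of m'] sz pn by auto
    have okp: "\<And>k. k < p \<Longrightarrow> ok k" using ok pn by auto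
    note cg = cgen_props[where n=p, OF okp]
    define y' where "y' = sc (1 / NN p) (nc (cgen t r p)) * y"
    have "p \<in> cindex t r" using pn okp by (simp add: cindex_iff)
    then have "y' \<in> Alg" using y by (auto simp: y'_def simp del: mul_sc intro!: Alg_mul Alg_sc Alg_gen)
    moreover have "y' \<in> FN Gc" using cg(1) y by (auto simp: y'_def intro!: FN_sc FN_mul)
    moreover have "hom (size m) y'" unfolding y'_def sz using cg(2) y by (intro hom_mul hom_sc)
    moreover have "ev y' x = (\<Prod>k\<in>#m. d k)" if "\<forall>q\<le>n. Th q (X x) = NN q * (\<Prod>k<q. d k)" for x d
    proof -
      have "ev y' x = (1 / NN p) * Th p (X x) * ev y x"
        using cg(1,3) y by (simp add: y'_def ev_mul[where G=Gc])
      also have "\<dots> = (\<Prod>k<p. d k) * (\<Prod>k\<in>#m'. d k)"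
        using that pn NN(1)[of p, OF okp] y(4)[OF that] by simp
      also have "\<dots> = (\<Prod>k\<in>#m. d k)" unfolding m by (simp add: prod_unfold_prod_mset)
      finally show ?thesis .
    qed
    ultimately show ?thesis by blast
  qed
qed

text \<open>On the line from \<open>x\<close> to a slice point where no generator vanishes, the
  generators have finitely many zeros; polynomials in one variable that agree elsewhere are
  equal.\<close>

lemma generic_agree:
  assumes ok: "\<And>k. k < n \<Longrightarrow> ok k" and z: "z \<in> FN Gc" "y \<in> FN Gc"
    and agree: "\<And>x. (\<And>q. q \<le> n \<Longrightarrow> Th q (X x) \<noteq> 0) \<Longrightarrow> ev z x = ev y x"
  shows "ev z x = ev y x"
proof -
  define x0 where "x0 = gx (SL n (\<lambda>_. 1))"
  have oq: "k < q \<Longrightarrow> q \<le> n \<Longrightarrow> ok k" for k q using ok by auto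
  have x0: "Th q (X x0) \<noteq> 0" if "q \<le> n" for q
    using Th_SL[of n q "\<lambda>_. 1", OF ok that] NN(1)[of q] oq that
    by (simp add: x0_def X_gx[OF SL_form[of n, OF ok]])
  let ?l = "\<lambda>s g. x0 g + s * (x g - x0 g)"
  obtain pz where pz: "\<And>s. ev z (?l s) = poly pz s" using ev_line_poly[OF z(1), of x0 "\<lambda>g. x g - x0 g"] by blast
  obtain py where py: "\<And>s. ev y (?l s) = poly py s" using ev_line_poly[OF z(2), of x0 "\<lambda>g. x g - x0 g"] by blast
  have "\<exists>p. \<forall>s. Th q (X (?l s)) = poly p s" if "q \<le> n" for q
  proof -
    have oq': "\<And>k. k < q \<Longrightarrow> ok k" using ok that by auto
    have "\<exists>p. \<forall>s. ev (nc (cgen t r q)) (?l s) = poly p s"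
      by (rule ev_line_poly[OF cgen_props(1)[where n=q, OF oq']])
    then show ?thesis using cgen_props(3)[where n=q, OF oq'] by simp
  qed
  then have "\<forall>q\<in>{..n}. \<exists>p. \<forall>s. Th q (X (?l s)) = poly p s" by blast
  from bchoice[OF this] obtain pq where pq: "\<And>q s. q \<le> n \<Longrightarrow> Th q (X (?l s)) = poly (pq q) s" by blast
  define Q where "Q = (\<Prod>q\<le>n. pq q)"
  have "poly Q 0 \<noteq> 0" using x0 pq[of _ 0] by (simp add: Q_def poly_prod)
  then have Q0: "Q \<noteq> 0" by auto
  have "poly ((pz - py) * Q) s = 0" for s
  proof (cases "poly Q s = 0")
    case False
    then have "Th q (X (?l s)) \<noteq> 0" if "q \<le> n" for q
      using that pq[OF that, of s] by (auto simp: Q_def poly_prod)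
    from agree[OF this] show ?thesis by (simp add: pz py)
  qed simp
  then have "(pz - py) * Q = 0" by (subst poly_all_0_iff_0[symmetric]) blast
  then have "pz = py" using Q0 by simp
  then show ?thesis using pz[of 1] py[of 1] by simp
qed

text \<open>At a generic point, elimination carries the value to the slice, where it is a
  combination of pivot monomials with weakly decreasing exponents. Those depend on the generator
  values alone, which the moves preserve, so the comparison returns to the original point.\<close>

lemma invariant_generated:
  assumes z: "invariant z" "hom e z"
  shows "\<exists>y\<in>Alg. y \<in> FN Gc \<and> hom e y \<and> (\<forall>x. ev y x = ev z x)"
proof -
  obtain z1 where z1: "z1 \<in> FN Gc" "hom e z1" "\<And>x. ev z1 x = ev z x" "invariant z1"
    by (rule invariant_restrict[OF z]) blast
  define G0 where "G0 = \<Union> (set ` {w. cf z1 w \<noteq> 0})"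
  have G0: "finite G0" "G0 \<subseteq> Gc" "z1 \<in> FN G0" using z1(1) by (auto simp: FN_iff G0_def)
  \<comment> \<open>Far enough along the cascade that every coordinate of \<open>z1\<close> has an
    index in it: cleaning those rows then determines all coordinates of \<open>z1\<close>.\<close>
  have "\<exists>n. (\<forall>k<n. ok k) \<and> (\<forall>(a, b)\<in>gpair ` G0. a \<in> cs n \<or> b \<in> cs n)"
  proof (rule cover_finite)
    show "finite (gpair ` G0)" using G0(1) by simp
    fix a b assume "(a, b) \<in> gpair ` G0"
    then obtain g where "g \<in> G0" "gpair g = (a, b)" by (elim imageE) simp
    then show "pairok a b \<and> (tC \<or> a \<noteq> b)" using gpair_Gc(1,2)[of g a b] G0(2) by blast
  qed
  then obtain n where n: "\<And>k. k < n \<Longrightarrow> ok k" "\<forall>(a, b)\<in>gpair ` G0. a \<in> cs n \<or> b \<in> cs n" by blast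
  define A where "A = cs n \<union> fst ` gpair ` G0 \<union> snd ` gpair ` G0"
  have A: "finite A" "cs n \<subseteq> A" using G0 cs_finite by (auto simp: A_def)
  have A': "a \<in> A \<and> b \<in> A" if "g \<in> G0" "gpair g = (a, b)" for g a b
  proof -
    have "fst (gpair g) \<in> A" "snd (gpair g) \<in> A" using that(1) by (auto simp: A_def)
    then show ?thesis using that(2) by simp
  qed
  have Apos: "0 < v" if "v \<in> A" for v
  proof -
    have "v \<in> cs n \<or> (\<exists>g\<in>G0. v = fst (gpair g) \<or> v = snd (gpair g))" using that by (auto simp: A_def)
    then show ?thesis
    proof
      assume "v \<in> cs n"
      then show ?thesis using cs_eq[of n, OF n(1)] ok_pos n(1) by auto
    next
      assume "\<exists>g\<in>G0. v = fst (gpair g) \<or> v = snd (gpair g)"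
      then obtain g where g: "g \<in> G0" "v = fst (gpair g) \<or> v = snd (gpair g)" by blast
      obtain a b where ab: "gpair g = (a, b)" by (cases "gpair g")
      then show ?thesis using g gpair_Gc(3,4)[of g a b] G0(2) by auto
    qed
  qed
  obtain M c where M: "finite M" "\<And>m. m \<in> M \<Longrightarrow> set_mset m \<subseteq> {..<n} \<and> size m = e"
    "\<And>d. ev z1 (gx (SL n d)) = (\<Sum>m\<in>M. c m * (\<Prod>k\<in>#m. d k))"
    using slice_expand[of n, OF n(1) z1(1,2)] by blast
  define M1 where "M1 = {m \<in> M. c m \<noteq> 0}"
  define GP where "GP m y \<longleftrightarrow> (\<forall>x d. (\<forall>q\<le>n. Th q (X x) = NN q * (\<Prod>k<q. d k)) \<longrightarrow> ev y x = (\<Prod>k\<in>#m. d k))"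
    for m y
  have "\<forall>m\<in>M1. \<exists>y. y \<in> Alg \<and> y \<in> FN Gc \<and> hom e y \<and> GP m y"
  proof
    fix m assume "m \<in> M1"
    then have mM: "m \<in> M" "c m \<noteq> 0" by (auto simp: M1_def)
    have "count m (Suc q) \<le> count m q" if "Suc q < n" for q
    proof (rule ccontr)
      assume "\<not> ?thesis"
      then have "c m = 0" by (intro slice_dominant[of n q, OF n(1) that z1(1,4) M(1,3) mM(1)]) auto
      then show False using mM(2) by simp
    qed
    from dominant_generator[of n m, OF n(1) _ this] M(2)[OF mM(1)]
    show "\<exists>y. y \<in> Alg \<and> y \<in> FN Gc \<and> hom e y \<and> GP m y" unfolding GP_def by auto
  qed
  from bchoice[OF this] obtain Y where
    Y: "\<forall>m\<in>M1. Y m \<in> Alg \<and> Y m \<in> FN Gc \<and> hom e (Y m) \<and> GP m (Y m)" ..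
  define y where "y = (\<Sum>m\<in>M1. sc (c m) (Y m))"
  have y: "y \<in> Alg" "y \<in> FN Gc" "hom e y"
    unfolding y_def using Y by (simp_all add: Alg_sum Alg_sc FN_sum FN_sc hom_sum hom_sc)
  have agree: "ev z1 x = ev y x" if gen: "\<And>q. q \<le> n \<Longrightarrow> Th q (X x) \<noteq> 0" for x
  proof -
    obtain Y' where Y': "mv (X x) Y'" "\<forall>k<n. clean A k Y'"
      using eliminate[of A n "X x", OF A(1,2) Apos n(1) form_X gen] by blast
    have fY: "form Y'" by (rule mv_form[OF Y'(1) form_X])
    let ?d = "\<lambda>k. gx Y' (beta k)"
    have "ev z1 x = ev z1 (gx (X x))" by (rule ev_cong[OF z1(1)]) (simp add: gx_X)
    also have "\<dots> = ev z1 (gx Y')" using mv_invariant[OF Y'(1) form_X z1(1,4)] by simp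
    also have "\<dots> = ev z1 (gx (SL n ?d))"
    proof (rule ev_cong[OF G0(3)])
      fix g assume g: "g \<in> G0"
      obtain a b where ab: "gpair g = (a, b)" by (cases "gpair g")
      then have "(a, b) \<in> gpair ` G0" using g by force
      then have "a \<in> cs n \<or> b \<in> cs n" using n(2) by auto
      then show "gx Y' g = gx (SL n ?d) g"
        using gx_clean[of n Y' A g a b, OF n(1) fY _ ab] A'[OF g ab] Y'(2) by auto
    qed
    also have "\<dots> = (\<Sum>m\<in>M1. c m * (\<Prod>k\<in>#m. ?d k))"
      unfolding M(3) M1_def using M(1) by (intro sum.mono_neutral_right) auto
    also have "\<dots> = (\<Sum>m\<in>M1. c m * ev (Y m) x)"
    proof -
      have th: "Th q (X x) = NN q * (\<Prod>k<q. ?d k)" if "q \<le> n" for q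
      proof -
        have oq: "\<And>k. k < q \<Longrightarrow> ok k" using n(1) that by auto
        have "Th q (X x) = Th q Y'" using mv_Th[of q, OF oq Y'(1) form_X] by simp
        also have "\<dots> = NN q * (\<Prod>k<q. ?d k)"
        proof (rule NN(2)[of q, OF oq fY])
          show "clean (cs q) k Y'" if "k < q" for k
            using Y'(2) that \<open>q \<le> n\<close> clean_mono[of A k Y' "cs q"] A(2) cs_mono[OF \<open>q \<le> n\<close>] by auto
          show "Y' (ci k) (cj k) = bc * gx Y' (beta k)" if "k < q" for k
            using gx_beta[OF oq[OF that]] bc_nz by simp
        qed
        finally show ?thesis .
      qed
      show ?thesis
      proof (rule sum.cong[OF refl])
        fix m assume "m \<in> M1"
        then have "GP m (Y m)" using Y by blast
        then have "ev (Y m) x = (\<Prod>k\<in>#m. ?d k)"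
          unfolding GP_def using th by (elim allE[of _ x] allE[of _ ?d] impE) auto
        then show "c m * (\<Prod>k\<in>#m. ?d k) = c m * ev (Y m) x" by simp
      qed
    qed
    also have "\<dots> = ev y x"
      unfolding y_def using Y by (subst ev_sum[where G=Gc]) (auto intro!: FN_sc)
    finally show ?thesis .
  qed
  have "ev z1 x = ev y x" for x using n(1) z1(1) y(2) agree by (rule generic_agree)
  then show ?thesis using y z1(3) by (intro bexI[of _ y]) simp_all
qed

lemma central_generated:
  assumes "central z" "deg_le d z" shows "\<exists>y\<in>Alg. z - y \<in> J"
  using assms
proof (induction d arbitrary: z)
  case 0
  have "z = sc (cf z []) 1"
    using 0(2) by (intro nc_eqI) (auto simp: deg_le_def cf_wd simp flip: wd_Nil)
  then have "z \<in> Alg" using Alg_sc[OF Alg_1] by metis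
  then show ?case by (intro bexI[of _ z]) auto
next
  case (Suc d)
  let ?z = "top_part (Suc d) z"
  have zF: "z \<in> FN GG" using Suc.prems by (simp add: central_def)
  have "invariant ?z"
    using FN_top[OF zF] central_invariant[OF Suc.prems] by (auto simp: invariant_def)
  then obtain y where y: "y \<in> Alg" "hom (Suc d) y" "\<And>x. ev y x = ev ?z x"
    using invariant_generated[OF _ hom_top] by blast
  have yc: "central y" by (rule Alg_central[OF y(1)])
  then have yF: "y \<in> FN GG" by (simp add: central_def)
  have cz: "central (z - y)" using central_add[OF Suc.prems(1) central_sc[OF yc, of "-1"]] by simp
  have "ev (top_part (Suc d) (z - y)) x = 0" for x
    unfolding top_diff top_hom[OF y(2)] using ev_diff[OF FN_top[OF zF] yF] y(3) by simp
  moreover have "deg_le (Suc d) (z - y)" by (intro deg_le_diff Suc.prems hom_deg_le[OF y(2)]) simp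
  \<comment> \<open>The difference has vanishing symbol but may still contain words of full length;
    reordering replaces it by a congruent element of smaller degree, again central.\<close>
  ultimately obtain z' where z': "z' \<in> FN GG" "z - y - z' \<in> J" "deg_le d z'"
    using reorder[of "z - y" "Suc d" "{}"] zF yF by auto
  have "- (z - y - z') \<in> J" using z'(2) by (rule idl_minus)
  then have "central z'" by (intro central_cong[OF cz z'(1)]) simp
  then obtain y' where y': "y' \<in> Alg" "z' - y' \<in> J" using Suc.IH z'(3) by blast
  have "(z - y - z') + (z' - y') \<in> J" using z'(2) y'(2) by (rule idl_add)
  then have "z - (y + y') \<in> J" by (simp add: algebra_simps)
  then show ?case using Alg_add[OF y(1) y'(1)] by blast
qed

lemma central_iff:
  assumes "z \<in> FN GG" shows "central z \<longleftrightarrow> (\<exists>y\<in>Alg. z - y \<in> J)"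
proof
  assume c: "central z"
  have "finite {w. cf z w \<noteq> 0}" using assms by (simp add: FN_iff)
  then have "deg_le (Max (insert 0 (length ` {w. cf z w \<noteq> 0}))) z" by (auto simp: deg_le_def)
  then show "\<exists>y\<in>Alg. z - y \<in> J" using central_generated[OF c] by blast
next
  assume "\<exists>y\<in>Alg. z - y \<in> J"
  then show "central z" using central_cong Alg_central assms by blast
qed

section \<open>Algebraic independence\<close>

definition wt :: "(nat \<Rightarrow>\<^sub>0 nat) \<Rightarrow> nat" where
  "wt e = (\<Sum>q\<in>Poly_Mapping.keys e. Poly_Mapping.lookup e q * q)"

text \<open>The generator of index q is homogeneous of degree q, so \<open>wt e\<close> is the
  degree of the monomial with exponents \<open>e\<close>.\<close>

lemma fmono_props:
  assumes "Poly_Mapping.keys e \<subseteq> cindex t r"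
  shows "nc (fmono t r e) \<in> FN Gc" "hom (wt e) (nc (fmono t r e))"
    "ev (nc (fmono t r e)) x = (\<Prod>q\<in>Poly_Mapping.keys e. Th q (X x) ^ Poly_Mapping.lookup e q)"
proof -
  have pw: "nc (fpow p n) = nc p ^ n" for p :: "gen fa" and n
    by (simp add: fpow_def nc_fprod)
  define Q where "Q qs = prod_list (map (\<lambda>q. nc (cgen t r q) ^ Poly_Mapping.lookup e q) qs)" for qs
  have "Q qs \<in> FN Gc \<and> hom (\<Sum>q\<leftarrow>qs. Poly_Mapping.lookup e q * q) (Q qs) \<and>
    ev (Q qs) x = (\<Prod>q\<leftarrow>qs. Th q (X x) ^ Poly_Mapping.lookup e q)" if "set qs \<subseteq> cindex t r" for qs
    using that
  proof (induction qs)
    case (Cons q qs)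
    have okq: "\<And>k. k < q \<Longrightarrow> ok k" using Cons.prems cindex_ok by auto
    note cg = cgen_props[where n=q, OF okq]
    have Qc: "Q (q # qs) = nc (cgen t r q) ^ Poly_Mapping.lookup e q * Q qs" by (simp add: Q_def)
    have IH: "Q qs \<in> FN Gc" "hom (\<Sum>q\<leftarrow>qs. Poly_Mapping.lookup e q * q) (Q qs)"
      "ev (Q qs) x = (\<Prod>q\<leftarrow>qs. Th q (X x) ^ Poly_Mapping.lookup e q)" using Cons by auto
    show ?case using IH cg
      by (auto simp: Qc ev_mul[where G=Gc] ev_power[where G=Gc] FN_power intro!: FN_mul FN_power hom_mul hom_power)
  qed (auto simp: Q_def hom_1)
  then have Q: "Q qs \<in> FN Gc" "hom (\<Sum>q\<leftarrow>qs. Poly_Mapping.lookup e q * q) (Q qs)"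
    "ev (Q qs) x = (\<Prod>q\<leftarrow>qs. Th q (X x) ^ Poly_Mapping.lookup e q)" if "set qs \<subseteq> cindex t r" for qs
    using that by blast+
  have f: "nc (fmono t r e) = Q (sorted_list_of_set (Poly_Mapping.keys e))"
    by (simp add: fmono_def nc_fprod pw o_def Q_def)
  have s: "set (sorted_list_of_set (Poly_Mapping.keys e)) = Poly_Mapping.keys e" by simp
  show "nc (fmono t r e) \<in> FN Gc" unfolding f using assms by (intro Q(1)) auto
  have "(\<Sum>q\<leftarrow>sorted_list_of_set (Poly_Mapping.keys e). Poly_Mapping.lookup e q * q) = wt e"
    unfolding wt_def by (simp add: sum_list_distinct_conv_sum_set)
  then show "hom (wt e) (nc (fmono t r e))" unfolding f using assms Q(2)[of "sorted_list_of_set (Poly_Mapping.keys e)"] by simp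
  show "ev (nc (fmono t r e)) x = (\<Prod>q\<in>Poly_Mapping.keys e. Th q (X x) ^ Poly_Mapping.lookup e q)"
    unfolding f using assms Q(3)[of "sorted_list_of_set (Poly_Mapping.keys e)"]
    by (simp add: prod.distinct_set_conv_list[symmetric])
qed

text \<open>The pivots are ratios of consecutive prescribed values, up to the constants
  \<open>NN\<close>. The value at index 0 is set to 1, the empty product, so that the products
  telescope.\<close>

lemma prescribe_Th:
  assumes ok: "\<And>k. k < n \<Longrightarrow> ok k" and y: "\<And>q. y q \<noteq> 0"
  shows "\<exists>x. \<forall>q. 1 \<le> q \<longrightarrow> q \<le> n \<longrightarrow> Th q (X x) = y q"
proof -
  define v where "v q = (if q = 0 then 1 else y q / NN q)" for q
  define d where "d k = v (Suc k) / v k" for k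
  have v: "v q \<noteq> 0" if "q \<le> n" for q using that y NN(1)[of q] ok by (auto simp: v_def)
  have pr: "(\<Prod>k<q. d k) = v q" if "q \<le> n" for q
    using that
  proof (induction q)
    case (Suc q) then show ?case using v[of q] by (simp add: d_def)
  qed (simp add: v_def)
  have "Th q (X (gx (SL n d))) = y q" if "1 \<le> q" "q \<le> n" for q
    using Th_SL[of n q d, OF ok that(2)] pr[OF that(2)] NN(1)[of q] ok that
    by (simp add: X_gx[OF SL_form[of n, OF ok]] v_def)
  then show ?thesis by blast
qed

text \<open>The part of greatest weight in a relation has an identically vanishing symbol, while the
  generators take arbitrary nonzero values simultaneously.\<close>

lemma independent:
  assumes c: "\<forall>e\<in>Poly_Mapping.keys c. Poly_Mapping.keys e \<subseteq> cindex t r" and J: "nc (peval t r c) \<in> J"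
  shows "c = 0"
proof (rule ccontr)
  assume "c \<noteq> 0"
  define E where "E = Poly_Mapping.keys c"
  have E: "finite E" "E \<noteq> {}" using \<open>c \<noteq> 0\<close> by (auto simp: E_def)
  define w where "w = Max (wt ` E)"
  define E1 where "E1 = {e \<in> E. wt e = w}"
  have "w \<in> wt ` E" unfolding w_def using E by (intro Max_in) auto
  then obtain e0 where e0: "e0 \<in> E1" by (auto simp: E1_def)
  have fm: "nc (fmono t r e) \<in> FN Gc" "hom (wt e) (nc (fmono t r e))"
    "\<And>x. ev (nc (fmono t r e)) x = (\<Prod>q\<in>Poly_Mapping.keys e. Th q (X x) ^ Poly_Mapping.lookup e q)"
    if "e \<in> E" for e using fmono_props[of e] c that by (auto simp: E_def)
  have pe: "nc (peval t r c) = (\<Sum>e\<in>E. sc (Poly_Mapping.lookup c e) (nc (fmono t r e)))"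
    by (simp add: peval_def nc_fsum nc_simps E_def)
  have "deg_le w (nc (peval t r c))"
    unfolding pe w_def using fm(2) E by (intro deg_le_sum deg_le_sc) (auto intro!: hom_deg_le)
  from symbol_J[OF J this] have sy: "ev (top_part w (nc (peval t r c))) x = 0" for x .
  have tp: "top_part w (nc (peval t r c)) = (\<Sum>e\<in>E1. sc (Poly_Mapping.lookup c e) (nc (fmono t r e)))"
  proof -
    have "top_part w (nc (fmono t r e)) = (if e \<in> E1 then nc (fmono t r e) else 0)" if "e \<in> E" for e
    proof (cases "wt e = w")
      case True
      then show ?thesis using fm(2)[OF that] top_hom that by (auto simp: E1_def)
    next
      case False
      then have "wt e < w" unfolding w_def using E that by (simp add: order_less_le)
      then show ?thesis using top_lower[OF hom_deg_le[OF fm(2)[OF that] order_refl]] by (auto simp: E1_def)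
    qed
    then have "top_part w (nc (peval t r c)) = (\<Sum>e\<in>E. if e \<in> E1 then sc (Poly_Mapping.lookup c e) (nc (fmono t r e)) else 0)"
      unfolding pe top_sum top_sc by (intro sum.cong) auto
    also have "\<dots> = (\<Sum>e\<in>E1. sc (Poly_Mapping.lookup c e) (nc (fmono t r e)))"
      using E by (intro sum.mono_neutral_cong_right) (auto simp: E1_def)
    finally show ?thesis .
  qed
  have E1f: "finite E1" "E1 \<subseteq> E" using E by (auto simp: E1_def)
  have s0: "(\<Sum>e\<in>E1. Poly_Mapping.lookup c e * (\<Prod>q\<in>Poly_Mapping.keys e. Th q (X x) ^ Poly_Mapping.lookup e q)) = 0" for x
  proof -
    have "ev (\<Sum>e\<in>E1. sc (Poly_Mapping.lookup c e) (nc (fmono t r e))) x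
      = (\<Sum>e\<in>E1. ev (sc (Poly_Mapping.lookup c e) (nc (fmono t r e))) x)"
      using fm(1) E1f by (intro ev_sum[where G=Gc]) (auto intro!: FN_sc)
    also have "\<dots> = (\<Sum>e\<in>E1. Poly_Mapping.lookup c e * (\<Prod>q\<in>Poly_Mapping.keys e. Th q (X x) ^ Poly_Mapping.lookup e q))"
      using fm(3) E1f by (intro sum.cong) auto
    finally show ?thesis using sy[of x] by (simp add: tp)
  qed
  define n where "n = Max (insert 0 (\<Union>e\<in>E. Poly_Mapping.keys e))"
  have fk: "finite (insert 0 (\<Union>e\<in>E. Poly_Mapping.keys e))" using E by auto
  have keyn: "1 \<le> q \<and> q \<le> n" if "e \<in> E" "q \<in> Poly_Mapping.keys e" for e q
  proof -
    have "q \<in> cindex t r" using that c by (auto simp: E_def)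
    moreover have "q \<le> n" unfolding n_def by (rule Max_ge[OF fk]) (use that in auto)
    ultimately show ?thesis by (simp add: cindex_iff)
  qed
  have okn: "ok k" if "k < n" for k
  proof -
    have "n \<in> insert 0 (\<Union>e\<in>E. Poly_Mapping.keys e)" unfolding n_def by (rule Max_in[OF fk]) simp
    then have "n \<in> cindex t r" using that c by (auto simp: E_def)
    then show ?thesis using cindex_ok that by blast
  qed
  \<comment> \<open>Exponent vectors become multisets, the form in which
    \<open>mset_poly_zero\<close> handles monomials.\<close>
  define me where "me e = (\<Sum>q\<in>Poly_Mapping.keys e. replicate_mset (Poly_Mapping.lookup e q) q)" for e :: "nat \<Rightarrow>\<^sub>0 nat"
  have cme: "count (me e) q = Poly_Mapping.lookup e q" for e q
    by (simp add: me_def count_sum in_keys_iff)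
  have inj: "inj me"
    by (rule injI, rule poly_mapping_eqI) (metis cme)
  have pme: "(\<Prod>q\<in>#me e. y q) = (\<Prod>q\<in>Poly_Mapping.keys e. (y q :: complex) ^ Poly_Mapping.lookup e q)" for e y
  proof -
    have "(\<Prod>q\<in>#(\<Sum>q\<in>F. replicate_mset (Poly_Mapping.lookup e q) q). y q) = (\<Prod>q\<in>F. y q ^ Poly_Mapping.lookup e q)"
      if "finite F" for F using that by (induction F rule: finite_induct) auto
    then show ?thesis by (simp add: me_def)
  qed
  have "Poly_Mapping.lookup c (inv me (me e0)) = 0"
  proof (rule mset_poly_zero[of "me ` E1" "\<lambda>m. Poly_Mapping.lookup c (inv me m)"])
    show "finite (me ` E1)" using E1f by simp
    show "me e0 \<in> me ` E1" using e0 by simp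
    fix y :: "nat \<Rightarrow> complex" assume "\<And>q. y q \<noteq> 0"
    then obtain x where x: "\<forall>q. 1 \<le> q \<longrightarrow> q \<le> n \<longrightarrow> Th q (X x) = y q" using prescribe_Th[of n y, OF okn] by blast
    have "(\<Sum>m\<in>me ` E1. Poly_Mapping.lookup c (inv me m) * (\<Prod>q\<in>#m. y q))
       = (\<Sum>e\<in>E1. Poly_Mapping.lookup c e * (\<Prod>q\<in>#me e. y q))"
      using inj by (subst sum.reindex) (auto intro: inj_on_subset simp: inv_f_f)
    also have "\<dots> = (\<Sum>e\<in>E1. Poly_Mapping.lookup c e * (\<Prod>q\<in>Poly_Mapping.keys e. Th q (X x) ^ Poly_Mapping.lookup e q))"
    proof (rule sum.cong[OF refl])
      fix e assume "e \<in> E1"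
      then have "Th q (X x) = y q" if "q \<in> Poly_Mapping.keys e" for q using keyn[of e q] that x E1f by auto
      then show "Poly_Mapping.lookup c e * (\<Prod>q\<in>#me e. y q)
         = Poly_Mapping.lookup c e * (\<Prod>q\<in>Poly_Mapping.keys e. Th q (X x) ^ Poly_Mapping.lookup e q)"
        unfolding pme by simp
    qed
    finally show "(\<Sum>m\<in>me ` E1. Poly_Mapping.lookup c (inv me m) * (\<Prod>q\<in>#m. y q)) = 0" using s0 by simp
  qed
  then have "Poly_Mapping.lookup c e0 = 0" using inj by (simp add: inv_f_f)
  moreover have "e0 \<in> Poly_Mapping.keys c" using e0 by (auto simp: E1_def E_def)
  ultimately show False by (simp add: in_keys_iff)
qed

end

theorem theorem2p6:
  fixes t :: rtype and r :: "int rel"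
  assumes "admissible t r"
  shows "(\<forall>z \<in> FA (Gens t r).
            z \<in> Zc t r \<longleftrightarrow> (\<exists>y \<in> falg (cgen t r ` cindex t r). fsub z y \<in> UJ t r))
       \<and> (\<forall>c. (\<forall>e \<in> Poly_Mapping.keys c. Poly_Mapping.keys e \<subseteq> cindex t r) \<longrightarrow> peval t r c \<in> UJ t r \<longrightarrow> c = 0)"
proof -
  interpret nilrad t r by standard (rule assms)
  have sub: "fsub z y \<in> UJ t r \<longleftrightarrow> nc z - nc y \<in> J" for z y
    by (simp add: UJ_def idl_nc[symmetric] nc_simps)
  show ?thesis
  proof (intro conjI ballI allI impI)
    fix z assume "z \<in> FA (Gens t r)"
    then have "central (nc z) \<longleftrightarrow> (\<exists>y\<in>Alg. nc z - y \<in> J)" by (intro central_iff) (simp add: FN_nc)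
    then show "z \<in> Zc t r \<longleftrightarrow> (\<exists>y \<in> falg (cgen t r ` cindex t r). fsub z y \<in> UJ t r)"
      by (simp add: Zc_central Alg_def sub)
  next
    fix c assume "\<forall>e \<in> Poly_Mapping.keys c. Poly_Mapping.keys e \<subseteq> cindex t r" "peval t r c \<in> UJ t r"
    then show "c = 0" by (intro independent) (auto simp: UJ_def idl_nc)
  qed
qed

end
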